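(* For every $\phi\in\operatorname{Hom}^+(\mathcal{A}^0,\mathbb{R})$ (where $\mathcal{A}^0$ is the flag algebra of unlabelled tournaments), we have $$\boldsymbol{\phi^A}(\vec C_3^A)=\frac14\quad\text{almost surely}$$ if and only if $\phi$ is the quasi-random homomorphism $\phi_{\mathrm{qr}}$.
   Context: A tournament is a finite set $V(T)$ together with, for each pair of distinct vertices $u,v$, exactly one of the arcs $\langle u,v\rangle$ (''$u$ beats $v$''), $\langle v,u\rangle$. Types and flags. Let $\sigma$ be either the empty type $0$ (with $|\sigma|=0$) or the type $A$ (with $|\sigma|=2$), where $A$ is the tournament on vertices labelled $1,2$ in which $1$ beats $2$. A $\sigma$-flag is a tournament together with an embedding of $\sigma$ into it: a $0$-flag is just a tournament, and an $A$-flag is a tournament with two distinguished vertices labelled $1$ and $2$ such that $1$ beats $2$. Isomorphisms of flags must preserve labels. $\mathcal{F}^\sigma$ is the set of isomorphism classes of finite $\sigma$-flags and $\mathcal{F}^\sigma_\ell$ those with $\ell$ vertices in total. For $F\in\mathcal{F}^\sigma_\ell$ and a $\sigma$-flag $G$ with at least $\ell$ vertices, $p(F,G)$ is the probability that a uniformly random $\ell$-element set of vertices of $G$ containing all labelled vertices induces a $\sigma$-flag isomorphic to $F$. For $F_i\in\mathcal{F}^\sigma_{\ell_i}$ ($i=1,2$) and $G$ with at least $\ell_1+\ell_2-|\sigma|$ vertices, $p(F_1,F_2;G)$ is the probability that a uniformly random pair of vertex sets of sizes $\ell_1,\ell_2$ whose intersection is exactly the set of labelled vertices induces $\sigma$-flags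 isomorphic to $F_1$ and $F_2$, respectively. Flag algebras. $\mathcal{A}^\sigma$ is the quotient of the real vector space with basis $\mathcal{F}^\sigma$ by the subspace spanned by all $F-\sum_{G\in\mathcal{F}^\sigma_m}p(F,G)G$ with $F\in\mathcal{F}^\sigma_\ell$, $m\geq\ell$. It is a commutative algebra with product induced by $F_1\cdot F_2=\sum_{G\in\mathcal{F}^\sigma_m}p(F_1,F_2;G)G$ for any $m\geq \ell_1+\ell_2-|\sigma|$ (well defined in the quotient); its unit $1_\sigma$ is the flag with $|\sigma|$ vertices. $\operatorname{Hom}^+(\mathcal{A}^\sigma,\mathbb{R})$ is the set of unital real algebra homomorphisms $\psi:\mathcal{A}^\sigma\to\mathbb{R}$ with $\psi(F)\geq0$ for all $F\in\mathcal{F}^\sigma$, viewed as a compact subset of $[0,1]^{\mathcal{F}^\sigma}$ with the product topology and its Borel $\sigma$-algebra. (Elements of $\operatorname{Hom}^+(\mathcal{A}^0,\mathbb{R})$ are exactly the functionals $\phi(T)=\lim_{n\to\infty}p(T,T_n)$ for sequences $\{T_n\}$ of tournaments with $|V(T_n)|\to\infty$ for which all these limits exist.) Downward operator and extensions. For an $A$-flag $F$ with underlying unlabelled tournament $M$, let $\llbracket F\rrbracket_A = q(F)\,M\in\mathcal{A}^0$, where $q(F)$ is the probability that a uniformly random ordered pair of distinct vertices of $M$, labelled $1$ and $2$ in order, turns $M$ into an $A$-flag isomorphic to $F$; this extends to a linear map $\llbracket\cdot\rrbracket_A:\mathcal{A}^A\to\mathcal{A}^0$, and $\llbracket 1_A\rrbracket_A=\frac12\cdot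 1$, where $1$ is the unit of $\mathcal{A}^0$. For $\phi\in\operatorname{Hom}^+(\mathcal{A}^0,\mathbb{R})$, $\boldsymbol{\phi^A}$ denotes the random variable with values in $\operatorname{Hom}^+(\mathcal{A}^A,\mathbb{R})$, unique in distribution, such that $\mathbf{E}[\boldsymbol{\phi^A}(F)]=\phi(\llbracket F\rrbracket_A)/\phi(\llbracket 1_A\rrbracket_A)$ for every $F\in\mathcal{F}^A$. The flag $\vec C_3^A$ is the $A$-flag on three vertices whose underlying tournament is the directed $3$-cycle, i.e. the unlabelled vertex beats vertex $1$ and is beaten by vertex $2$ (and $1$ beats $2$). The quasi-random homomorphism $\phi_{\mathrm{qr}}\in\operatorname{Hom}^+(\mathcal{A}^0,\mathbb{R})$ is the almost sure limit of uniformly random tournaments (each arc orientation picked independently with probability $1/2$) as the number of vertices goes to infinity; explicitly, $\phi_{\mathrm{qr}}(T)=\dfrac{|V(T)|!}{|\operatorname{Aut}(T)|\cdot 2^{\binom{|V(T)|}{2}}}$ for every tournament $T$, where $\operatorname{Aut}(T)$ is the automorphism group of $T$. *)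

theory Defs
  imports "HOL-Probability.Probability" "HOL-Analysis.Finite_Function_Topology"
    "HOL-Combinatorics.Permutations"
begin

section \<open>Tournaments, types and flags\<close>

definition tournament :: "'v set \<Rightarrow> ('v \<times> 'v) set \<Rightarrow> bool" where
  "tournament V E \<longleftrightarrow> finite V \<and> E \<subseteq> V \<times> V \<and> (\<forall>u\<in>V. (u, u) \<notin> E) \<and>
     (\<forall>u\<in>V. \<forall>v\<in>V. u \<noteq> v \<longrightarrow> ((u, v) \<in> E) \<noteq> ((v, u) \<in> E))"

text \<open>
  A type \<open>\<sigma>\<close> is represented by an Isabelle type \<open>'s\<close> that carries a tournament on the label set
  \<open>{..<type_size TYPE('s)}\<close>, so that flags and flag algebras over different types \<open>\<sigma>\<close> have
  different Isabelle types. Labels are counted from \<open>0\<close>: the labels 1 and 2 of the type \<open>A\<close>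
  are the indices \<open>0\<close> and \<open>1\<close>.
\<close>

class tournament_type =
  fixes type_size :: "'a itself \<Rightarrow> nat"
    and type_arcs :: "'a itself \<Rightarrow> (nat \<times> nat) set"
  assumes tournament_type: "tournament {..<type_size TYPE('a)} (type_arcs TYPE('a))"

datatype ty_0 = Ty_0
datatype ty_A = Ty_A

instantiation ty_0 :: tournament_type
begin
definition "type_size (_ :: ty_0 itself) = 0"
definition "type_arcs (_ :: ty_0 itself) = {}"
instance by standard (auto simp: tournament_def type_size_ty_0_def type_arcs_ty_0_def)
end

instantiation ty_A :: tournament_type
begin
definition "type_size (_ :: ty_A itself) = 2"
definition "type_arcs (_ :: ty_A itself) = {(0, 1)}"
instance by standard (auto simp: tournament_def type_size_ty_A_def type_arcs_ty_A_def)
end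

text \<open>The list \<open>ls\<close> is the embedding of \<open>\<sigma>\<close>: label \<open>i\<close> sits at the vertex \<open>ls ! i\<close>.\<close>

definition is_flag ::
  "'s::tournament_type itself \<Rightarrow> 'v set \<Rightarrow> ('v \<times> 'v) set \<Rightarrow> 'v list \<Rightarrow> bool" where
  "is_flag s V E ls \<longleftrightarrow> tournament V E \<and>
     length ls = type_size s \<and> distinct ls \<and> set ls \<subseteq> V \<and>
     (\<forall>i<type_size s. \<forall>j<type_size s. (ls ! i, ls ! j) \<in> E \<longleftrightarrow> (i, j) \<in> type_arcs s)"

text \<open>Concrete flags have finite sets of natural numbers as vertex sets; \<open>flag\<close> is the type of
  isomorphism classes.\<close>

typedef (overloaded) ('s::tournament_type) cflag =
  "{(V :: nat set, E, ls). is_flag TYPE('s) V E ls}"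
proof
  show "({..<type_size TYPE('s)}, type_arcs TYPE('s), [0..<type_size TYPE('s)])
    \<in> {(V, E, ls). is_flag TYPE('s) V E ls}"
    using tournament_type[where 'a = 's] by (auto simp: is_flag_def)
qed

definition verts :: "'s::tournament_type cflag \<Rightarrow> nat set" where
  "verts F = fst (Rep_cflag F)"

definition arcs :: "'s::tournament_type cflag \<Rightarrow> (nat \<times> nat) set" where
  "arcs F = fst (snd (Rep_cflag F))"

definition labels :: "'s::tournament_type cflag \<Rightarrow> nat list" where
  "labels F = snd (snd (Rep_cflag F))"

definition flag_isomorphism ::
  "'s::tournament_type cflag \<Rightarrow> 's cflag \<Rightarrow> (nat \<Rightarrow> nat) \<Rightarrow> bool" where
  "flag_isomorphism F G f \<longleftrightarrow> bij_betw f (verts F) (verts G) \<and>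
     (\<forall>u\<in>verts F. \<forall>v\<in>verts F. (f u, f v) \<in> arcs G \<longleftrightarrow> (u, v) \<in> arcs F) \<and>
     map f (labels F) = labels G"

definition flag_iso :: "'s::tournament_type cflag \<Rightarrow> 's cflag \<Rightarrow> bool" where
  "flag_iso F G \<longleftrightarrow> (\<exists>f. flag_isomorphism F G f)"

lemma is_flag_cflag: "is_flag TYPE('s) (verts F) (arcs F) (labels (F :: 's::tournament_type cflag))"
  using Rep_cflag[of F] by (auto simp: verts_def arcs_def labels_def)

lemma labels_subset: "set (labels F) \<subseteq> verts F"
  and finite_verts: "finite (verts F)"
  and arcs_subset: "arcs F \<subseteq> verts F \<times> verts F"
  using is_flag_cflag[of F] by (auto simp: is_flag_def tournament_def)

lemma flag_isomorphism_sym: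
  assumes "flag_isomorphism F G f"
  shows "flag_isomorphism G F (inv_into (verts F) f)"
proof -
  let ?g = "inv_into (verts F) f"
  have bij: "bij_betw f (verts F) (verts G)"
    and arc: "\<And>u v. u \<in> verts F \<Longrightarrow> v \<in> verts F \<Longrightarrow> (f u, f v) \<in> arcs G \<longleftrightarrow> (u, v) \<in> arcs F"
    and lab: "map f (labels F) = labels G"
    using assms by (auto simp: flag_isomorphism_def)
  have g: "?g y \<in> verts F" "f (?g y) = y" if "y \<in> verts G" for y
    using that bij by (auto simp: bij_betw_def inv_into_into f_inv_into_f)
  have "map ?g (labels G) = map (\<lambda>x. ?g (f x)) (labels F)"
    by (simp flip: lab add: comp_def)
  also have "\<dots> = labels F"
    using labels_subset[of F] bij by (intro map_idI) (auto simp: bij_betw_def)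
  finally have "map ?g (labels G) = labels F" .
  moreover have "(?g u, ?g v) \<in> arcs F \<longleftrightarrow> (u, v) \<in> arcs G" if "u \<in> verts G" "v \<in> verts G" for u v
    using arc[OF g(1) g(1), OF that] g(2) that by simp
  ultimately show ?thesis
    using bij_betw_inv_into[OF bij] by (simp add: flag_isomorphism_def)
qed

lemma flag_isomorphism_trans:
  assumes "flag_isomorphism F G f" "flag_isomorphism G H g"
  shows "flag_isomorphism F H (g \<circ> f)"
proof -
  have "\<And>u. u \<in> verts F \<Longrightarrow> f u \<in> verts G"
    using assms(1) by (auto simp: flag_isomorphism_def bij_betw_def)
  thus ?thesis
    using assms by (auto simp: flag_isomorphism_def intro: bij_betw_trans simp flip: map_map)
qed

lemma flag_isomorphism_cong:
  assumes "flag_isomorphism F G f" "\<And>x. x \<in> verts F \<Longrightarrow> g x = f x"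
  shows "flag_isomorphism F G g"
proof -
  have "map g (labels F) = map f (labels F)"
    using assms(2) labels_subset[of F] by (intro map_cong) auto
  moreover have "bij_betw g (verts F) (verts G) \<longleftrightarrow> bij_betw f (verts F) (verts G)"
    using assms(2) by (rule bij_betw_cong)
  ultimately show ?thesis
    using assms unfolding flag_isomorphism_def by metis
qed

lemma equivp_flag_iso: "equivp flag_iso"
proof (rule equivpI)
  show "reflp flag_iso"
    by (rule reflpI) (auto simp: flag_iso_def flag_isomorphism_def intro!: exI[of _ id])
  show "symp flag_iso"
    by (rule sympI) (use flag_isomorphism_sym in \<open>auto simp: flag_iso_def\<close>)
  show "transp flag_iso"
    by (rule transpI) (use flag_isomorphism_trans in \<open>fastforce simp: flag_iso_def\<close>)
qed

quotient_type (overloaded) 's flag = "'s::tournament_type cflag" / flag_iso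
  morphisms rep_flag flag_class
  by (rule equivp_flag_iso)

lemma flag_cases [cases type: flag]:
  obtains (abs_flag) G where "F = flag_class G"
  by (rule that[of "rep_flag F"]) (simp add: Quotient3_abs_rep[OF Quotient3_flag])

lemma flag_class_eq_iff: "flag_class F = flag_class G \<longleftrightarrow> flag_iso F G"
  by (rule flag.abs_eq_iff)

lift_definition flag_size :: "'s::tournament_type flag \<Rightarrow> nat" is "\<lambda>F. card (verts F)"
  by (auto simp: flag_iso_def flag_isomorphism_def dest: bij_betw_same_card)

definition unit_flag :: "'s::tournament_type flag" where
  "unit_flag = flag_class (Abs_cflag
     ({..<type_size TYPE('s)}, type_arcs TYPE('s), [0..<type_size TYPE('s)]))"


section \<open>Densities\<close>

definition induced :: "'s::tournament_type cflag \<Rightarrow> nat set \<Rightarrow> 's cflag" where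
  "induced G W = Abs_cflag (W, arcs G \<inter> W \<times> W, labels G)"

definition flag_sets :: "nat \<Rightarrow> 's::tournament_type cflag \<Rightarrow> nat set set" where
  "flag_sets l G = {W. set (labels G) \<subseteq> W \<and> W \<subseteq> verts G \<and> card W = l}"

definition flag_set_pairs ::
  "nat \<Rightarrow> nat \<Rightarrow> 's::tournament_type cflag \<Rightarrow> (nat set \<times> nat set) set" where
  "flag_set_pairs l1 l2 G =
     {(W1, W2). W1 \<subseteq> verts G \<and> W2 \<subseteq> verts G \<and> card W1 = l1 \<and> card W2 = l2 \<and>
                W1 \<inter> W2 = set (labels G)}"

definition label_tuples :: "'s::tournament_type cflag \<Rightarrow> nat list set" where
  "label_tuples F = {ls. length ls = type_size TYPE('s) \<and> distinct ls \<and> set ls \<subseteq> verts F}"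

definition automorphisms :: "'s::tournament_type cflag \<Rightarrow> (nat \<Rightarrow> nat) set" where
  "automorphisms F = {f. f permutes verts F \<and> flag_isomorphism F F f}"

lemma cflag_Abs:
  assumes "is_flag TYPE('s::tournament_type) V E ls"
  shows "verts (Abs_cflag (V, E, ls) :: 's cflag) = V"
    "arcs (Abs_cflag (V, E, ls) :: 's cflag) = E"
    "labels (Abs_cflag (V, E, ls) :: 's cflag) = ls"
  using assms by (simp_all add: verts_def arcs_def labels_def Abs_cflag_inverse)

lemma tournament_restrict:
  assumes "tournament V E" "W \<subseteq> V" shows "tournament W (E \<inter> W \<times> W)"
  unfolding tournament_def
proof (intro conjI ballI impI)
  show "finite W" using assms by (meson finite_subset tournament_def)
  show "E \<inter> W \<times> W \<subseteq> W \<times> W" by blast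
  show "(u, u) \<notin> E \<inter> W \<times> W" if "u \<in> W" for u
    using assms that unfolding tournament_def by blast
  fix u v assume uv: "u \<in> W" "v \<in> W" "u \<noteq> v"
  hence "((u, v) \<in> E) \<noteq> ((v, u) \<in> E)"
    using assms unfolding tournament_def by (meson subsetD)
  thus "((u, v) \<in> E \<inter> W \<times> W) \<noteq> ((v, u) \<in> E \<inter> W \<times> W)"
    using uv by blast
qed

lemma is_flag_induced:
  assumes "set (labels G) \<subseteq> W" "W \<subseteq> verts (G :: 's::tournament_type cflag)"
  shows "is_flag TYPE('s) W (arcs G \<inter> W \<times> W) (labels G)"
proof -
  have "labels G ! i \<in> W" if "i < type_size TYPE('s)" for i
    using that assms(1) is_flag_cflag[of G] by (simp add: is_flag_def subset_iff)
  moreover have "tournament W (arcs G \<inter> W \<times> W)"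
    using is_flag_cflag[of G] assms(2) by (auto simp: is_flag_def intro: tournament_restrict)
  ultimately show ?thesis
    using is_flag_cflag[of G] assms(1) by (simp add: is_flag_def)
qed

lemma induced_simps:
  assumes "set (labels G) \<subseteq> W" "W \<subseteq> verts G"
  shows "verts (induced G W) = W" "arcs (induced G W) = arcs G \<inter> W \<times> W"
    "labels (induced G W) = labels G"
  unfolding induced_def using cflag_Abs[OF is_flag_induced[OF assms]] by auto

lemma flag_isomorphism_induced:
  assumes "flag_isomorphism F G f" "set (labels F) \<subseteq> W" "W \<subseteq> verts F"
  shows "flag_iso (induced F W) (induced G (f ` W))"
proof -
  have "set (labels G) = f ` set (labels F)"
    using assms(1) by (auto simp: flag_isomorphism_def simp flip: set_map)
  hence 1: "set (labels G) \<subseteq> f ` W" using assms(2) by auto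
  have 2: "f ` W \<subseteq> verts G"
    using assms(1,3) by (auto simp: flag_isomorphism_def bij_betw_def)
  have "flag_isomorphism (induced F W) (induced G (f ` W)) f"
    using assms(1,3) unfolding flag_isomorphism_def
      induced_simps[OF assms(2,3)] induced_simps[OF 1 2]
    by (auto simp: bij_betw_def intro: inj_on_subset)
  thus ?thesis by (auto simp: flag_iso_def)
qed

lemma flag_isomorphism_class:
  assumes "flag_isomorphism F G f" "set (labels F) \<subseteq> W" "W \<subseteq> verts F"
  shows "flag_class (induced G (f ` W)) = flag_class (induced F W)"
  using flag_isomorphism_induced[OF assms] by (metis flag_class_eq_iff)

lemma flag_isomorphism_labels:
  assumes "flag_isomorphism F G f" shows "set (labels G) = f ` set (labels F)"
  using assms by (auto simp: flag_isomorphism_def simp flip: set_map)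

lemma flag_isomorphism_flag_sets:
  assumes "flag_isomorphism F G f"
  shows "bij_betw ((`) f) (flag_sets l F) (flag_sets l G)"
proof -
  have b: "bij_betw f (verts F) (verts G)" using assms by (simp add: flag_isomorphism_def)
  have sub: "(`) f ` flag_sets l F \<subseteq> flag_sets l G" if "flag_isomorphism F G f"
    for f and F G :: "'a cflag"
  proof -
    have "inj_on f (verts F)" "f ` verts F = verts G"
      using that by (auto simp: flag_isomorphism_def bij_betw_def)
    moreover from this have "card (f ` W) = card W" if "W \<subseteq> verts F" for W
      using that by (meson card_image inj_on_subset)
    ultimately show ?thesis
      using flag_isomorphism_labels[OF that]
      by (auto simp: flag_sets_def simp flip: \<open>f ` verts F = verts G\<close>)
  qed
  let ?g = "inv_into (verts F) f"
  show ?thesis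
  proof (rule bij_betw_byWitness[where f' = "(`) ?g"])
    show "\<forall>W\<in>flag_sets l F. ?g ` f ` W = W"
      using b by (auto simp: flag_sets_def bij_betw_def inv_into_image_cancel)
    show "\<forall>W\<in>flag_sets l G. f ` ?g ` W = W"
      using b by (auto simp: flag_sets_def bij_betw_def image_inv_into_cancel)
    show "(`) f ` flag_sets l F \<subseteq> flag_sets l G" by (rule sub[OF assms])
    show "(`) ?g ` flag_sets l G \<subseteq> flag_sets l F"
      by (rule sub[OF flag_isomorphism_sym[OF assms]])
  qed
qed

lemma flag_isomorphism_flag_set_pairs:
  assumes "flag_isomorphism F G f"
  shows "bij_betw (map_prod ((`) f) ((`) f)) (flag_set_pairs l1 l2 F) (flag_set_pairs l1 l2 G)"
proof -
  have b: "bij_betw f (verts F) (verts G)" using assms by (simp add: flag_isomorphism_def)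
  have sub: "map_prod ((`) f) ((`) f) ` flag_set_pairs l1 l2 F \<subseteq> flag_set_pairs l1 l2 G"
    if "flag_isomorphism F G f" for f and F G :: "'a cflag"
  proof -
    have inj: "inj_on f (verts F)" and img: "f ` verts F = verts G"
      using that by (auto simp: flag_isomorphism_def bij_betw_def)
    have c: "card (f ` W) = card W" if "W \<subseteq> verts F" for W
      using that inj by (meson card_image inj_on_subset)
    have i: "f ` W1 \<inter> f ` W2 = set (labels G)"
      if "W1 \<subseteq> verts F" "W2 \<subseteq> verts F" "W1 \<inter> W2 = set (labels F)" for W1 W2
      using inj_on_image_Int[OF inj that(1,2)] that(3) flag_isomorphism_labels[OF \<open>flag_isomorphism F G f\<close>]
      by simp
    show ?thesis
    proof
      fix p assume "p \<in> map_prod ((`) f) ((`) f) ` flag_set_pairs l1 l2 F"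
      then obtain W1 W2 where "p = (f ` W1, f ` W2)" "(W1, W2) \<in> flag_set_pairs l1 l2 F"
        by auto
      thus "p \<in> flag_set_pairs l1 l2 G"
        using c[of W1] c[of W2] i[of W1 W2]
        by (auto simp: flag_set_pairs_def simp flip: img)
    qed
  qed
  let ?g = "inv_into (verts F) f"
  show ?thesis
  proof (rule bij_betw_byWitness[where f' = "map_prod ((`) ?g) ((`) ?g)"])
    show "\<forall>p\<in>flag_set_pairs l1 l2 F. map_prod ((`) ?g) ((`) ?g) (map_prod ((`) f) ((`) f) p) = p"
      using b by (auto simp: flag_set_pairs_def bij_betw_def inv_into_image_cancel)
    show "\<forall>p\<in>flag_set_pairs l1 l2 G. map_prod ((`) f) ((`) f) (map_prod ((`) ?g) ((`) ?g) p) = p"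
      using b by (auto simp: flag_set_pairs_def bij_betw_def image_inv_into_cancel)
    show "map_prod ((`) f) ((`) f) ` flag_set_pairs l1 l2 F \<subseteq> flag_set_pairs l1 l2 G"
      by (rule sub[OF assms])
    show "map_prod ((`) ?g) ((`) ?g) ` flag_set_pairs l1 l2 G \<subseteq> flag_set_pairs l1 l2 F"
      by (rule sub[OF flag_isomorphism_sym[OF assms]])
  qed
qed

lemma bij_betw_card_filter:
  assumes "bij_betw h A B" "\<And>x. x \<in> A \<Longrightarrow> P x \<longleftrightarrow> Q (h x)"
  shows "card {x \<in> A. P x} = card {y \<in> B. Q y}"
proof -
  have "bij_betw h {x \<in> A. P x} {y \<in> B. Q y}"
    using assms by (auto simp: bij_betw_def inj_on_def)
  thus ?thesis by (rule bij_betw_same_card)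
qed

text \<open>The argument \<open>F\<close> of \<open>flag_density F G\<close> is the (isomorphism class of the) small flag.\<close>

lift_definition flag_density :: "'s::tournament_type flag \<Rightarrow> 's flag \<Rightarrow> real" is
  "\<lambda>F G. real (card {W \<in> flag_sets (card (verts F)) G. flag_iso (induced G W) F}) /
         real (card (flag_sets (card (verts F)) G))"
proof -
  fix F F' G G' :: "'s cflag"
  assume "flag_iso F F'" and "flag_iso G G'"
  then obtain f where f: "flag_isomorphism G G' f" by (auto simp: flag_iso_def)
  have c: "card (verts F) = card (verts F')"
    using \<open>flag_iso F F'\<close> by (auto simp: flag_iso_def flag_isomorphism_def dest: bij_betw_same_card)
  note bij = flag_isomorphism_flag_sets[OF f, of "card (verts F')"]
  have FF': "flag_class F = flag_class F'"
    using \<open>flag_iso F F'\<close> by (simp add: flag_class_eq_iff)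
  have "flag_iso (induced G W) F \<longleftrightarrow> flag_iso (induced G' (f ` W)) F'"
    if "W \<in> flag_sets (card (verts F')) G" for W
    using flag_isomorphism_class[OF f, of W] that FF'
    by (auto simp: flag_sets_def simp flip: flag_class_eq_iff)
  hence "card {W \<in> flag_sets (card (verts F')) G. flag_iso (induced G W) F} =
      card {W \<in> flag_sets (card (verts F')) G'. flag_iso (induced G' W) F'}"
    by (intro bij_betw_card_filter[OF bij])
  with bij_betw_same_card[OF bij]
  show "real (card {W \<in> flag_sets (card (verts F)) G. flag_iso (induced G W) F}) /
         real (card (flag_sets (card (verts F)) G)) =
        real (card {W \<in> flag_sets (card (verts F')) G'. flag_iso (induced G' W) F'}) /
         real (card (flag_sets (card (verts F')) G'))"
    unfolding c by simp
qed

lift_definition joint_density ::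
  "'s::tournament_type flag \<Rightarrow> 's flag \<Rightarrow> 's flag \<Rightarrow> real" is
  "\<lambda>F1 F2 G.
     real (card {p \<in> flag_set_pairs (card (verts F1)) (card (verts F2)) G.
                   flag_iso (induced G (fst p)) F1 \<and> flag_iso (induced G (snd p)) F2}) /
     real (card (flag_set_pairs (card (verts F1)) (card (verts F2)) G))"
proof -
  fix F1 F1' F2 F2' G G' :: "'s cflag"
  assume F1: "flag_iso F1 F1'" and F2: "flag_iso F2 F2'" and "flag_iso G G'"
  then obtain f where f: "flag_isomorphism G G' f" by (auto simp: flag_iso_def)
  have c: "card (verts F1) = card (verts F1')" "card (verts F2) = card (verts F2')"
    using F1 F2 by (auto simp: flag_iso_def flag_isomorphism_def dest: bij_betw_same_card)
  note bij = flag_isomorphism_flag_set_pairs[OF f, of "card (verts F1')" "card (verts F2')"]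
  have FF': "flag_class F1 = flag_class F1'" "flag_class F2 = flag_class F2'"
    using F1 F2 by (simp_all add: flag_class_eq_iff)
  have "flag_iso (induced G (fst p)) F1 \<and> flag_iso (induced G (snd p)) F2 \<longleftrightarrow>
        flag_iso (induced G' (fst (map_prod ((`) f) ((`) f) p))) F1' \<and>
        flag_iso (induced G' (snd (map_prod ((`) f) ((`) f) p))) F2'"
    if "p \<in> flag_set_pairs (card (verts F1')) (card (verts F2')) G" for p
  proof -
    obtain W1 W2 where p: "p = (W1, W2)" by fastforce
    have "set (labels G) \<subseteq> W1" "W1 \<subseteq> verts G" "set (labels G) \<subseteq> W2" "W2 \<subseteq> verts G"
      using that by (auto simp: p flag_set_pairs_def)
    thus ?thesis
      using flag_isomorphism_class[OF f, of W1] flag_isomorphism_class[OF f, of W2] FF'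
      by (auto simp: p simp flip: flag_class_eq_iff)
  qed
  hence "card {p \<in> flag_set_pairs (card (verts F1')) (card (verts F2')) G.
                   flag_iso (induced G (fst p)) F1 \<and> flag_iso (induced G (snd p)) F2} =
      card {p \<in> flag_set_pairs (card (verts F1')) (card (verts F2')) G'.
                   flag_iso (induced G' (fst p)) F1' \<and> flag_iso (induced G' (snd p)) F2'}"
    by (intro bij_betw_card_filter[OF bij])
  with bij_betw_same_card[OF bij]
  show "real (card {p \<in> flag_set_pairs (card (verts F1)) (card (verts F2)) G.
                   flag_iso (induced G (fst p)) F1 \<and> flag_iso (induced G (snd p)) F2}) /
     real (card (flag_set_pairs (card (verts F1)) (card (verts F2)) G)) =
     real (card {p \<in> flag_set_pairs (card (verts F1')) (card (verts F2')) G'.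
                   flag_iso (induced G' (fst p)) F1' \<and> flag_iso (induced G' (snd p)) F2'}) /
     real (card (flag_set_pairs (card (verts F1')) (card (verts F2')) G'))"
    unfolding c by simp
qed

lift_definition automorphism_count :: "'s::tournament_type flag \<Rightarrow> nat" is
  "\<lambda>F. card (automorphisms F)"
proof -
  have le: "card (automorphisms F) \<le> card (automorphisms G)"
    if f: "flag_isomorphism F G f" for F G :: "'s cflag" and f
  proof (rule card_inj_on_le)
    let ?g = "inv_into (verts F) f"
    let ?c = "\<lambda>h x. if x \<in> verts G then f (h (?g x)) else x"
    have bf: "bij_betw f (verts F) (verts G)" using f by (simp add: flag_isomorphism_def)
    show "finite (automorphisms G)"
      unfolding automorphisms_def
      by (rule finite_subset[OF _ finite_permutations[OF finite_verts[of G]]]) auto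
    show "?c ` automorphisms F \<subseteq> automorphisms G"
    proof safe
      fix h assume "h \<in> automorphisms F"
      hence h: "flag_isomorphism F F h" by (simp add: automorphisms_def)
      have i: "flag_isomorphism G G (f \<circ> (h \<circ> ?g))"
        using flag_isomorphism_trans[OF flag_isomorphism_trans[OF flag_isomorphism_sym[OF f] h] f] .
      have i': "flag_isomorphism G G (?c h)"
        by (rule flag_isomorphism_cong[OF i]) simp
      have "?c h permutes verts G"
        using i' by (intro bij_imp_permutes) (auto simp: flag_isomorphism_def)
      with i' show "?c h \<in> automorphisms G" by (simp add: automorphisms_def)
    qed
    show "inj_on ?c (automorphisms F)"
    proof (rule inj_onI)
      fix h h' assume h: "h \<in> automorphisms F" "h' \<in> automorphisms F" and eq: "?c h = ?c h'"
      show "h = h'"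
      proof
        fix x
        show "h x = h' x"
        proof (cases "x \<in> verts F")
          case True
          have "f x \<in> verts G" using True bf by (auto simp: bij_betw_def)
          hence "f (h x) = f (h' x)"
            using fun_cong[OF eq, of "f x"] True bf by (simp add: bij_betw_def)
          moreover have "h x \<in> verts F" "h' x \<in> verts F"
            using h True by (auto simp: automorphisms_def permutes_in_image)
          ultimately show ?thesis using bf by (auto simp: bij_betw_def inj_on_def)
        next
          case False
          thus ?thesis using h by (auto simp: automorphisms_def permutes_def)
        qed
      qed
    qed
  qed
  fix F G :: "'s cflag"
  assume "flag_iso F G"
  then obtain f where "flag_isomorphism F G f" by (auto simp: flag_iso_def)
  with le[OF this] le[OF flag_isomorphism_sym[OF this]]
  show "card (automorphisms F) = card (automorphisms G)" by simp
qed

definition unlabelled :: "'s::tournament_type cflag \<Rightarrow> ty_0 cflag" where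
  "unlabelled F = Abs_cflag (verts F, arcs F, [])"

definition relabelled :: "'s::tournament_type cflag \<Rightarrow> nat list \<Rightarrow> 's cflag" where
  "relabelled F ls = Abs_cflag (verts F, arcs F, ls)"

lemma is_flag_unlabelled:
  "is_flag TYPE(ty_0) (verts F) (arcs F) []"
  using is_flag_cflag[of F] by (auto simp: is_flag_def type_size_ty_0_def)

lemma unlabelled_simps:
  "verts (unlabelled F) = verts F" "arcs (unlabelled F) = arcs F" "labels (unlabelled F) = []"
  unfolding unlabelled_def using cflag_Abs[OF is_flag_unlabelled] by auto

lift_definition underlying :: "'s::tournament_type flag \<Rightarrow> ty_0 flag" is unlabelled
  by (auto simp: flag_iso_def flag_isomorphism_def unlabelled_simps)

text \<open>\<open>label_prob F\<close> is the probability \<open>q(F)\<close> used in the downward operator; tuples that do not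
  turn \<open>F\<close> into a \<open>\<sigma>\<close>-flag count as failures.\<close>

lift_definition label_prob :: "'s::tournament_type flag \<Rightarrow> real" is
  "\<lambda>F :: 's cflag. real (card {ls \<in> label_tuples F.
         is_flag TYPE('s) (verts F) (arcs F) ls \<and> flag_iso (relabelled F ls) F}) /
       real (card (label_tuples F))"
proof -
  fix F G :: "'s cflag"
  assume FG: "flag_iso F G"
  then obtain f where f: "flag_isomorphism F G f" by (auto simp: flag_iso_def)
  let ?g = "inv_into (verts F) f"
  have b: "bij_betw f (verts F) (verts G)" using f by (simp add: flag_isomorphism_def)
  have sub: "map f ` label_tuples F \<subseteq> label_tuples G" if "flag_isomorphism F G f"
    for f and F G :: "'s cflag"
  proof -
    have "inj_on f (verts F)" "f ` verts F = verts G"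
      using that by (auto simp: flag_isomorphism_def bij_betw_def)
    thus ?thesis
      using inj_on_subset[of f "verts F"] imageI[of _ "verts F" f]
      unfolding label_tuples_def by (auto simp: distinct_map subset_iff)
  qed
  have bij: "bij_betw (map f) (label_tuples F) (label_tuples G)"
  proof (rule bij_betw_byWitness[where f' = "map ?g"])
    show "\<forall>ls\<in>label_tuples F. map ?g (map f ls) = ls"
      using b by (auto simp: label_tuples_def bij_betw_def subset_iff intro!: map_idI)
    show "\<forall>ls\<in>label_tuples G. map f (map ?g ls) = ls"
      using b by (auto simp: label_tuples_def bij_betw_def subset_iff f_inv_into_f intro!: map_idI)
    show "map f ` label_tuples F \<subseteq> label_tuples G" by (rule sub[OF f])
    show "map ?g ` label_tuples G \<subseteq> label_tuples F"
      by (rule sub[OF flag_isomorphism_sym[OF f]])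
  qed
  have eq: "is_flag TYPE('s) (verts F) (arcs F) ls \<and> flag_iso (relabelled F ls) F \<longleftrightarrow>
        is_flag TYPE('s) (verts G) (arcs G) (map f ls) \<and> flag_iso (relabelled G (map f ls)) G"
    if ls: "ls \<in> label_tuples F" for ls
  proof -
    have l: "length ls = type_size TYPE('s)" "distinct ls" "set ls \<subseteq> verts F"
      and l': "length (map f ls) = type_size TYPE('s)" "distinct (map f ls)"
        "set (map f ls) \<subseteq> verts G"
      using ls image_subset_iff[THEN iffD1, OF sub[OF f], rule_format, OF ls]
      by (auto simp: label_tuples_def)
    have "ls ! i \<in> verts F" if "i < type_size TYPE('s)" for i
      using that l by (metis nth_mem subsetD)
    hence "(map f ls ! i, map f ls ! j) \<in> arcs G \<longleftrightarrow> (ls ! i, ls ! j) \<in> arcs F"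
      if "i < type_size TYPE('s)" "j < type_size TYPE('s)" for i j
      using that f l(1) by (simp add: flag_isomorphism_def)
    hence *: "is_flag TYPE('s) (verts F) (arcs F) ls \<longleftrightarrow>
        is_flag TYPE('s) (verts G) (arcs G) (map f ls)"
      using l l' is_flag_cflag[of F] is_flag_cflag[of G] by (simp add: is_flag_def)
    have "flag_isomorphism (relabelled F ls) (relabelled G (map f ls)) f"
      if "is_flag TYPE('s) (verts F) (arcs F) ls"
      using f cflag_Abs[OF that] cflag_Abs[OF that[unfolded *]]
      by (simp add: flag_isomorphism_def relabelled_def)
    hence "flag_class (relabelled F ls) = flag_class (relabelled G (map f ls))"
      if "is_flag TYPE('s) (verts F) (arcs F) ls"
      using that by (auto simp: flag_class_eq_iff flag_iso_def)
    moreover have "flag_class F = flag_class G" using FG by (simp add: flag_class_eq_iff)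
    ultimately show ?thesis using * by (auto simp flip: flag_class_eq_iff)
  qed
  show "real (card {ls \<in> label_tuples F.
         is_flag TYPE('s) (verts F) (arcs F) ls \<and> flag_iso (relabelled F ls) F}) /
       real (card (label_tuples F)) =
       real (card {ls \<in> label_tuples G.
         is_flag TYPE('s) (verts G) (arcs G) ls \<and> flag_iso (relabelled G ls) G}) /
       real (card (label_tuples G))"
  proof -
    have "card {ls \<in> label_tuples F.
         is_flag TYPE('s) (verts F) (arcs F) ls \<and> flag_iso (relabelled F ls) F} =
       card {ls \<in> label_tuples G.
         is_flag TYPE('s) (verts G) (arcs G) ls \<and> flag_iso (relabelled G ls) G}"
      using eq by (intro bij_betw_card_filter[OF bij])
    thus ?thesis using bij_betw_same_card[OF bij] by simp
  qed
qed

subsection \<open>Averaging identities\<close>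

text \<open>These serve to show that the product below is compatible with the relations of the flag
  algebra.\<close>

lemma finite_flags_of_size: "finite {H :: 's::tournament_type flag. flag_size H = m}"
proof (rule finite_subset)
  let ?T = "{{..<m}} \<times> Pow ({..<m} \<times> {..<m}) \<times>
     {ls :: nat list. set ls \<subseteq> {..<m} \<and> length ls = type_size TYPE('s)}"
  show "finite ((\<lambda>t. flag_class (Abs_cflag t) :: 's flag) ` ?T)"
    by (intro finite_imageI finite_cartesian_product finite_lists_length_eq) auto
  show "{H :: 's flag. flag_size H = m} \<subseteq> (\<lambda>t. flag_class (Abs_cflag t)) ` ?T"
  proof
    fix H :: "'s flag" assume H: "H \<in> {H. flag_size H = m}"
    obtain G :: "'s cflag" where G: "H = flag_class G" by (rule flag_cases)
    have "card (verts G) = m" using H by (simp add: G flag_size.abs_eq)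
    then obtain f where f: "bij_betw f (verts G) {..<m}"
      using ex_bij_betw_finite_nat[OF finite_verts[of G]] by (auto simp: lessThan_atLeast0)
    define E where "E = {(f u, f v) | u v. (u, v) \<in> arcs G}"
    define ls where "ls = map f (labels G)"
    have inj: "inj_on f (verts G)" and img: "f ` verts G = {..<m}"
      using f by (auto simp: bij_betw_def)
    have E: "(f u, f v) \<in> E \<longleftrightarrow> (u, v) \<in> arcs G" if "u \<in> verts G" "v \<in> verts G" for u v
      using arcs_subset[of G] inj that unfolding E_def inj_on_def by blast
    have G': "tournament (verts G) (arcs G)" "length (labels G) = type_size TYPE('s)"
        "distinct (labels G)"
      using is_flag_cflag[of G] by (auto simp: is_flag_def)
    have "tournament {..<m} E"
      unfolding tournament_def
    proof (intro conjI)
      show "E \<subseteq> {..<m} \<times> {..<m}"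
        using arcs_subset[of G] unfolding E_def img[symmetric] by blast
      show "\<forall>u\<in>{..<m}. (u, u) \<notin> E"
        using G'(1) E unfolding img[symmetric] tournament_def by blast
      show "\<forall>u\<in>{..<m}. \<forall>v\<in>{..<m}. u \<noteq> v \<longrightarrow> ((u, v) \<in> E) \<noteq> ((v, u) \<in> E)"
      proof (intro ballI impI)
        fix u v assume "u \<in> {..<m}" "v \<in> {..<m}" and ne: "u \<noteq> v"
        then obtain x y where xy: "x \<in> verts G" "y \<in> verts G" "u = f x" "v = f y"
          unfolding img[symmetric] by blast
        have "((x, y) \<in> arcs G) \<noteq> ((y, x) \<in> arcs G)"
          using G'(1) xy ne unfolding tournament_def by metis
        thus "((u, v) \<in> E) \<noteq> ((v, u) \<in> E)"
          unfolding xy(3,4) E[OF xy(1,2)] E[OF xy(2,1)] .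
      qed
    qed simp
    moreover have "distinct ls"
      using G'(3) inj labels_subset[of G] by (auto simp: ls_def distinct_map intro: inj_on_subset)
    moreover have ls: "set ls \<subseteq> {..<m}"
      using labels_subset[of G] by (auto simp: ls_def simp flip: img)
    moreover have "(ls ! i, ls ! j) \<in> E \<longleftrightarrow> (i, j) \<in> type_arcs TYPE('s)"
      if "i < type_size TYPE('s)" "j < type_size TYPE('s)" for i j
    proof -
      have "labels G ! i \<in> verts G" "labels G ! j \<in> verts G"
        using that labels_subset[of G] G'(2) by (metis nth_mem subsetD)+
      thus ?thesis
        using that is_flag_cflag[of G] G'(2) by (simp add: ls_def E is_flag_def)
    qed
    ultimately have fl: "is_flag TYPE('s) {..<m} E ls"
      using G'(2) by (simp add: is_flag_def ls_def)
    have "flag_isomorphism G (Abs_cflag ({..<m}, E, ls)) f"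
      unfolding flag_isomorphism_def cflag_Abs[OF fl] using f E by (simp add: ls_def)
    hence "H = flag_class (Abs_cflag ({..<m}, E, ls))"
      by (auto simp: G flag_class_eq_iff flag_iso_def)
    moreover have "E \<subseteq> {..<m} \<times> {..<m}"
      using fl by (simp add: is_flag_def tournament_def)
    ultimately show "H \<in> (\<lambda>t. flag_class (Abs_cflag t)) ` ?T"
      using ls G'(2) by (auto simp: ls_def)
  qed
qed

definition avg :: "'b set \<Rightarrow> ('b \<Rightarrow> real) \<Rightarrow> real" where
  "avg A g = (\<Sum>x\<in>A. g x) / real (card A)"

lemma avg_cong: "A = B \<Longrightarrow> (\<And>x. x \<in> B \<Longrightarrow> f x = g x) \<Longrightarrow> avg A f = avg B g"
  by (simp add: avg_def)

lemma avg_sum: "(\<Sum>i\<in>I. avg A (f i)) = avg A (\<lambda>x. \<Sum>i\<in>I. f i x)"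
  unfolding avg_def by (subst sum.swap) (simp add: sum_divide_distrib)

lemma avg_mult: "avg A g * c = avg A (\<lambda>x. g x * c)"
  by (simp add: avg_def sum_distrib_right)

lemma avg_image: "inj_on h A \<Longrightarrow> avg (h ` A) g = avg A (\<lambda>x. g (h x))"
  by (simp add: avg_def sum.reindex card_image)

lemma avg_regular:
  assumes fin: "finite A" "finite B" and "c > 0" "d > 0"
    and c: "\<And>a. a \<in> A \<Longrightarrow> card {b \<in> B. R a b} = c"
    and d: "\<And>b. b \<in> B \<Longrightarrow> card {a \<in> A. R a b} = d"
  shows "avg B (\<lambda>b. avg {a \<in> A. R a b} g) = avg A g"
proof -
  have *: "(\<Sum>b\<in>B. \<Sum>a\<in>{a \<in> A. R a b}. h a) = real c * (\<Sum>a\<in>A. h a)" for h :: "_ \<Rightarrow> real"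
  proof -
    have "(\<Sum>b\<in>B. \<Sum>a\<in>{a \<in> A. R a b}. h a) = (\<Sum>a\<in>A. \<Sum>b\<in>{b \<in> B. R a b}. h a)"
      by (rule sum.swap_restrict[OF fin(2,1)])
    thus ?thesis by (simp add: c sum_distrib_left)
  qed
  have card: "real (card B) * real d = real c * real (card A)"
    using *[of "\<lambda>_. 1"] d by simp
  have "avg B (\<lambda>b. avg {a \<in> A. R a b} g) = (\<Sum>b\<in>B. (\<Sum>a\<in>{a \<in> A. R a b}. g a) / d) / card B"
    by (simp add: avg_def d)
  also have "\<dots> = real c * (\<Sum>a\<in>A. g a) / (real (card B) * real d)"
    by (simp add: * flip: sum_divide_distrib)
  also have "\<dots> = avg A g"
    using \<open>c > 0\<close> by (simp add: card avg_def)
  finally show ?thesis .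
qed

lemma card_between:
  assumes "finite V" "S \<subseteq> V" "card S \<le> m"
  shows "card {W. S \<subseteq> W \<and> W \<subseteq> V \<and> card W = m} = (card V - card S) choose (m - card S)"
proof -
  have fS: "finite S" using assms by (meson finite_subset)
  have "bij_betw (\<lambda>W. W - S) {W. S \<subseteq> W \<and> W \<subseteq> V \<and> card W = m} {X. X \<subseteq> V - S \<and> card X = m - card S}"
  proof (rule bij_betw_byWitness[where f' = "\<lambda>X. X \<union> S"])
    show "(\<lambda>W. W - S) ` {W. S \<subseteq> W \<and> W \<subseteq> V \<and> card W = m} \<subseteq> {X. X \<subseteq> V - S \<and> card X = m - card S}"
      using fS by (auto simp: card_Diff_subset)
    have "card (X \<union> S) = m" if "X \<subseteq> V - S" "card X = m - card S" for X
    proof -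
      have "finite X" "X \<inter> S = {}" using that assms(1) by (auto intro: finite_subset)
      thus ?thesis using fS that assms(3) by (simp add: card_Un_disjoint)
    qed
    thus "(\<lambda>X. X \<union> S) ` {X. X \<subseteq> V - S \<and> card X = m - card S} \<subseteq> {W. S \<subseteq> W \<and> W \<subseteq> V \<and> card W = m}"
      using assms(2) by auto
  qed auto
  hence "card {W. S \<subseteq> W \<and> W \<subseteq> V \<and> card W = m} = card {X. X \<subseteq> V - S \<and> card X = m - card S}"
    by (rule bij_betw_same_card)
  also have "\<dots> = card (V - S) choose (m - card S)"
    using assms(1) by (intro n_subsets) auto
  finally show ?thesis using fS assms(2) by (simp add: card_Diff_subset)
qed

lemma card_labels: "card (set (labels G)) = type_size TYPE('s)" for G :: "'s::tournament_type cflag"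
  using is_flag_cflag[of G] by (simp add: is_flag_def distinct_card)

lemma flag_size_ge: "type_size TYPE('s) \<le> flag_size F" for F :: "'s::tournament_type flag"
proof (cases F)
  case (abs_flag G)
  thus ?thesis
    using card_mono[OF finite_verts labels_subset[of G]] card_labels[of G]
    by (simp add: flag_size.abs_eq)
qed

lemma finite_flag_sets: "finite (flag_sets l G)"
  by (rule finite_subset[of _ "Pow (verts G)"]) (auto simp: flag_sets_def finite_verts)

lemma finite_flag_set_pairs: "finite (flag_set_pairs l1 l2 G)"
  by (rule finite_subset[of _ "Pow (verts G) \<times> Pow (verts G)"])
    (auto simp: flag_set_pairs_def finite_verts)

lemma card_flag_sets:
  assumes "type_size TYPE('s) \<le> l"
  shows "card (flag_sets l (G :: 's::tournament_type cflag)) =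
    (card (verts G) - type_size TYPE('s)) choose (l - type_size TYPE('s))"
  using card_between[OF finite_verts labels_subset[of G]] assms
  by (simp add: flag_sets_def card_labels)

lemma card_pairs_fibre:
  fixes G :: "'s::tournament_type cflag"
  assumes "W2 \<subseteq> verts G" "set (labels G) \<subseteq> W2" "set (labels G) \<subseteq> S" "S \<inter> W2 = set (labels G)"
    "S \<subseteq> verts G" "card S \<le> m"
  shows "card {W. S \<subseteq> W \<and> W \<subseteq> verts G \<and> card W = m \<and> W \<inter> W2 = set (labels G)} =
    (card (verts G) - (card W2 - type_size TYPE('s)) - card S) choose (m - card S)"
proof -
  let ?V = "verts G - (W2 - set (labels G))"
  have "{W. S \<subseteq> W \<and> W \<subseteq> verts G \<and> card W = m \<and> W \<inter> W2 = set (labels G)} =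
      {W. S \<subseteq> W \<and> W \<subseteq> ?V \<and> card W = m}"
    using assms by blast
  moreover have "card ?V = card (verts G) - (card W2 - type_size TYPE('s))"
    using assms(1,2) finite_subset[OF assms(1) finite_verts]
    by (subst card_Diff_subset) (auto simp: card_Diff_subset card_labels)
  moreover have "S \<subseteq> ?V" using assms(3-5) by blast
  ultimately show ?thesis
    using card_between[of ?V S m] assms(6) finite_verts[of G] by simp
qed

lemma card_flag_set_pairs:
  fixes G :: "'s::tournament_type cflag"
  assumes "type_size TYPE('s) \<le> l1" "type_size TYPE('s) \<le> l2"
  shows "card (flag_set_pairs l1 l2 G) =
    ((card (verts G) - type_size TYPE('s)) choose (l2 - type_size TYPE('s))) *
    ((card (verts G) - (l2 - type_size TYPE('s)) - type_size TYPE('s)) choose (l1 - type_size TYPE('s)))"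
proof -
  let ?N = "\<lambda>W2. {W1. set (labels G) \<subseteq> W1 \<and> W1 \<subseteq> verts G \<and> card W1 = l1 \<and> W1 \<inter> W2 = set (labels G)}"
  have "bij_betw prod.swap (flag_set_pairs l1 l2 G) (Sigma (flag_sets l2 G) ?N)"
    by (rule bij_betw_byWitness[where f' = prod.swap])
      (auto simp: flag_set_pairs_def flag_sets_def)
  hence "card (flag_set_pairs l1 l2 G) = card (Sigma (flag_sets l2 G) ?N)"
    by (rule bij_betw_same_card)
  also have "\<dots> = (\<Sum>W2\<in>flag_sets l2 G. card (?N W2))"
    by (intro card_SigmaI finite_flag_sets ballI)
       (auto intro: finite_subset[of _ "Pow (verts G)"] simp: finite_verts)
  also have "\<dots> = (\<Sum>W2\<in>flag_sets l2 G.
      (card (verts G) - (l2 - type_size TYPE('s)) - type_size TYPE('s)) choose (l1 - type_size TYPE('s)))"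
  proof (rule sum.cong)
    fix W2 assume "W2 \<in> flag_sets l2 G"
    thus "card (?N W2) = (card (verts G) - (l2 - type_size TYPE('s)) - type_size TYPE('s)) choose
        (l1 - type_size TYPE('s))"
      using card_pairs_fibre[of W2 G "set (labels G)" l1] assms labels_subset[of G]
      by (auto simp: flag_sets_def card_labels Int_absorb2)
  qed simp
  also have "\<dots> = ((card (verts G) - type_size TYPE('s)) choose (l2 - type_size TYPE('s))) *
    ((card (verts G) - (l2 - type_size TYPE('s)) - type_size TYPE('s)) choose (l1 - type_size TYPE('s)))"
    by (simp add: card_flag_sets[OF assms(2)])
  finally show ?thesis .
qed

abbreviation cls :: "'s::tournament_type cflag \<Rightarrow> nat set \<Rightarrow> 's flag" where
  "cls G W \<equiv> flag_class (induced G W)"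

lemma density_avg:
  "flag_density F (flag_class G) = avg (flag_sets (flag_size F) G) (\<lambda>W. of_bool (cls G W = F))"
proof (cases F)
  case (abs_flag F0)
  have "(\<Sum>W\<in>flag_sets l G. of_bool (cls G W = F)) =
      real (card {W \<in> flag_sets l G. cls G W = F})" for l
    using finite_flag_sets[of l G] by (simp add: Int_def)
  thus ?thesis
    by (simp add: abs_flag avg_def flag_density.abs_eq flag_size.abs_eq flag_class_eq_iff)
qed

lemma joint_density_avg:
  "joint_density F1 F2 (flag_class G) =
     avg (flag_set_pairs (flag_size F1) (flag_size F2) G)
       (\<lambda>p. of_bool (cls G (fst p) = F1 \<and> cls G (snd p) = F2))"
proof -
  obtain F1' F2' where F: "F1 = flag_class F1'" "F2 = flag_class F2'"
    by (metis flag_cases)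
  have "(\<Sum>p\<in>flag_set_pairs l l' G. of_bool (cls G (fst p) = F1 \<and> cls G (snd p) = F2)) =
      real (card {p \<in> flag_set_pairs l l' G. cls G (fst p) = F1 \<and> cls G (snd p) = F2})" for l l'
    using finite_flag_set_pairs[of l l' G] by (simp add: Int_def)
  thus ?thesis
    by (simp add: F avg_def joint_density.abs_eq flag_size.abs_eq flag_class_eq_iff)
qed

lemma flag_size_cls: "W \<in> flag_sets l G \<Longrightarrow> flag_size (cls G W) = l"
  by (auto simp: flag_sets_def flag_size.abs_eq induced_simps)

lemma sum_of_bool_flag:
  assumes "flag_size K = m"
  shows "(\<Sum>H | flag_size H = m. of_bool (K = H) * q H) = (q K :: real)"
proof -
  have "(\<Sum>H | flag_size H = m. of_bool (K = H) * q H) = (\<Sum>H | flag_size H = m. if H = K then q H else 0)"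
    by (intro sum.cong) auto
  also have "\<dots> = q K"
    using assms by (simp add: sum.delta[OF finite_flags_of_size])
  finally show ?thesis .
qed

lemma sum_density:
  "(\<Sum>H | flag_size H = m. flag_density H (flag_class G) * q H) = avg (flag_sets m G) (\<lambda>W. q (cls G W))"
proof -
  have "(\<Sum>H | flag_size H = m. flag_density H (flag_class G) * q H) =
      (\<Sum>H | flag_size H = m. avg (flag_sets m G) (\<lambda>W. of_bool (cls G W = H) * q H))"
    by (intro sum.cong) (auto simp: density_avg avg_mult)
  also have "\<dots> = avg (flag_sets m G) (\<lambda>W. \<Sum>H | flag_size H = m. of_bool (cls G W = H) * q H)"
    by (rule avg_sum)
  also have "\<dots> = avg (flag_sets m G) (\<lambda>W. q (cls G W))"
    by (intro avg_cong refl sum_of_bool_flag flag_size_cls)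
  finally show ?thesis .
qed

lemma induced_induced:
  assumes "set (labels G) \<subseteq> W" "W \<subseteq> verts G" "set (labels G) \<subseteq> W'" "W' \<subseteq> W"
  shows "induced (induced G W) W' = induced G W'"
proof -
  have "arcs G \<inter> W \<times> W \<inter> W' \<times> W' = arcs G \<inter> W' \<times> W'" using assms(4) by blast
  thus ?thesis
    unfolding induced_def[of "induced G W"] induced_simps[OF assms(1,2)] by (simp add: induced_def)
qed

lemma joint_density_chain_right:
  fixes F1 F2 G :: "'s::tournament_type flag"
  assumes "flag_size F1 + flag_size F2 - type_size TYPE('s) \<le> m" "m \<le> flag_size G"
  shows "(\<Sum>H | flag_size H = m. joint_density F1 F2 H * flag_density H G) = joint_density F1 F2 G"
proof (cases G)
  case (abs_flag G0)
  define k where "k = type_size TYPE('s)"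
  define l1 where "l1 = flag_size F1"
  define l2 where "l2 = flag_size F2"
  define n where "n = card (verts G0)"
  have k: "k \<le> l1" "k \<le> l2" using flag_size_ge by (auto simp: k_def l1_def l2_def)
  have m: "l1 + l2 - k \<le> m" "m \<le> n"
    using assms by (auto simp: k_def l1_def l2_def n_def abs_flag flag_size.abs_eq)
  let ?g = "\<lambda>p. of_bool (cls G0 (fst p) = F1 \<and> cls G0 (snd p) = F2) :: real"
  let ?R = "\<lambda>p W. fst p \<subseteq> W \<and> snd p \<subseteq> W"
  let ?A = "flag_set_pairs l1 l2 G0" and ?B = "flag_sets m G0"
  have sub: "{p \<in> ?A. ?R p W} = flag_set_pairs l1 l2 (induced G0 W)" if "W \<in> ?B" for W
    using that by (auto simp: flag_set_pairs_def flag_sets_def induced_simps)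
  have jd: "joint_density F1 F2 (cls G0 W) = avg {p \<in> ?A. ?R p W} ?g" if W: "W \<in> ?B" for W
    unfolding joint_density_avg sub[OF W] l1_def[symmetric] l2_def[symmetric]
  proof (rule avg_cong[OF refl])
    fix p assume p: "p \<in> flag_set_pairs l1 l2 (induced G0 W)"
    have W': "set (labels G0) \<subseteq> W" "W \<subseteq> verts G0" using W by (auto simp: flag_sets_def)
    have "set (labels G0) \<subseteq> fst p" "fst p \<subseteq> W" "set (labels G0) \<subseteq> snd p" "snd p \<subseteq> W"
      using p by (auto simp: flag_set_pairs_def induced_simps[OF W'])
    thus "of_bool (cls (induced G0 W) (fst p) = F1 \<and> cls (induced G0 W) (snd p) = F2) = ?g p"
      using W' by (simp add: induced_induced)
  qed
  have "(\<Sum>H | flag_size H = m. joint_density F1 F2 H * flag_density H G) =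
      avg ?B (\<lambda>W. joint_density F1 F2 (cls G0 W))"
    using sum_density[where m = m and G = G0 and q = "joint_density F1 F2"] by (simp add: abs_flag mult.commute)
  also have "\<dots> = avg ?B (\<lambda>W. avg {p \<in> ?A. ?R p W} ?g)"
    by (intro avg_cong refl jd)
  also have "\<dots> = avg ?A ?g"
  proof (rule avg_regular[OF finite_flag_set_pairs finite_flag_sets])
    show "(n - (l1 + l2 - k)) choose (m - (l1 + l2 - k)) > 0"
      using m by (intro zero_less_binomial) simp
    show "((m - k) choose (l2 - k)) * ((m - (l2 - k) - k) choose (l1 - k)) > 0"
      using m k by (simp add: zero_less_binomial_iff) linarith
    show "card {p \<in> ?A. ?R p W} = ((m - k) choose (l2 - k)) * ((m - (l2 - k) - k) choose (l1 - k))"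
      if "W \<in> ?B" for W
      using card_flag_set_pairs[of l1 l2 "induced G0 W"] k that
      by (auto simp: sub k_def flag_sets_def induced_simps)
    fix p assume p: "p \<in> ?A"
    have fin: "finite (fst p)" "finite (snd p)"
      using p finite_subset[OF _ finite_verts[of G0], of "fst p"]
        finite_subset[OF _ finite_verts[of G0], of "snd p"]
      by (auto simp: flag_set_pairs_def)
    have U: "card (fst p \<union> snd p) = l1 + l2 - k"
      using p card_Un_Int[OF fin] by (auto simp: flag_set_pairs_def card_labels k_def)
    have "{W \<in> ?B. ?R p W} = {W. fst p \<union> snd p \<subseteq> W \<and> W \<subseteq> verts G0 \<and> card W = m}"
    proof -
      have "set (labels G0) \<subseteq> fst p" using p by (auto simp: flag_set_pairs_def)
      thus ?thesis by (auto simp: flag_sets_def)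
    qed
    thus "card {W \<in> ?B. ?R p W} = (n - (l1 + l2 - k)) choose (m - (l1 + l2 - k))"
      using card_between[OF finite_verts[of G0], of "fst p \<union> snd p" m] p U m
      by (auto simp: flag_set_pairs_def n_def)
  qed
  also have "\<dots> = joint_density F1 F2 G"
    by (simp add: abs_flag joint_density_avg l1_def l2_def)
  finally show ?thesis .
qed

lemma joint_density_chain_left:
  fixes F1 F2 G :: "'s::tournament_type flag"
  assumes "flag_size F1 \<le> m" "m + flag_size F2 - type_size TYPE('s) \<le> flag_size G"
  shows "(\<Sum>H | flag_size H = m. flag_density F1 H * joint_density H F2 G) = joint_density F1 F2 G"
proof (cases G)
  case (abs_flag G0)
  define k where "k = type_size TYPE('s)"
  define l1 where "l1 = flag_size F1"
  define l2 where "l2 = flag_size F2"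
  define n where "n = card (verts G0)"
  have k: "k \<le> l1" "k \<le> l2" using flag_size_ge by (auto simp: k_def l1_def l2_def)
  have m: "l1 \<le> m" "m + l2 - k \<le> n"
    using assms by (auto simp: k_def l1_def l2_def n_def abs_flag flag_size.abs_eq)
  let ?g = "\<lambda>p. of_bool (cls G0 (fst p) = F1 \<and> cls G0 (snd p) = F2) :: real"
  let ?R = "\<lambda>p q. fst p \<subseteq> fst q \<and> snd p = snd q"
  let ?A = "flag_set_pairs l1 l2 G0" and ?B = "flag_set_pairs m l2 G0"
  have BD: "set (labels G0) \<subseteq> fst q" "fst q \<subseteq> verts G0" "card (fst q) = m"
    "set (labels G0) \<subseteq> snd q" "snd q \<subseteq> verts G0" "card (snd q) = l2"
    "fst q \<inter> snd q = set (labels G0)" if "q \<in> ?B" for q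
    using that by (auto simp: flag_set_pairs_def)
  have sub: "{p \<in> ?A. ?R p q} = (\<lambda>W1. (W1, snd q)) ` flag_sets l1 (induced G0 (fst q))"
    if "q \<in> ?B" for q
  proof -
    note b = BD[OF that]
    have "(W1, snd q) \<in> ?A" if "set (labels G0) \<subseteq> W1" "W1 \<subseteq> fst q" "card W1 = l1" for W1
    proof -
      have "W1 \<inter> snd q = set (labels G0)" using that b(4,7) by blast
      moreover have "W1 \<subseteq> verts G0" using that(2) b(2) by blast
      ultimately show ?thesis using that(3) b(5,6) by (simp add: flag_set_pairs_def)
    qed
    moreover have "set (labels G0) \<subseteq> fst p" "card (fst p) = l1" if "p \<in> ?A" for p
      using that by (auto simp: flag_set_pairs_def)
    ultimately have *: "p \<in> ?A \<and> ?R p q \<longleftrightarrow> snd p = snd q \<and> set (labels G0) \<subseteq> fst p \<and>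
        fst p \<subseteq> fst q \<and> card (fst p) = l1" for p
      by (metis prod.collapse)
    show ?thesis
      unfolding * by (auto simp: flag_sets_def induced_simps[OF b(1,2)])
  qed
  have inj: "inj_on (\<lambda>W1. (W1, w)) X" for w :: "nat set" and X :: "nat set set"
    by (auto simp: inj_on_def)
  have d: "flag_density F1 (cls G0 (fst q)) * of_bool (cls G0 (snd q) = F2) = avg {p \<in> ?A. ?R p q} ?g"
    if q: "q \<in> ?B" for q
    unfolding density_avg sub[OF q] l1_def[symmetric] avg_image[OF inj] avg_mult
  proof (rule avg_cong[OF refl])
    fix W1 assume "W1 \<in> flag_sets l1 (induced G0 (fst q))"
    hence "set (labels G0) \<subseteq> W1" "W1 \<subseteq> fst q"
      by (auto simp: flag_sets_def induced_simps[OF BD(1,2)[OF q]])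
    thus "of_bool (cls (induced G0 (fst q)) W1 = F1) * of_bool (cls G0 (snd q) = F2) =
        ?g (W1, snd q)"
      using BD(1,2)[OF q] by (simp add: induced_induced)
  qed
  have "(\<Sum>H | flag_size H = m. flag_density F1 H * joint_density H F2 G) =
      (\<Sum>H | flag_size H = m. avg ?B (\<lambda>q. of_bool (cls G0 (fst q) = H) *
         (flag_density F1 H * of_bool (cls G0 (snd q) = F2))))"
    unfolding abs_flag joint_density_avg l2_def
  proof (intro sum.cong refl)
    fix H :: "'s flag" assume H: "H \<in> {H. flag_size H = m}"
    have "flag_density F1 H * avg ?B (\<lambda>q. of_bool (cls G0 (fst q) = H \<and> cls G0 (snd q) = F2)) =
        avg ?B (\<lambda>q. of_bool (cls G0 (fst q) = H \<and> cls G0 (snd q) = F2) * flag_density F1 H)"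
      by (subst mult.commute) (rule avg_mult)
    also have "\<dots> = avg ?B (\<lambda>q. of_bool (cls G0 (fst q) = H) *
         (flag_density F1 H * of_bool (cls G0 (snd q) = F2)))"
      by (intro avg_cong refl) (simp add: of_bool_conj)
    finally show "flag_density F1 H * avg (flag_set_pairs (flag_size H) (flag_size F2) G0)
         (\<lambda>q. of_bool (cls G0 (fst q) = H \<and> cls G0 (snd q) = F2)) =
        avg (flag_set_pairs m (flag_size F2) G0) (\<lambda>q. of_bool (cls G0 (fst q) = H) *
         (flag_density F1 H * of_bool (cls G0 (snd q) = F2)))"
      using H by (simp add: l2_def)
  qed
  also have "\<dots> = avg ?B (\<lambda>q. \<Sum>H | flag_size H = m. of_bool (cls G0 (fst q) = H) *
         (flag_density F1 H * of_bool (cls G0 (snd q) = F2)))"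
    by (rule avg_sum)
  also have "\<dots> = avg ?B (\<lambda>q. flag_density F1 (cls G0 (fst q)) * of_bool (cls G0 (snd q) = F2))"
  proof (rule avg_cong[OF refl])
    fix q assume q: "q \<in> ?B"
    have "flag_size (cls G0 (fst q)) = m"
      using BD[OF q] by (simp add: flag_size.abs_eq induced_simps)
    thus "(\<Sum>H | flag_size H = m. of_bool (cls G0 (fst q) = H) *
         (flag_density F1 H * of_bool (cls G0 (snd q) = F2))) =
        flag_density F1 (cls G0 (fst q)) * of_bool (cls G0 (snd q) = F2)"
      by (rule sum_of_bool_flag)
  qed
  also have "\<dots> = avg ?B (\<lambda>q. avg {p \<in> ?A. ?R p q} ?g)"
    by (intro avg_cong refl d)
  also have "\<dots> = avg ?A ?g"
  proof (rule avg_regular[OF finite_flag_set_pairs finite_flag_set_pairs])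
    show "(n - (l2 - k) - l1) choose (m - l1) > 0"
      using m k by (intro zero_less_binomial) simp
    show "(m - k) choose (l1 - k) > 0"
      using m k by (intro zero_less_binomial) simp
    show "card {p \<in> ?A. ?R p q} = (m - k) choose (l1 - k)" if q: "q \<in> ?B" for q
      using card_flag_sets[of l1 "induced G0 (fst q)"] k BD[OF q]
      by (simp add: sub[OF q] card_image[OF inj] k_def induced_simps)
    fix p assume p: "p \<in> ?A"
    let ?N = "{W. fst p \<subseteq> W \<and> W \<subseteq> verts G0 \<and> card W = m \<and> W \<inter> snd p = set (labels G0)}"
    have "{q \<in> ?B. ?R p q} = (\<lambda>W. (W, snd p)) ` ?N"
    proof -
      have "(W, snd p) \<in> ?B \<longleftrightarrow> W \<subseteq> verts G0 \<and> card W = m \<and> W \<inter> snd p = set (labels G0)" for W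
        using p by (auto simp: flag_set_pairs_def)
      thus ?thesis by auto
    qed
    moreover have "card ?N = (n - (l2 - k) - l1) choose (m - l1)"
    proof -
      have "fst p \<subseteq> verts G0" "snd p \<subseteq> verts G0" "card (fst p) = l1" "card (snd p) = l2"
        and I: "fst p \<inter> snd p = set (labels G0)"
        using p by (auto simp: flag_set_pairs_def)
      moreover have "set (labels G0) \<subseteq> fst p" "set (labels G0) \<subseteq> snd p"
        using I by blast+
      ultimately show ?thesis
        using card_pairs_fibre[of "snd p" G0 "fst p" m] m(1) by (simp add: n_def k_def)
    qed
    ultimately show "card {q \<in> ?B. ?R p q} = (n - (l2 - k) - l1) choose (m - l1)"
      by (simp add: card_image[OF inj])
  qed
  also have "\<dots> = joint_density F1 F2 G"
    by (simp add: abs_flag joint_density_avg l1_def l2_def)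
  finally show ?thesis .
qed

lemma joint_density_commute: "joint_density F1 F2 G = joint_density F2 F1 G"
proof (cases G)
  case (abs_flag G0)
  let ?P = "flag_set_pairs (flag_size F1) (flag_size F2) G0"
  have "flag_set_pairs (flag_size F2) (flag_size F1) G0 = prod.swap ` ?P"
  proof
    show "flag_set_pairs (flag_size F2) (flag_size F1) G0 \<subseteq> prod.swap ` ?P"
    proof
      fix p assume "p \<in> flag_set_pairs (flag_size F2) (flag_size F1) G0"
      hence "prod.swap p \<in> ?P" by (auto simp: flag_set_pairs_def)
      thus "p \<in> prod.swap ` ?P" by (metis image_eqI swap_swap)
    qed
  qed (auto simp: flag_set_pairs_def)
  moreover have "inj_on prod.swap ?P" by simp
  ultimately show ?thesis
    unfolding abs_flag joint_density_avg by (simp only: avg_image prod.sel fst_swap snd_swap conj_commute)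
qed


section \<open>Flag algebras\<close>

definition flag_relations :: "('s::tournament_type flag \<Rightarrow>\<^sub>0 real) set" where
  "flag_relations = span {Poly_Mapping.single F 1 -
       (\<Sum>H | flag_size H = m. Poly_Mapping.single H (flag_density F H)) | F m. flag_size F \<le> m}"

lemma subspace_flag_relations: "subspace flag_relations"
  by (simp add: flag_relations_def)

quotient_type (overloaded) 's flag_alg =
  "'s::tournament_type flag \<Rightarrow>\<^sub>0 real" / "\<lambda>x y. x - y \<in> flag_relations"
proof (rule equivpI)
  show "reflp (\<lambda>x y. x - y \<in> (flag_relations :: ('s flag \<Rightarrow>\<^sub>0 real) set))"
    by (rule reflpI) (simp add: subspace_0[OF subspace_flag_relations])
  show "symp (\<lambda>x y. x - y \<in> (flag_relations :: ('s flag \<Rightarrow>\<^sub>0 real) set))"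
  proof (rule sympI)
    fix x y :: "'s flag \<Rightarrow>\<^sub>0 real"
    assume "x - y \<in> flag_relations"
    from subspace_neg[OF subspace_flag_relations this] show "y - x \<in> flag_relations" by simp
  qed
  show "transp (\<lambda>x y. x - y \<in> (flag_relations :: ('s flag \<Rightarrow>\<^sub>0 real) set))"
  proof (rule transpI)
    fix x y z :: "'s flag \<Rightarrow>\<^sub>0 real"
    assume "x - y \<in> flag_relations" "y - z \<in> flag_relations"
    from subspace_add[OF subspace_flag_relations this] show "x - z \<in> flag_relations" by simp
  qed
qed

text \<open>Product of two basis elements, with the smallest admissible \<open>m\<close>.\<close>

definition flag_product ::
  "'s::tournament_type flag \<Rightarrow> 's flag \<Rightarrow> ('s flag \<Rightarrow>\<^sub>0 real)" where
  "flag_product F1 F2 =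
     (\<Sum>H | flag_size H = flag_size F1 + flag_size F2 - type_size TYPE('s).
        Poly_Mapping.single H (joint_density F1 F2 H))"

definition bilinear_product ::
  "('s::tournament_type flag \<Rightarrow>\<^sub>0 real) \<Rightarrow> ('s flag \<Rightarrow>\<^sub>0 real) \<Rightarrow> ('s flag \<Rightarrow>\<^sub>0 real)" where
  "bilinear_product x y =
     (\<Sum>F1\<in>Poly_Mapping.keys x. \<Sum>F2\<in>Poly_Mapping.keys y.
        (Poly_Mapping.lookup x F1 * Poly_Mapping.lookup y F2) *\<^sub>R flag_product F1 F2)"

lemma lookup_scaleR: "Poly_Mapping.lookup (c *\<^sub>R x) F = c * Poly_Mapping.lookup x F"
  for x :: "'b \<Rightarrow>\<^sub>0 real"
proof -
  have "finite {i. c *\<^sub>R Poly_Mapping.lookup x i \<noteq> 0}"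
    by (rule finite_subset[OF _ finite_lookup[of x]]) auto
  thus ?thesis by (simp add: scaleR_poly_mapping_def Abs_poly_mapping_inverse)
qed

lemma bilinear_product_superset:
  assumes "finite A" "Poly_Mapping.keys x \<subseteq> A" "finite B" "Poly_Mapping.keys y \<subseteq> B"
  shows "bilinear_product x y = (\<Sum>F1\<in>A. \<Sum>F2\<in>B.
        (Poly_Mapping.lookup x F1 * Poly_Mapping.lookup y F2) *\<^sub>R flag_product F1 F2)"
proof -
  have "bilinear_product x y = (\<Sum>F1\<in>Poly_Mapping.keys x. \<Sum>F2\<in>B.
        (Poly_Mapping.lookup x F1 * Poly_Mapping.lookup y F2) *\<^sub>R flag_product F1 F2)"
    unfolding bilinear_product_def
    by (rule sum.cong[OF refl], rule sum.mono_neutral_left[OF assms(3,4)])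
      (simp add: in_keys_iff)
  also have "\<dots> = (\<Sum>F1\<in>A. \<Sum>F2\<in>B.
        (Poly_Mapping.lookup x F1 * Poly_Mapping.lookup y F2) *\<^sub>R flag_product F1 F2)"
    by (rule sum.mono_neutral_left[OF assms(1,2)]) (simp add: in_keys_iff)
  finally show ?thesis .
qed

lemma flag_product_commute: "flag_product F1 F2 = flag_product F2 F1"
  unfolding flag_product_def
  by (simp only: joint_density_commute[of F1 F2] add.commute[of "flag_size F1" "flag_size F2"])

lemma bilinear_product_commute: "bilinear_product x y = bilinear_product y x"
  unfolding bilinear_product_def
  by (subst sum.swap) (intro sum.cong refl, metis flag_product_commute mult.commute)

lemma linear_bilinear_product: "linear (\<lambda>x. bilinear_product x y)"
proof (rule linearI)
  fix x x' :: "'a flag \<Rightarrow>\<^sub>0 real" and c :: real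
  let ?A = "Poly_Mapping.keys x \<union> Poly_Mapping.keys x'" and ?B = "Poly_Mapping.keys y"
  have "Poly_Mapping.keys (x + x') \<subseteq> ?A" by (rule keys_add)
  hence 1: "bilinear_product (x + x') y = (\<Sum>F1\<in>?A. \<Sum>F2\<in>?B.
      (Poly_Mapping.lookup (x + x') F1 * Poly_Mapping.lookup y F2) *\<^sub>R flag_product F1 F2)"
    by (intro bilinear_product_superset) auto
  have 2: "bilinear_product x y = (\<Sum>F1\<in>?A. \<Sum>F2\<in>?B.
      (Poly_Mapping.lookup x F1 * Poly_Mapping.lookup y F2) *\<^sub>R flag_product F1 F2)"
    by (intro bilinear_product_superset) auto
  have 3: "bilinear_product x' y = (\<Sum>F1\<in>?A. \<Sum>F2\<in>?B.
      (Poly_Mapping.lookup x' F1 * Poly_Mapping.lookup y F2) *\<^sub>R flag_product F1 F2)"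
    by (intro bilinear_product_superset) auto
  show "bilinear_product (x + x') y = bilinear_product x y + bilinear_product x' y"
    unfolding 1 2 3 by (simp add: lookup_add algebra_simps sum.distrib)
  have "Poly_Mapping.keys (c *\<^sub>R x) \<subseteq> Poly_Mapping.keys x"
    by (auto simp: in_keys_iff lookup_scaleR)
  hence "bilinear_product (c *\<^sub>R x) y = (\<Sum>F1\<in>Poly_Mapping.keys x. \<Sum>F2\<in>?B.
      (Poly_Mapping.lookup (c *\<^sub>R x) F1 * Poly_Mapping.lookup y F2) *\<^sub>R flag_product F1 F2)"
    by (intro bilinear_product_superset) auto
  also have "\<dots> = c *\<^sub>R bilinear_product x y"
    unfolding bilinear_product_def by (simp add: lookup_scaleR scaleR_sum_right mult.assoc)
  finally show "bilinear_product (c *\<^sub>R x) y = c *\<^sub>R bilinear_product x y" .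
qed

lemma bilinear_product_single:
  "bilinear_product (Poly_Mapping.single F1 a) (Poly_Mapping.single F2 b) =
     (a * b) *\<^sub>R flag_product F1 F2"
  by (subst bilinear_product_superset[of "{F1}" _ "{F2}"]) (auto simp: lookup_single)

lemma single_scaleR: "Poly_Mapping.single F (c * a) = c *\<^sub>R Poly_Mapping.single F (a :: real)"
  by (rule poly_mapping_eqI) (simp add: lookup_scaleR lookup_single when_def)

lemma single_sum: "Poly_Mapping.single F (\<Sum>i\<in>I. f i) = (\<Sum>i\<in>I. Poly_Mapping.single F (f i :: real))"
  by (induction I rule: infinite_finite_induct) (auto simp: single_add)

text \<open>The product of basis elements may be computed with any admissible \<open>m\<close>.\<close>

lemma flag_product_any_size:
  fixes F1 F2 :: "'s::tournament_type flag"
  assumes "flag_size F1 + flag_size F2 - type_size TYPE('s) \<le> m"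
  shows "flag_product F1 F2 - (\<Sum>G | flag_size G = m. Poly_Mapping.single G (joint_density F1 F2 G))
    \<in> flag_relations"
proof -
  let ?l = "flag_size F1 + flag_size F2 - type_size TYPE('s)"
  let ?r = "\<lambda>H :: 's flag. Poly_Mapping.single H 1 -
       (\<Sum>G | flag_size G = m. Poly_Mapping.single G (flag_density H G)) :: 's flag \<Rightarrow>\<^sub>0 real"
  have "(\<Sum>H | flag_size H = ?l. joint_density F1 F2 H *\<^sub>R ?r H) \<in> flag_relations"
    unfolding flag_relations_def
  proof (intro span_sum span_scale span_base)
    fix H :: "'s flag" assume "H \<in> {H. flag_size H = ?l}"
    thus "?r H \<in> {Poly_Mapping.single F 1 -
       (\<Sum>H | flag_size H = m. Poly_Mapping.single H (flag_density F H)) | F m. flag_size F \<le> m}"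
      using assms by (intro CollectI exI[of _ H] exI[of _ m]) auto
  qed
  moreover have "(\<Sum>H | flag_size H = ?l. joint_density F1 F2 H *\<^sub>R ?r H) =
      flag_product F1 F2 - (\<Sum>H | flag_size H = ?l. \<Sum>G | flag_size G = m.
        Poly_Mapping.single G (joint_density F1 F2 H * flag_density H G))"
    by (simp add: flag_product_def scaleR_diff_right sum_subtractf scaleR_sum_right
        flip: single_scaleR)
  moreover have "(\<Sum>H | flag_size H = ?l. \<Sum>G | flag_size G = m.
        Poly_Mapping.single G (joint_density F1 F2 H * flag_density H G)) =
      (\<Sum>G | flag_size G = m. Poly_Mapping.single G (joint_density F1 F2 G))"
    by (subst sum.swap)
      (auto simp flip: single_sum simp: joint_density_chain_right assms intro!: sum.cong)
  ultimately show ?thesis by simp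
qed

lemma bilinear_product_relation_single:
  assumes "x \<in> (flag_relations :: ('s::tournament_type flag \<Rightarrow>\<^sub>0 real) set)"
  shows "bilinear_product x (Poly_Mapping.single F2 1) \<in> flag_relations"
  using assms unfolding flag_relations_def
proof (induction rule: span_induct)
  case base
  show ?case
    using linear_subspace_vimage[OF linear_bilinear_product subspace_span]
    by (simp add: vimage_def)
next
  case (step z)
  then obtain F1 :: "'s flag" and m where m: "flag_size F1 \<le> m"
    and z: "z = Poly_Mapping.single F1 1 -
       (\<Sum>H | flag_size H = m. Poly_Mapping.single H (flag_density F1 H))"
    by auto
  let ?n = "m + flag_size F2 - type_size TYPE('s)"
  have "bilinear_product z (Poly_Mapping.single F2 1) = flag_product F1 F2 -
      (\<Sum>H | flag_size H = m. flag_density F1 H *\<^sub>R flag_product H F2)"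
    unfolding z
    by (simp add: linear_diff[OF linear_bilinear_product] linear_sum[OF linear_bilinear_product]
        bilinear_product_single)
  also have "(\<Sum>H | flag_size H = m. flag_density F1 H *\<^sub>R flag_product H F2) =
      (\<Sum>H | flag_size H = m. \<Sum>G | flag_size G = ?n.
        Poly_Mapping.single G (flag_density F1 H * joint_density H F2 G))"
    by (intro sum.cong refl) (simp add: flag_product_def scaleR_sum_right single_scaleR)
  also have "\<dots> = (\<Sum>G | flag_size G = ?n. Poly_Mapping.single G (joint_density F1 F2 G))"
    by (subst sum.swap)
      (auto simp flip: single_sum simp: joint_density_chain_left m intro!: sum.cong)
  finally show ?case
    using flag_product_any_size[of F1 F2 ?n] m by (simp add: flag_relations_def)
qed

lemma bilinear_product_relation_left:
  assumes "x \<in> (flag_relations :: ('s::tournament_type flag \<Rightarrow>\<^sub>0 real) set)"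
  shows "bilinear_product x y \<in> flag_relations"
proof -
  have y: "y = (\<Sum>F\<in>Poly_Mapping.keys y. Poly_Mapping.lookup y F *\<^sub>R Poly_Mapping.single F 1)"
    (is "_ = ?y")
    by (rule poly_mapping_eqI)
      (simp add: lookup_sum lookup_scaleR lookup_single when_def in_keys_iff if_distrib
        sum.delta cong: if_cong)
  have "bilinear_product x y = bilinear_product y x"
    by (rule bilinear_product_commute)
  also have "\<dots> = bilinear_product ?y x"
    by (rule arg_cong[OF y])
  also have "\<dots> = (\<Sum>F\<in>Poly_Mapping.keys y.
      Poly_Mapping.lookup y F *\<^sub>R bilinear_product x (Poly_Mapping.single F 1))"
    by (simp add: linear_sum[OF linear_bilinear_product] linear_scale[OF linear_bilinear_product]
        bilinear_product_commute[of x])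
  also have "\<dots> \<in> flag_relations"
    using bilinear_product_relation_single[OF assms] unfolding flag_relations_def
    by (intro span_sum span_scale) auto
  finally show ?thesis .
qed

instantiation flag_alg :: (tournament_type) real_vector
begin

lift_definition zero_flag_alg :: "'a flag_alg" is 0 .

lift_definition plus_flag_alg :: "'a flag_alg \<Rightarrow> 'a flag_alg \<Rightarrow> 'a flag_alg" is "(+)"
proof -
  fix x x' y y' :: "'a flag \<Rightarrow>\<^sub>0 real"
  assume "x - x' \<in> flag_relations" "y - y' \<in> flag_relations"
  from subspace_add[OF subspace_flag_relations this]
  show "x + y - (x' + y') \<in> flag_relations" by (simp add: add_diff_add)
qed

lift_definition minus_flag_alg :: "'a flag_alg \<Rightarrow> 'a flag_alg \<Rightarrow> 'a flag_alg" is "(-)"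
proof -
  fix x x' y y' :: "'a flag \<Rightarrow>\<^sub>0 real"
  assume "x - x' \<in> flag_relations" "y - y' \<in> flag_relations"
  from subspace_diff[OF subspace_flag_relations this]
  show "x - y - (x' - y') \<in> flag_relations" by (simp add: algebra_simps)
qed

lift_definition uminus_flag_alg :: "'a flag_alg \<Rightarrow> 'a flag_alg" is uminus
proof -
  fix x x' :: "'a flag \<Rightarrow>\<^sub>0 real"
  assume "x - x' \<in> flag_relations"
  from subspace_neg[OF subspace_flag_relations this]
  show "- x - - x' \<in> flag_relations" by simp
qed

lift_definition scaleR_flag_alg :: "real \<Rightarrow> 'a flag_alg \<Rightarrow> 'a flag_alg" is scaleR
proof -
  fix c and x x' :: "'a flag \<Rightarrow>\<^sub>0 real"
  assume "x - x' \<in> flag_relations"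
  from subspace_scale[OF subspace_flag_relations this]
  show "c *\<^sub>R x - c *\<^sub>R x' \<in> flag_relations" by (simp add: scaleR_diff_right)
qed

instance
  by standard (transfer, simp add: subspace_0[OF subspace_flag_relations] algebra_simps)+

end

instantiation flag_alg :: (tournament_type) "{one, times}"
begin

lift_definition one_flag_alg :: "'a flag_alg" is "Poly_Mapping.single unit_flag 1" .

lift_definition times_flag_alg :: "'a flag_alg \<Rightarrow> 'a flag_alg \<Rightarrow> 'a flag_alg" is bilinear_product
proof -
  fix x x' y y' :: "'a flag \<Rightarrow>\<^sub>0 real"
  assume x: "x - x' \<in> flag_relations" and y: "y - y' \<in> flag_relations"
  have "bilinear_product x y - bilinear_product x' y' =
      bilinear_product (x - x') y + bilinear_product (y - y') x'"
    unfolding linear_diff[OF linear_bilinear_product]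
    by (simp only: bilinear_product_commute[of _ x']) simp
  also have "\<dots> \<in> flag_relations"
    using bilinear_product_relation_left[OF x] bilinear_product_relation_left[OF y]
    unfolding flag_relations_def by (rule span_add)
  finally show "bilinear_product x y - bilinear_product x' y' \<in> flag_relations" .
qed

instance ..

end

definition of_flag :: "'s::tournament_type flag \<Rightarrow> 's flag_alg" where
  "of_flag F = abs_flag_alg (Poly_Mapping.single F 1)"

section \<open>Homomorphisms, the downward operator and random extensions\<close>

definition pos_homs :: "('s::tournament_type flag_alg \<Rightarrow> real) set" where
  "pos_homs = {\<psi>. linear \<psi> \<and> \<psi> 1 = 1 \<and> (\<forall>x y. \<psi> (x * y) = \<psi> x * \<psi> y) \<and>
     (\<forall>F. 0 \<le> \<psi> (of_flag F))}"

text \<open>The identification of a homomorphism with a point of \<open>[0,1]\<close> to the power of the set of all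
  flags.\<close>

definition hom_point :: "('s::tournament_type flag_alg \<Rightarrow> real) \<Rightarrow> 's flag \<Rightarrow> real" where
  "hom_point \<psi> = (\<lambda>F. \<psi> (of_flag F))"

text \<open>The downward operator on basis elements; only these values are needed below.\<close>

definition downward :: "'s::tournament_type flag \<Rightarrow> ty_0 flag_alg" where
  "downward F = label_prob F *\<^sub>R of_flag (underlying F)"

text \<open>\<open>X\<close>, defined on the probability space \<open>M\<close>, is a version of the random homomorphism
  \<open>\<phi>\<^sup>A\<close>; its law is determined by \<open>\<phi>\<close>. In the measurability condition \<open>borel\<close> is the Borel
  sigma-algebra of the product topology on functions from \<open>A\<close>-flags to the reals.\<close>

definition random_extension ::
  "(ty_0 flag_alg \<Rightarrow> real) \<Rightarrow> 'w measure \<Rightarrow> ('w \<Rightarrow> ty_A flag_alg \<Rightarrow> real) \<Rightarrow> bool" where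
  "random_extension \<phi> M X \<longleftrightarrow> prob_space M \<and>
     (\<forall>\<omega>\<in>space M. X \<omega> \<in> pos_homs) \<and>
     (\<lambda>\<omega>. hom_point (X \<omega>)) \<in> borel_measurable M \<and>
     (\<forall>F. (\<integral>\<omega>. X \<omega> (of_flag F) \<partial>M) =
            \<phi> (downward F) / \<phi> (downward (unit_flag :: ty_A flag)))"

definition phi_qr :: "ty_0 flag \<Rightarrow> real" where
  "phi_qr T = fact (flag_size T) /
     (real (automorphism_count T) * 2 ^ (flag_size T choose 2))"

text \<open>The vertices \<open>0\<close>, \<open>1\<close> carry the labels 1, 2; the vertex \<open>2\<close> is unlabelled.\<close>

definition C3_A :: "ty_A flag" where
  "C3_A = flag_class (Abs_cflag ({0, 1, 2}, {(0, 1), (1, 2), (2, 0)}, [0, 1]))"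

lemma is_flag_C3_A: "is_flag TYPE(ty_A) {0, 1, 2 :: nat} {(0, 1), (1, 2), (2, 0)} [0, 1]"
proof -
  have "tournament {0, 1, 2 :: nat} {(0, 1), (1, 2), (2, 0)}"
    unfolding tournament_def by simp
  thus ?thesis
    by (simp add: is_flag_def type_size_ty_A_def type_arcs_ty_A_def less_Suc_eq numeral_2_eq_2
        all_conj_distrib)
qed

lemma is_flag_unit:
  "is_flag TYPE('s::tournament_type) {..<type_size TYPE('s)} (type_arcs TYPE('s))
     [0..<type_size TYPE('s)]"
  using tournament_type[where 'a = 's] by (auto simp: is_flag_def)

end

theory Submission
  imports Defs
begin

text \<open>
  A positive homomorphism \<open>\<phi>\<close> of unlabelled tournaments encodes an exchangeable random tournament: for
  every \<open>n\<close>, draw an isomorphism class of size \<open>n\<close> with the probabilities \<open>\<phi>\<close> and number its vertices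
  at random. The relations of the flag algebra make these laws consistent under all injections
  (\<open>random_tournament_law\<close>), and \<open>\<phi>\<close> is quasi-random exactly when all of them are uniform
  (\<open>phi_qr_iff_uniform\<close>, an orbit--stabiliser count).

  The random variable \<open>\<phi>\<^sup>A(C)\<close>, where \<open>C\<close> is the cyclic triangle with a labelled arc, is almost surely
  \<open>1/4\<close> iff its first two moments are \<open>1/4\<close> and \<open>1/16\<close>. These moments are probabilities of
  configurations of three and four random vertices (\<open>extension_moments\<close>): a cyclic triangle, and two
  cyclic triangles on a common arc. Let \<open>g\<close> be the matrix with entries \<open>1\<close> and \<open>-1\<close> of the arc
  directions, \<open>d = E(g 0 1 * g 0 2)\<close> the second moment of the normalised scores and
  \<open>K = E(g 0 2 * g 0 3 * g 1 2 * g 1 3)\<close> the signed 4-cycle density. Expanding the indicators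
  \<open>(1 + g) / 2\<close> shows that the first moment is \<open>(1 - 3 d) / 4\<close>, so it is \<open>1/4\<close> iff \<open>d = 0\<close>. If
  \<open>d = 0\<close>, every product of entries of \<open>g\<close> whose graph has a leaf has expectation \<open>0\<close>
  (\<open>leaf_zero\<close>), and almost all of the expansion of the second moment disappears: what is left is
  \<open>(1 + K) / 16\<close>. So the almost sure identity means \<open>d = K = 0\<close>.

  If \<open>K = 0\<close>, then the law is uniform, by the argument of Chung and Graham: two applications of
  Cauchy--Schwarz bound the expectation of any nonempty product of entries of \<open>g\<close> by a power of \<open>K\<close>
  (\<open>edge_zero\<close>), so all nontrivial Fourier coefficients of the law vanish
  (\<open>expectation_uniform\<close>). Conversely \<open>d\<close> and \<open>K\<close> vanish under the uniform law, because reversing a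
  single arc changes the sign of the products.

  No limit objects occur. Where an argument about them would integrate over the position of a vertex
  and use Cauchy--Schwarz, the proofs below average over \<open>M\<close> further vertices of the same random
  tournament; the terms in which two of these coincide are of smaller order, and \<open>M\<close> is arbitrary.
\<close>

section \<open>Tournaments on initial segments\<close>

definition tournaments :: "nat \<Rightarrow> (nat \<times> nat) set set" where
  "tournaments n = {E. tournament {..<n} E}"

text \<open>
  The pullback \<open>x\<^sup>*E\<close> of a relation along \<open>x\<close>, cut down to the vertices below \<open>n\<close> so that its value
  depends on \<open>x\<close> there only. Restriction to a subset and relabelling are both pullbacks along
  injections.
\<close>

definition pull :: "(nat \<Rightarrow> nat) \<Rightarrow> nat \<Rightarrow> (nat \<times> nat) set \<Rightarrow> (nat \<times> nat) set" where
  "pull x n E = {(i, j). i < n \<and> j < n \<and> (x i, x j) \<in> E}"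

text \<open>
  A difference of indicators rather than a case distinction: antisymmetric and at most 1 in absolute
  value for every relation \<open>E\<close>, and \<open>0\<close> only on the diagonal if \<open>E\<close> is a tournament on its vertices.
\<close>

definition arc_sign :: "(nat \<times> nat) set \<Rightarrow> nat \<Rightarrow> nat \<Rightarrow> real" where
  "arc_sign E i j = of_bool ((i, j) \<in> E) - of_bool ((j, i) \<in> E)"

lemma finite_tournaments: "finite (tournaments n)"
  by (rule finite_subset[of _ "Pow ({..<n} \<times> {..<n})"]) (auto simp: tournaments_def tournament_def)

lemma arc_sign_swap: "arc_sign E j i = - arc_sign E i j"
  by (simp add: arc_sign_def)

lemma abs_arc_sign_le: "\<bar>arc_sign E i j\<bar> \<le> 1"
  by (simp add: arc_sign_def)

lemma abs_mult_le_1: "\<bar>a\<bar> \<le> 1 \<Longrightarrow> \<bar>b\<bar> \<le> 1 \<Longrightarrow> \<bar>a * b :: real\<bar> \<le> 1"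
  by (metis abs_ge_zero abs_mult mult_le_one)

lemma arc_sign_pull: "i < n \<Longrightarrow> j < n \<Longrightarrow> arc_sign (pull x n E) i j = arc_sign E (x i) (x j)"
  by (simp add: arc_sign_def pull_def)

lemma tournament_arcs:
  assumes "tournament V E" "u \<in> V" "v \<in> V" "u \<noteq> v"
  shows "((u, v) \<in> E) \<noteq> ((v, u) \<in> E)"
  by (rule assms(1)[unfolded tournament_def, THEN conjunct2, THEN conjunct2, THEN conjunct2, rule_format])
    (fact assms)+

lemma tournaments_arcs:
  assumes "E \<in> tournaments n" "i < n" "j < n" "i \<noteq> j"
  shows "((i, j) \<in> E) \<noteq> ((j, i) \<in> E)"
  using assms by (intro tournament_arcs[of "{..<n}"]) (simp_all add: tournaments_def)

lemma arc_iff_arc_sign: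
  assumes "E \<in> tournaments n" "i < n" "j < n" "i \<noteq> j"
  shows "of_bool ((i, j) \<in> E) = (1 + arc_sign E i j) / 2"
  using tournaments_arcs[OF assms] by (auto simp: arc_sign_def)

lemma arc_sign_square:
  assumes "E \<in> tournaments n" "i < n" "j < n" "i \<noteq> j"
  shows "arc_sign E i j * arc_sign E i j = 1"
  using tournaments_arcs[OF assms] by (auto simp: arc_sign_def)

lemma pull_tournament:
  assumes "tournament V E" "inj_on x {..<n}" "x ` {..<n} \<subseteq> V"
  shows "pull x n E \<in> tournaments n"
proof -
  have V: "x i \<in> V" if "i < n" for i using assms(3) that by auto
  have "((x i, x j) \<in> E) \<noteq> ((x j, x i) \<in> E)" if "i < n" "j < n" "i \<noteq> j" for i j
  proof -
    have "x i \<noteq> x j" using assms(2) that by (auto dest: inj_onD)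
    thus ?thesis by (rule tournament_arcs[OF assms(1) V[OF that(1)] V[OF that(2)]])
  qed
  moreover have "(x i, x i) \<notin> E" if "i < n" for i
    using assms(1) V[OF that] by (auto simp: tournament_def)
  moreover have "pull x n E \<subseteq> {..<n} \<times> {..<n}" by (auto simp: pull_def)
  moreover have "(i, j) \<in> pull x n E \<longleftrightarrow> (x i, x j) \<in> E" if "i < n" "j < n" for i j
    using that by (simp add: pull_def)
  ultimately show ?thesis
    unfolding tournaments_def tournament_def mem_Collect_eq
    by (intro conjI ballI impI) (simp_all only: finite_lessThan lessThan_iff not_False_eq_True)
qed

lemma pull_tournaments:
  assumes "E \<in> tournaments N" "inj_on x {..<n}" "x ` {..<n} \<subseteq> {..<N}"
  shows "pull x n E \<in> tournaments n"
  using pull_tournament assms by (auto simp: tournaments_def)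

text \<open>
  In a graphon-style argument, \<open>w\<close> would be called independent of the coordinate \<open>q\<close>: the arcs at the
  vertex \<open>q\<close> do not influence it. Such a \<open>w\<close> keeps its value when \<open>q\<close> alone is moved elsewhere.
\<close>

definition ignores :: "nat \<Rightarrow> ((nat \<times> nat) set \<Rightarrow> real) \<Rightarrow> bool" where
  "ignores q w \<longleftrightarrow> (\<forall>E E'. (\<forall>i j. i \<noteq> q \<longrightarrow> j \<noteq> q \<longrightarrow> (i, j) \<in> E \<longleftrightarrow> (i, j) \<in> E') \<longrightarrow> w E = w E')"

lemma ignoresD:
  assumes "ignores q w" "\<And>i j. i \<noteq> q \<Longrightarrow> j \<noteq> q \<Longrightarrow> (i, j) \<in> E \<longleftrightarrow> (i, j) \<in> E'"
  shows "w E = w E'"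
  by (rule assms(1)[unfolded ignores_def, rule_format]) (rule assms(2))

lemma ignoresI:
  assumes "\<And>E E'. (\<And>i j. i \<noteq> q \<Longrightarrow> j \<noteq> q \<Longrightarrow> (i, j) \<in> E \<longleftrightarrow> (i, j) \<in> E') \<Longrightarrow> w E = w E'"
  shows "ignores q w"
  unfolding ignores_def by (intro allI impI assms) simp

lemma ignores_arc_sign: "i \<noteq> q \<Longrightarrow> j \<noteq> q \<Longrightarrow> ignores q (\<lambda>E. arc_sign E i j)"
  by (rule ignoresI) (simp add: arc_sign_def)

lemma ignores_mult:
  assumes "ignores q u" "ignores q v" shows "ignores q (\<lambda>E. u E * v E)"
  by (rule ignoresI, rule arg_cong2[where f = "(*)"]) (rule ignoresD[OF assms(1)] ignoresD[OF assms(2)], assumption)+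

lemma ignores_prod:
  assumes "\<And>e. e \<in> H \<Longrightarrow> ignores q (u e)"
  shows "ignores q (\<lambda>E. \<Prod>e\<in>H. u e E)"
  by (rule ignoresI, rule prod.cong[OF refl]) (rule ignoresD[OF assms])

lemma ignores_pull:
  assumes "ignores q w" "\<And>i. i < n \<Longrightarrow> i \<noteq> q \<Longrightarrow> x i = y i"
  shows "w (pull x n E) = w (pull y n E)"
  by (rule ignoresD[OF assms(1)]) (use assms(2) in \<open>auto simp: pull_def\<close>)

text \<open>
  One orientation of every pair of vertices, hence one coordinate per arc: a tournament on \<open>{..<n}\<close> is
  determined by its signs on this set.
\<close>

definition edges :: "nat \<Rightarrow> (nat \<times> nat) set" where
  "edges n = {(i, j). i < j \<and> j < n}"

lemma finite_edges: "finite (edges n)"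
  by (rule finite_subset[of _ "{..<n} \<times> {..<n}"]) (auto simp: edges_def)

lemma card_edges: "card (edges n) = n choose 2"
proof -
  have "bij_betw (\<lambda>(i, j). {i, j}) (edges n) {W. W \<subseteq> {..<n} \<and> card W = 2}"
    unfolding bij_betw_def
  proof
    show "inj_on (\<lambda>(i, j). {i, j}) (edges n)"
      by (auto simp: inj_on_def edges_def doubleton_eq_iff)
    show "(\<lambda>(i, j). {i, j}) ` edges n = {W. W \<subseteq> {..<n} \<and> card W = 2}"
    proof
      show "{W. W \<subseteq> {..<n} \<and> card W = 2} \<subseteq> (\<lambda>(i, j). {i, j}) ` edges n"
      proof
        fix W assume "W \<in> {W. W \<subseteq> {..<n} \<and> card W = 2}"
        then obtain i j where "W = {i, j}" "i \<noteq> j" "i < n" "j < n"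
          by (auto simp: card_2_iff)
        hence "(min i j, max i j) \<in> edges n" "W = {min i j, max i j}"
          by (auto simp: edges_def min_def max_def)
        thus "W \<in> (\<lambda>(i, j). {i, j}) ` edges n" by force
      qed
    qed (auto simp: edges_def)
  qed
  hence "card (edges n) = card {W. W \<subseteq> {..<n} \<and> card W = 2}" by (rule bij_betw_same_card)
  thus ?thesis by (simp add: n_subsets)
qed

lemma tournament_eqI:
  assumes "E \<in> tournaments n" "T \<in> tournaments n" "E \<inter> edges n = T \<inter> edges n"
  shows "E = T"
proof -
  have e: "(i, j) \<in> E \<longleftrightarrow> (i, j) \<in> T" if "i < j" "j < n" for i j
    using assms(3) that unfolding edges_def by blast
  have *: "(i, j) \<in> E \<longleftrightarrow> (i, j) \<in> T" if "i < n" "j < n" "i \<noteq> j" for i j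
    using e[of i j] e[of j i] tournaments_arcs[OF assms(1) that] tournaments_arcs[OF assms(2) that] that
    by (cases i j rule: linorder_cases) auto
  have sub: "X \<subseteq> {..<n} \<times> {..<n} - Id" if "X \<in> tournaments n" for X
    using that by (auto simp: tournaments_def tournament_def)
  show ?thesis
    using * sub[OF assms(1)] sub[OF assms(2)] by blast
qed

text \<open>
  The Fourier expansion of a point mass on the cube \<open>{-1, 1}\<close> to the power \<open>edges n\<close>: the factor at an
  edge is 1 when \<open>E\<close> and \<open>T\<close> agree there and 0 when they differ.
\<close>

lemma indicator_fourier:
  assumes T: "T \<in> tournaments n" and E: "E \<in> tournaments n"
  shows "of_bool (E = T) = (\<Sum>H\<in>Pow (edges n). (\<Prod>e\<in>H. arc_sign T (fst e) (snd e)) *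
    (\<Prod>e\<in>H. arc_sign E (fst e) (snd e))) / 2 ^ (n choose 2)"
proof -
  let ?s = "\<lambda>E e. arc_sign E (fst e) (snd e)"
  have "of_bool (E = T) = (\<Prod>e\<in>edges n. (?s T e * ?s E e + 1) / 2)"
  proof (cases "E = T")
    case True
    have "(?s T e * ?s E e + 1) / 2 = 1" if "e \<in> edges n" for e
      using that True arc_sign_square[OF T, of "fst e" "snd e"] by (auto simp: edges_def)
    thus ?thesis using True by simp
  next
    case False
    hence "E \<inter> edges n \<noteq> T \<inter> edges n" using tournament_eqI[OF E T] by blast
    then obtain i j where e: "(i, j) \<in> edges n" "((i, j) \<in> E) \<noteq> ((i, j) \<in> T)"
      by (auto simp: set_eq_iff)
    hence ij: "i < n" "j < n" "i \<noteq> j" by (auto simp: edges_def)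
    have "?s T (i, j) * ?s E (i, j) + 1 = 0"
      using e(2) tournaments_arcs[OF E ij] tournaments_arcs[OF T ij] by (auto simp: arc_sign_def)
    hence "(\<Prod>e\<in>edges n. (?s T e * ?s E e + 1) / 2) = 0"
      using e(1) by (intro prod_zero finite_edges) force
    thus ?thesis using False by simp
  qed
  also have "\<dots> = (\<Prod>e\<in>edges n. ?s T e * ?s E e + 1) / 2 ^ (n choose 2)"
    by (simp add: prod_dividef card_edges)
  also have "\<dots> = (\<Sum>H\<in>Pow (edges n). (\<Prod>e\<in>H. ?s T e) * (\<Prod>e\<in>H. ?s E e)) / 2 ^ (n choose 2)"
    by (simp add: prod_add[OF finite_edges] prod.distrib)
  finally show ?thesis .
qed

definition flip :: "nat \<Rightarrow> nat \<Rightarrow> (nat \<times> nat) set \<Rightarrow> (nat \<times> nat) set" where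
  "flip p q E = {(i, j). ((i, j) \<in> E) \<noteq> ({i, j} = {p, q})}"

lemma arc_sign_flip:
  assumes "E \<in> tournaments n" "p < n" "q < n" "p \<noteq> q"
  shows "arc_sign (flip p q E) i j = (if {i, j} = {p, q} then - arc_sign E i j else arc_sign E i j)"
proof (cases "{i, j} = {p, q}")
  case True
  hence "(i, j) = (p, q) \<or> (i, j) = (q, p)" by (auto simp: doubleton_eq_iff)
  hence "((i, j) \<in> E) \<noteq> ((j, i) \<in> E)" using tournaments_arcs[OF assms] by auto
  thus ?thesis using True by (simp add: arc_sign_def flip_def insert_commute)
next
  case False
  thus ?thesis by (simp add: arc_sign_def flip_def insert_commute)
qed

lemma flip_tournaments:
  assumes "E \<in> tournaments n" "p < n" "q < n" "p \<noteq> q"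
  shows "flip p q E \<in> tournaments n"
proof -
  have "((i, j) \<in> flip p q E) \<noteq> ((j, i) \<in> flip p q E)" if "i < n" "j < n" "i \<noteq> j" for i j
    using tournaments_arcs[OF assms(1) that] by (simp add: flip_def insert_commute)
  moreover have "flip p q E \<subseteq> {..<n} \<times> {..<n}"
    using assms by (auto simp: flip_def tournaments_def tournament_def doubleton_eq_iff)
  moreover have "(i, i) \<notin> flip p q E" for i
    using assms by (auto simp: flip_def tournaments_def tournament_def doubleton_eq_iff)
  ultimately show ?thesis
    unfolding tournaments_def tournament_def mem_Collect_eq
    by (intro conjI ballI impI) (simp_all only: finite_lessThan lessThan_iff not_False_eq_True)
qed

lemma flip_flip: "flip p q (flip p q E) = E"
  by (auto simp: flip_def)

text \<open>
  Under the uniform law the arcs are independent and symmetric; the corresponding cancellation is the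
  involution that reverses a single arc.
\<close>

lemma sum_tournaments_flip:
  fixes f :: "(nat \<times> nat) set \<Rightarrow> real"
  assumes "p < n" "q < n" "p \<noteq> q" "\<And>E. E \<in> tournaments n \<Longrightarrow> f (flip p q E) = - f E"
  shows "(\<Sum>E\<in>tournaments n. f E) = 0"
proof -
  have "bij_betw (flip p q) (tournaments n) (tournaments n)"
    by (rule bij_betw_byWitness[where f' = "flip p q"])
      (use assms in \<open>auto simp: flip_flip intro: flip_tournaments\<close>)
  hence "(\<Sum>E\<in>tournaments n. f E) = (\<Sum>E\<in>tournaments n. f (flip p q E))"
    by (rule sum.reindex_bij_betw[symmetric])
  also have "\<dots> = - (\<Sum>E\<in>tournaments n. f E)"
    by (simp add: assms(4) flip: sum_negf)
  finally show ?thesis by simp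
qed

section \<open>Exchangeable random tournaments\<close>

text \<open>
  The finite inequality that bounds a cut norm by a count of 4-cycles. Cauchy--Schwarz over \<open>a\<close>
  removes \<open>U\<close>, and a second application, over the pairs \<open>(b, b')\<close> that result from expanding the
  square, removes \<open>V\<close>; only the correlations of the columns of \<open>g\<close> remain.
\<close>

lemma bilinear_form_fourth_power:
  fixes g :: "nat \<Rightarrow> nat \<Rightarrow> real"
  assumes U: "\<And>a. \<bar>U a\<bar> \<le> 1" and V: "\<And>b. \<bar>V b\<bar> \<le> 1"
  shows "(\<Sum>a<M. \<Sum>b<M. g a b * (U a * V b)) ^ 4 \<le>
    real M ^ 4 * (\<Sum>b<M. \<Sum>b'<M. (\<Sum>a<M. g a b * g a b')\<^sup>2)"
proof -
  define S where "S = (\<Sum>a<M. \<Sum>b<M. g a b * (U a * V b))"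
  define C where "C b b' = (\<Sum>a<M. g a b * g a b')" for b b'
  define R where "R = (\<Sum>a<M. (\<Sum>b<M. g a b * V b)\<^sup>2)"
  have "S\<^sup>2 = (\<Sum>a<M. U a * (\<Sum>b<M. g a b * V b))\<^sup>2"
    by (simp add: S_def sum_distrib_left mult_ac)
  also have "\<dots> \<le> (\<Sum>a<M. (U a)\<^sup>2) * R"
    unfolding R_def by (rule Cauchy_Schwarz_ineq_sum)
  also have "(\<Sum>a<M. (U a)\<^sup>2) \<le> (\<Sum>a<M. 1)"
    using U by (intro sum_mono) (simp add: abs_square_le_1)
  finally have S: "S\<^sup>2 \<le> M * R" by (simp add: R_def mult_right_mono sum_nonneg)
  have "R = (\<Sum>a<M. \<Sum>p\<in>{..<M} \<times> {..<M}. V (fst p) * V (snd p) * (g a (fst p) * g a (snd p)))"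
    by (simp add: R_def power2_eq_square sum_product sum.cartesian_product mult_ac case_prod_beta)
  also have "\<dots> = (\<Sum>p\<in>{..<M} \<times> {..<M}. V (fst p) * V (snd p) * C (fst p) (snd p))"
    by (subst sum.swap) (simp add: C_def sum_distrib_left)
  finally have "R\<^sup>2 \<le> (\<Sum>p\<in>{..<M} \<times> {..<M}. (V (fst p) * V (snd p))\<^sup>2) *
      (\<Sum>p\<in>{..<M} \<times> {..<M}. (C (fst p) (snd p))\<^sup>2)"
    using Cauchy_Schwarz_ineq_sum by simp
  also have "(\<Sum>p\<in>{..<M} \<times> {..<M}. (V (fst p) * V (snd p))\<^sup>2) \<le> (\<Sum>p\<in>{..<M} \<times> {..<M}. 1)"
    by (intro sum_mono) (simp add: abs_square_le_1 abs_mult_le_1 V)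
  finally have R: "R\<^sup>2 \<le> M ^ 2 * (\<Sum>p\<in>{..<M} \<times> {..<M}. (C (fst p) (snd p))\<^sup>2)"
    by (simp add: mult_right_mono sum_nonneg power2_eq_square)
  have "S ^ 4 = (S\<^sup>2)\<^sup>2" by simp
  also have "\<dots> \<le> (M * R)\<^sup>2" using S by (intro power_mono) auto
  also have "\<dots> = M ^ 2 * R\<^sup>2" by (simp add: power_mult_distrib)
  also have "\<dots> \<le> M ^ 2 * (M ^ 2 * (\<Sum>p\<in>{..<M} \<times> {..<M}. (C (fst p) (snd p))\<^sup>2))"
    using R by (intro mult_left_mono) auto
  also have "\<dots> = M ^ 4 * (\<Sum>b<M. \<Sum>b'<M. (C b b')\<^sup>2)"
    by (simp add: sum.cartesian_product case_prod_beta power_numeral_reduce mult_ac)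
  finally show ?thesis by (simp add: S_def C_def)
qed

text \<open>
  The expectation operators of an exchangeable random tournament on the natural numbers, given only by
  its finite restrictions: \<open>\<E> n f\<close> is the expectation of \<open>f\<close> of the tournament induced on \<open>{..<n}\<close>.
  The axiom \<open>pull\<close> says both that these restrictions are consistent and that the law does not depend
  on the numbering of the vertices.
\<close>

locale random_tournament =
  fixes \<E> :: "nat \<Rightarrow> ((nat \<times> nat) set \<Rightarrow> real) \<Rightarrow> real"
  assumes add: "\<E> n (\<lambda>E. f E + h E) = \<E> n f + \<E> n h"
    and scale: "\<E> n (\<lambda>E. c * f E) = c * \<E> n f"
    and nonneg: "(\<And>E. E \<in> tournaments n \<Longrightarrow> 0 \<le> f E) \<Longrightarrow> 0 \<le> \<E> n f"
    and one: "\<E> n (\<lambda>_. 1) = 1"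
    and pull: "inj_on y {..<n} \<Longrightarrow> y ` {..<n} \<subseteq> {..<N} \<Longrightarrow> \<E> N (\<lambda>E. f (pull y n E)) = \<E> n f"
begin

lemma uminus: "\<E> n (\<lambda>E. - f E) = - \<E> n f"
  using scale[of n "-1" f] by simp

lemma diff: "\<E> n (\<lambda>E. f E - h E) = \<E> n f - \<E> n h"
  using add[of n f "\<lambda>E. - h E"] by (simp add: uminus)

lemma const: "\<E> n (\<lambda>_. c) = c"
  using scale[of n c "\<lambda>_. 1"] by (simp add: one)

lemma mono: "(\<And>E. E \<in> tournaments n \<Longrightarrow> f E \<le> h E) \<Longrightarrow> \<E> n f \<le> \<E> n h"
  using nonneg[of n "\<lambda>E. h E - f E"] by (simp add: diff)

lemma cong: "(\<And>E. E \<in> tournaments n \<Longrightarrow> f E = h E) \<Longrightarrow> \<E> n f = \<E> n h"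
  by (intro antisym mono) auto

lemma sum: "\<E> n (\<lambda>E. \<Sum>i\<in>I. f i E) = (\<Sum>i\<in>I. \<E> n (f i))"
  by (induction I rule: infinite_finite_induct) (simp_all add: add const)

lemma square_le: "(\<E> n f)\<^sup>2 \<le> \<E> n (\<lambda>E. (f E)\<^sup>2)"
proof -
  have "0 \<le> \<E> n (\<lambda>E. (f E - \<E> n f)\<^sup>2)" by (intro nonneg) simp
  also have "(\<lambda>E. (f E - \<E> n f)\<^sup>2) = (\<lambda>E. (f E)\<^sup>2 + (\<E> n f)\<^sup>2 - (2 * \<E> n f) * f E)"
    by (simp add: power2_diff algebra_simps)
  also have "\<E> n \<dots> = \<E> n (\<lambda>E. (f E)\<^sup>2) + (\<E> n f)\<^sup>2 - 2 * \<E> n f * \<E> n f"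
    unfolding diff add scale const ..
  finally show ?thesis by (simp add: power2_eq_square)
qed

lemma permutation_antisymmetric:
  assumes "y permutes {..<n}" "\<And>E. E \<in> tournaments n \<Longrightarrow> f (pull y n E) = - f E"
  shows "\<E> n f = 0"
proof -
  have "\<E> n f = \<E> n (\<lambda>E. f (pull y n E))"
    using pull[of y n n f] permutes_inj_on[OF assms(1)] permutes_image[OF assms(1)] by simp
  also have "\<dots> = - \<E> n f" using cong[of n "\<lambda>E. f (pull y n E)" "\<lambda>E. - f E"] assms(2) by (simp add: uminus)
  finally show ?thesis by simp
qed

text \<open>
  The hypothesis says that the normalised score \<open>d(x)\<close>, the mean of \<open>arc_sign x y\<close> over \<open>y\<close>, has second
  moment 0. The claim is \<open>\<E>(w d(p)) = 0\<close>, which is then immediate for limit objects. Here the average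
  over \<open>y\<close> is replaced by an average over \<open>M\<close> fresh copies \<open>n, \<dots>, n + M - 1\<close> of the vertex \<open>q\<close>.
  Only the coinciding pairs of copies contribute to the second moment of this average, which is
  therefore at most \<open>1 / M\<close>.
\<close>

lemma leaf_zero:
  assumes d2: "\<E> 3 (\<lambda>E. arc_sign E 0 1 * arc_sign E 0 2) = 0"
    and pq: "p < n" "q < n" "p \<noteq> q"
    and w: "ignores q w" "\<And>E. \<bar>w E\<bar> \<le> 1"
  shows "\<E> n (\<lambda>E. arc_sign E p q * w E) = 0"
proof (rule ccontr)
  define c where "c = \<E> n (\<lambda>E. arc_sign E p q * w E)"
  assume "\<E> n (\<lambda>E. arc_sign E p q * w E) \<noteq> 0"
  hence "c\<^sup>2 > 0" by (simp add: c_def)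
  then obtain M :: nat where M: "1 < M * c\<^sup>2" using reals_Archimedean3 by blast
  define y where "y b = (\<lambda>i. if i = q then n + b else i)" for b
  \<comment> \<open>the value of \<open>w\<close> on the first \<open>n\<close> vertices, which moving \<open>q\<close> does not change\<close>
  define W where "W E = w (pull (\<lambda>i. i) n E)" for E
  have "c = \<E> (n + M) (\<lambda>E. arc_sign E p (n + b) * W E)" if "b < M" for b
  proof -
    have "inj_on (y b) {..<n}" "y b ` {..<n} \<subseteq> {..<n + M}"
      using that pq(2) by (auto simp: y_def inj_on_def)
    from pull[OF this, of "\<lambda>E. arc_sign E p q * w E"]
    have "c = \<E> (n + M) (\<lambda>E. arc_sign (pull (y b) n E) p q * w (pull (y b) n E))"
      by (simp add: c_def)
    also have "\<dots> = \<E> (n + M) (\<lambda>E. arc_sign E p (n + b) * W E)"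
      using pq ignores_pull[OF w(1), of n "y b" "\<lambda>i. i"]
      by (intro cong) (auto simp: arc_sign_pull y_def W_def)
    finally show ?thesis .
  qed
  hence "(\<Sum>b<M. c) = (\<Sum>b<M. \<E> (n + M) (\<lambda>E. arc_sign E p (n + b) * W E))"
    by (intro sum.cong) auto
  also have "\<dots> = \<E> (n + M) (\<lambda>E. (\<Sum>b<M. arc_sign E p (n + b)) * W E)"
    by (simp add: sum_distrib_right sum)
  finally have "(M * c)\<^sup>2 = (\<E> (n + M) (\<lambda>E. (\<Sum>b<M. arc_sign E p (n + b)) * W E))\<^sup>2"
    by simp
  also have "\<dots> \<le> \<E> (n + M) (\<lambda>E. ((\<Sum>b<M. arc_sign E p (n + b)) * W E)\<^sup>2)" by (rule square_le)
  also have "\<dots> \<le> \<E> (n + M) (\<lambda>E. (\<Sum>b<M. arc_sign E p (n + b))\<^sup>2)"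
    using w(2) by (intro mono) (auto simp: power_mult_distrib W_def abs_square_le_1 intro!: mult_left_le)
  also have "\<dots> = (\<Sum>b<M. \<Sum>b'<M. \<E> (n + M) (\<lambda>E. arc_sign E p (n + b) * arc_sign E p (n + b')))"
    by (simp add: power2_eq_square sum_product sum)
  also have "\<dots> = (\<Sum>b<M. \<Sum>b'<M. of_bool (b = b'))"
  proof (intro sum.cong refl)
    fix b b' assume b: "b \<in> {..<M}" "b' \<in> {..<M}"
    show "\<E> (n + M) (\<lambda>E. arc_sign E p (n + b) * arc_sign E p (n + b')) = of_bool (b = b')"
    proof (cases "b = b'")
      case True
      have "\<E> (n + M) (\<lambda>E. arc_sign E p (n + b) * arc_sign E p (n + b)) = \<E> (n + M) (\<lambda>_. 1)"
        using b pq by (intro cong arc_sign_square[of _ "n + M"]) auto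
      thus ?thesis using True by (simp add: one)
    next
      case False
      define z where "z = (\<lambda>i::nat. if i = 0 then p else if i = 1 then n + b else n + b')"
      have "inj_on z {..<3}" "z ` {..<3} \<subseteq> {..<n + M}"
        using b pq False by (auto simp: z_def inj_on_def)
      from pull[OF this, of "\<lambda>E. arc_sign E 0 1 * arc_sign E 0 2"] d2
      show ?thesis using False by (simp add: arc_sign_pull z_def)
    qed
  qed
  also have "\<dots> = M" by simp
  finally have "real M * (M * c\<^sup>2) \<le> real M * 1" by (simp add: power2_eq_square algebra_simps)
  moreover have "0 < real M" using M by (cases M) auto
  ultimately have "M * c\<^sup>2 \<le> 1" by (rule mult_left_le_imp_le)
  with M show False by simp
qed

text \<open>
  The counting step of the Chung--Graham theory of quasi-randomness: if the signed 4-cycle density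
  vanishes, then the sign of an arc is uncorrelated with every product of a function that does not see
  one end and a function that does not see the other. As before, both ends are spread over \<open>M\<close> fresh
  copies: \<open>n + a\<close> stands for \<open>p\<close> and \<open>n + M + b\<close> for \<open>q\<close>. In the fourth power of the resulting
  bilinear form the 4-cycles on distinct vertices have expectation 0, and the degenerate ones, at
  most \<open>2 M\<^sup>3\<close> in number, are too few to matter against the normalisation \<open>M\<^sup>4\<close>.
\<close>

lemma edge_zero:
  assumes K: "\<E> 4 (\<lambda>E. arc_sign E 0 2 * arc_sign E 0 3 * arc_sign E 1 2 * arc_sign E 1 3) = 0"
    and pq: "p < n" "q < n" "p \<noteq> q"
    and u: "ignores q u" "\<And>E. \<bar>u E\<bar> \<le> 1"
    and v: "ignores p v" "\<And>E. \<bar>v E\<bar> \<le> 1"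
  shows "\<E> n (\<lambda>E. arc_sign E p q * (u E * v E)) = 0"
proof (rule ccontr)
  define c where "c = \<E> n (\<lambda>E. arc_sign E p q * (u E * v E))"
  assume "\<E> n (\<lambda>E. arc_sign E p q * (u E * v E)) \<noteq> 0"
  hence "c ^ 4 > 0" by (simp add: c_def)
  then obtain M :: nat where M: "2 < M * c ^ 4" using reals_Archimedean3 by blast
  define N where "N = n + 2 * M"
  define g where "g E a b = arc_sign E (n + a) (n + M + b)" for E a b
  define y where "y a b = (\<lambda>i. if i = p then n + a else if i = q then n + M + b else i)" for a b
  \<comment> \<open>the copy 0 of the vertex that \<open>u\<close> (respectively \<open>v\<close>) ignores is an arbitrary choice\<close>
  define U where "U a E = u (pull (y a 0) n E)" for a E
  define V where "V b E = v (pull (y 0 b) n E)" for b E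
  have c: "c = \<E> N (\<lambda>E. g E a b * (U a E * V b E))" if "a < M" "b < M" for a b
  proof -
    have "inj_on (y a b) {..<n}" "y a b ` {..<n} \<subseteq> {..<N}"
      using that by (auto simp: y_def inj_on_def N_def)
    from pull[OF this, of "\<lambda>E. arc_sign E p q * (u E * v E)"]
    have "c = \<E> N (\<lambda>E. arc_sign (pull (y a b) n E) p q * (u (pull (y a b) n E) * v (pull (y a b) n E)))"
      by (simp add: c_def)
    also have "\<dots> = \<E> N (\<lambda>E. g E a b * (U a E * V b E))"
      using pq ignores_pull[OF u(1), of n "y a b" "y a 0"] ignores_pull[OF v(1), of n "y a b" "y 0 b"]
      by (simp add: arc_sign_pull y_def U_def V_def g_def)
    finally show ?thesis .
  qed
  have "(\<Sum>a<M. \<Sum>b<M. c) = (\<Sum>a<M. \<Sum>b<M. \<E> N (\<lambda>E. g E a b * (U a E * V b E)))"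
    by (intro sum.cong refl c) auto
  also have "\<dots> = \<E> N (\<lambda>E. \<Sum>a<M. \<Sum>b<M. g E a b * (U a E * V b E))"
    by (simp add: sum)
  finally have "M ^ 2 * c = \<E> N (\<lambda>E. \<Sum>a<M. \<Sum>b<M. g E a b * (U a E * V b E))"
    by (simp add: power2_eq_square)
  hence "(M ^ 2 * c) ^ 4 = ((\<E> N (\<lambda>E. \<Sum>a<M. \<Sum>b<M. g E a b * (U a E * V b E)))\<^sup>2)\<^sup>2"
    by simp
  also have "\<dots> \<le> (\<E> N (\<lambda>E. (\<Sum>a<M. \<Sum>b<M. g E a b * (U a E * V b E))\<^sup>2))\<^sup>2"
    by (intro power_mono square_le) simp
  also have "\<dots> \<le> \<E> N (\<lambda>E. ((\<Sum>a<M. \<Sum>b<M. g E a b * (U a E * V b E))\<^sup>2)\<^sup>2)"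
    by (rule square_le)
  also have "\<dots> \<le> \<E> N (\<lambda>E. M ^ 4 * (\<Sum>b<M. \<Sum>b'<M. (\<Sum>a<M. g E a b * g E a b')\<^sup>2))"
    unfolding power_mult[symmetric] using u(2) v(2)
    by (intro mono) (simp, intro bilinear_form_fourth_power, auto simp: U_def V_def)
  also have "\<dots> = M ^ 4 * (\<Sum>b<M. \<Sum>b'<M. \<Sum>a<M. \<Sum>a'<M.
      \<E> N (\<lambda>E. g E a b * g E a b' * (g E a' b * g E a' b')))"
    by (simp add: scale sum power2_eq_square sum_product)
  also have "\<dots> \<le> M ^ 4 * (\<Sum>b<M. \<Sum>b'<M. \<Sum>a<M. \<Sum>a'<M. of_bool (a = a') + of_bool (b = b') :: real)"
  proof (intro mult_left_mono sum_mono)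
    fix a a' b b' assume ab: "a \<in> {..<M}" "a' \<in> {..<M}" "b \<in> {..<M}" "b' \<in> {..<M}"
    let ?F = "\<lambda>E. g E a b * g E a b' * (g E a' b * g E a' b')"
    show "\<E> N ?F \<le> of_bool (a = a') + of_bool (b = b')"
    proof (cases "a = a' \<or> b = b'")
      case True
      have "\<bar>?F E\<bar> \<le> 1" for E
        unfolding g_def by (intro abs_mult_le_1 abs_arc_sign_le)
      hence "\<E> N ?F \<le> \<E> N (\<lambda>_. 1)" by (intro mono) (auto dest: abs_le_D1)
      also have "\<dots> \<le> of_bool (a = a') + of_bool (b = b')" using True by (auto simp: one)
      finally show ?thesis .
    next
      case False
      define z where "z = (\<lambda>i::nat. if i = 0 then n + a else if i = 1 then n + a' else
        if i = 2 then n + M + b else n + M + b')"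
      have "inj_on z {..<4}" "z ` {..<4} \<subseteq> {..<N}"
        using ab False by (auto simp: z_def inj_on_def N_def)
      from pull[OF this, of "\<lambda>E. arc_sign E 0 2 * arc_sign E 0 3 * arc_sign E 1 2 * arc_sign E 1 3"] K
      show ?thesis using False by (simp add: arc_sign_pull z_def g_def mult.assoc)
    qed
  qed simp
  also have "\<dots> = M ^ 7 * 2"
    by (simp add: sum.distrib flip: sum_distrib_left) (simp add: power_numeral_reduce)
  finally have "real M ^ 7 * (M * c ^ 4) \<le> real M ^ 7 * 2" by (simp add: power_mult_distrib power_numeral_reduce mult_ac)
  moreover have "0 < real M ^ 7" using M by (cases M) auto
  ultimately have "M * c ^ 4 \<le> 2" by (rule mult_left_le_imp_le)
  with M show False by simp
qed

lemma abs_arc_sign_prod_le: "\<bar>\<Prod>e\<in>H. arc_sign E (fst e) (snd e)\<bar> \<le> 1"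
  unfolding abs_prod by (intro prod_le_1) (simp add: abs_arc_sign_le)

text \<open>
  Pick one edge \<open>(p, q)\<close> of \<open>H\<close>. The other edges of \<open>H\<close> cannot meet both \<open>p\<close> and \<open>q\<close>, so their product
  splits into a factor that ignores \<open>q\<close> and one that ignores \<open>p\<close>.
\<close>

lemma fourier_coefficient:
  assumes K: "\<E> 4 (\<lambda>E. arc_sign E 0 2 * arc_sign E 0 3 * arc_sign E 1 2 * arc_sign E 1 3) = 0"
    and H: "H \<subseteq> edges n" "H \<noteq> {}"
  shows "\<E> n (\<lambda>E. \<Prod>e\<in>H. arc_sign E (fst e) (snd e)) = 0"
proof -
  obtain p q where pq: "(p, q) \<in> H" using H(2) by auto
  hence n: "p < q" "q < n" using H(1) by (auto simp: edges_def)
  have fin: "finite H" using H(1) finite_edges by (rule finite_subset)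
  define A where "A = {e \<in> H. fst e \<noteq> q \<and> snd e \<noteq> q}"
  define B where "B = {e \<in> H. (fst e = q \<or> snd e = q) \<and> e \<noteq> (p, q)}"
  have split: "H = insert (p, q) (A \<union> B)" "(p, q) \<notin> A \<union> B" "A \<inter> B = {}"
    using pq by (auto simp: A_def B_def)
  have fAB: "finite A" "finite B" using fin by (auto simp: A_def B_def)
  let ?\<pi> = "\<lambda>X E. \<Prod>e\<in>X. arc_sign E (fst e) (snd e)"
  have "(\<lambda>E. ?\<pi> H E) = (\<lambda>E. arc_sign E p q * (?\<pi> A E * ?\<pi> B E))"
    unfolding split(1) using split(2,3) fAB by (simp add: prod.union_disjoint)
  moreover have "\<E> n \<dots> = 0"
  proof (rule edge_zero[OF K])
    show "ignores q (?\<pi> A)"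
      by (intro ignores_prod ignores_arc_sign) (auto simp: A_def)
    show "ignores p (?\<pi> B)"
      using H(1) n(1) by (intro ignores_prod ignores_arc_sign) (auto simp: B_def edges_def)
  qed (use n in \<open>auto simp: abs_arc_sign_prod_le\<close>)
  ultimately show ?thesis by simp
qed

theorem expectation_uniform:
  assumes K: "\<E> 4 (\<lambda>E. arc_sign E 0 2 * arc_sign E 0 3 * arc_sign E 1 2 * arc_sign E 1 3) = 0"
  shows "\<E> n h = (\<Sum>T\<in>tournaments n. h T) / 2 ^ (n choose 2)"
proof -
  have point: "\<E> n (\<lambda>E. of_bool (E = T)) = 1 / 2 ^ (n choose 2)" if T: "T \<in> tournaments n" for T
  proof -
    let ?s = "\<lambda>E e. arc_sign E (fst e) (snd e)"
    have "\<E> n (\<lambda>E. of_bool (E = T)) =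
        \<E> n (\<lambda>E. (\<Sum>H\<in>Pow (edges n). (\<Prod>e\<in>H. ?s T e) * (\<Prod>e\<in>H. ?s E e)) / 2 ^ (n choose 2))"
      using indicator_fourier[OF T] by (intro cong) auto
    also have "\<dots> = (\<Sum>H\<in>Pow (edges n). (\<Prod>e\<in>H. ?s T e) * \<E> n (\<lambda>E. \<Prod>e\<in>H. ?s E e)) / 2 ^ (n choose 2)"
      using scale[of n "1 / 2 ^ (n choose 2)"] by (simp add: scale sum)
    \<comment> \<open>only the constant coefficient survives\<close>
    also have "(\<Sum>H\<in>Pow (edges n). (\<Prod>e\<in>H. ?s T e) * \<E> n (\<lambda>E. \<Prod>e\<in>H. ?s E e)) =
        (\<Sum>H\<in>{{}}. (\<Prod>e\<in>H. ?s T e) * \<E> n (\<lambda>E. \<Prod>e\<in>H. ?s E e))"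
      using fourier_coefficient[OF K]
      by (intro sum.mono_neutral_right) (auto simp: finite_edges)
    finally show ?thesis by (simp add: one)
  qed
  have "\<E> n h = \<E> n (\<lambda>E. \<Sum>T\<in>tournaments n. h T * of_bool (E = T))"
    by (intro cong) (simp add: finite_tournaments)
  also have "\<dots> = (\<Sum>T\<in>tournaments n. h T) / 2 ^ (n choose 2)"
    by (simp add: sum scale point sum_divide_distrib)
  finally show ?thesis .
qed

end

section \<open>Triangles on a common arc\<close>

text \<open>
  For an arc from 0 to 1, the vertex \<open>w\<close> completes it to a directed triangle.
\<close>

definition cyclic :: "nat \<Rightarrow> (nat \<times> nat) set \<Rightarrow> bool" where
  "cyclic w E \<longleftrightarrow> (1, w) \<in> E \<and> (w, 0) \<in> E"

context random_tournament
begin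

text \<open>
  The second moment of the normalised score of a random vertex; it is 0 exactly for regular limits.
\<close>

definition out_square :: real where
  "out_square = \<E> 3 (\<lambda>E. arc_sign E 0 1 * arc_sign E 0 2)"

text \<open>
  The density of the 4-cycle \<open>0 - 2 - 1 - 3\<close>, weighted with the signs of its arcs.
\<close>

definition four_cycle :: real where
  "four_cycle = \<E> 4 (\<lambda>E. arc_sign E 0 2 * arc_sign E 0 3 * arc_sign E 1 2 * arc_sign E 1 3)"

lemma transpose_antisymmetric:
  assumes "i < n" "j < n" "\<And>E. E \<in> tournaments n \<Longrightarrow> f (pull (Transposition.transpose i j) n E) = - f E"
  shows "\<E> n f = 0"
  using assms by (intro permutation_antisymmetric[of "Transposition.transpose i j"]) (auto intro: permutes_swap_id)

lemma transpose_eq: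
  assumes "i < n" "j < n"
  shows "\<E> n (\<lambda>E. f (pull (Transposition.transpose i j) n E)) = \<E> n f"
  using assms permutes_swap_id[of i "{..<n}" j]
  by (intro pull) (auto simp: permutes_inj_on permutes_image)

text \<open>
  Expand the three indicators \<open>(1 + sign) / 2\<close>. Single arcs and the full triangle vanish because a
  transposition changes their sign; the three paths of length two are each \<open>- out_square\<close>, as the
  two arcs of a directed triangle at a vertex point in opposite directions.
\<close>

lemma triangle_prob:
  "\<E> 3 (\<lambda>E. of_bool ((0, 1) \<in> E) * of_bool (cyclic 2 E)) = (1 - 3 * out_square) / 8"
proof -
  let ?s = arc_sign
  note swaps = arc_sign_swap[of _ 0 1] arc_sign_swap[of _ 0 2] arc_sign_swap[of _ 1 2]
  have 1: "\<E> 3 (\<lambda>E. ?s E 0 1) = 0" "\<E> 3 (\<lambda>E. ?s E 0 1 * ?s E 1 2 * ?s E 0 2) = 0"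
    by (rule transpose_antisymmetric[of 0 _ 1]; simp add: arc_sign_pull Transposition.transpose_def swaps del: One_nat_def)+
  have 2: "\<E> 3 (\<lambda>E. ?s E 1 2) = 0"
    by (rule transpose_antisymmetric[of 1 _ 2]) (simp_all add: arc_sign_pull Transposition.transpose_def swaps del: One_nat_def)
  have 3: "\<E> 3 (\<lambda>E. ?s E 0 2) = 0"
    by (rule transpose_antisymmetric[of 0 _ 2]) (simp_all add: arc_sign_pull Transposition.transpose_def swaps del: One_nat_def)
  have 4: "\<E> 3 (\<lambda>E. ?s E 0 1 * ?s E 1 2) = - out_square"
    using transpose_eq[of 0 3 1 "\<lambda>E. ?s E 0 1 * ?s E 0 2"]
    by (simp add: out_square_def arc_sign_pull Transposition.transpose_def swaps uminus del: One_nat_def)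
  have 5: "\<E> 3 (\<lambda>E. ?s E 0 2 * ?s E 1 2) = out_square"
    using transpose_eq[of 0 3 2 "\<lambda>E. ?s E 0 1 * ?s E 0 2"]
    by (simp add: out_square_def arc_sign_pull Transposition.transpose_def swaps mult.commute del: One_nat_def)
  have "\<E> 3 (\<lambda>E. of_bool ((0, 1) \<in> E) * of_bool (cyclic 2 E)) =
    \<E> 3 (\<lambda>E. (1 / 8) * (1 + ?s E 0 1 + ?s E 1 2 - ?s E 0 2 + ?s E 0 1 * ?s E 1 2
      - ?s E 0 1 * ?s E 0 2 - ?s E 0 2 * ?s E 1 2 - ?s E 0 1 * ?s E 1 2 * ?s E 0 2))"
    by (intro cong) (simp add: cyclic_def of_bool_conj arc_iff_arc_sign[of _ 3] swaps field_simps del: One_nat_def)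
  also have "\<dots> = (1 - 3 * out_square) / 8"
    unfolding scale add diff one 1 2 3 4 5 out_square_def[symmetric] by simp
  finally show ?thesis .
qed

text \<open>
  When the scores are regular, every term of the expansion that contains exactly one of the two arcs
  at the vertex 2, or exactly one of those at the vertex 3, has a leaf there and vanishes. With \<open>A\<close> and
  \<open>B\<close> the products of both signs at 2 and at 3, what is left consists of products of \<open>A\<close>, \<open>B\<close> and the
  arc \<open>0 1\<close>; those with this arc are odd under the transposition of 0 and 1, the paths \<open>A\<close> and \<open>B\<close>
  have leaves again, and \<open>A B\<close> is the signed 4-cycle.
\<close>

lemma two_triangles_prob:
  assumes d2: "out_square = 0"
  shows "\<E> 4 (\<lambda>E. of_bool ((0, 1) \<in> E) * (of_bool (cyclic 2 E) * of_bool (cyclic 3 E))) = (1 + four_cycle) / 32"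
proof -
  let ?s = arc_sign
  define x where "x E i j = (1 + ?s E i j) / 2" for E i j
  define A where "A E = ?s E 1 2 * ?s E 2 0" for E
  define B where "B E = ?s E 1 3 * ?s E 3 0" for E
  define G where "G E = 1 + A E + B E + A E * B E" for E
  have x: "\<bar>x E i j\<bar> \<le> 1" for E i j
    using abs_arc_sign_le[of E i j] by (auto simp: x_def abs_le_iff)
  have x_ign: "ignores q (\<lambda>E. x E i j)" if "i \<noteq> q" "j \<noteq> q" for i j q
    using that by (intro ignoresI) (simp add: x_def arc_sign_def)
  have A_ign: "ignores 3 (\<lambda>E. (1 + A E) / 2)"
    by (intro ignoresI) (simp add: A_def arc_sign_def)
  have A_le: "\<bar>(1 + A E) / 2\<bar> \<le> 1" for E
    using abs_mult_le_1[OF abs_arc_sign_le abs_arc_sign_le, of E 1 2 E 2 0] by (auto simp: A_def abs_le_iff)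
  note leaf = leaf_zero[OF d2[unfolded out_square_def]]
  \<comment> \<open>the cofactors of the terms with one arc at the vertex 2, and of those that remain with one arc at 3\<close>
  define w where "w E = x E 0 1 * (x E 1 3 * x E 3 0)" for E
  define w' where "w' E = x E 0 1 * ((1 + A E) / 2)" for E
  have "ignores 2 w" "\<bar>w E\<bar> \<le> 1" for E
    unfolding w_def by (intro ignores_mult x_ign abs_mult_le_1 x; simp)+
  hence w: "\<E> 4 (\<lambda>E. ?s E 1 2 * w E) = 0" "\<E> 4 (\<lambda>E. ?s E 0 2 * w E) = 0"
    by (intro leaf; simp)+
  have "ignores 3 w'" "\<bar>w' E\<bar> \<le> 1" for E
    unfolding w'_def by (intro ignores_mult x_ign A_ign abs_mult_le_1 x A_le; simp)+
  hence w': "\<E> 4 (\<lambda>E. ?s E 1 3 * w' E) = 0" "\<E> 4 (\<lambda>E. ?s E 0 3 * w' E) = 0"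
    by (intro leaf; simp)+
  have "A = (\<lambda>E. - (?s E 2 1 * ?s E 2 0))" "B = (\<lambda>E. - (?s E 3 1 * ?s E 3 0))"
    by (simp_all add: fun_eq_iff A_def B_def arc_sign_swap[of _ 1 2] arc_sign_swap[of _ 1 3] del: One_nat_def)
  hence AB0: "\<E> 4 A = 0" "\<E> 4 B = 0"
    by (simp_all only: uminus, simp_all add: leaf ignores_arc_sign abs_arc_sign_le del: One_nat_def)
  have AB: "\<E> 4 (\<lambda>E. A E * B E) = four_cycle"
    unfolding four_cycle_def by (intro cong)
      (simp add: A_def B_def arc_sign_swap[of _ 0 2] arc_sign_swap[of _ 0 3] mult_ac del: One_nat_def)
  have sG: "\<E> 4 (\<lambda>E. ?s E 0 1 * G E) = 0"
  proof (rule transpose_antisymmetric[of 0 _ 1])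
    fix E
    let ?E = "pull (Transposition.transpose 0 1) 4 E"
    have "A ?E = A E" "B ?E = B E"
      by (simp_all add: A_def B_def arc_sign_pull Transposition.transpose_def arc_sign_swap[of _ 0 2]
        arc_sign_swap[of _ 0 3] arc_sign_swap[of _ 2 1] arc_sign_swap[of _ 3 1] del: One_nat_def)
    thus "?s ?E 0 1 * G ?E = - (?s E 0 1 * G E)"
      by (simp add: G_def arc_sign_pull Transposition.transpose_def arc_sign_swap[of E 0 1] del: One_nat_def)
  qed auto
  have "\<E> 4 (\<lambda>E. of_bool ((0, 1) \<in> E) * (of_bool (cyclic 2 E) * of_bool (cyclic 3 E))) =
    \<E> 4 (\<lambda>E. (1 / 4) * (?s E 1 2 * w E) - (1 / 4) * (?s E 0 2 * w E)
       + (1 / 8) * (?s E 1 3 * w' E) - (1 / 8) * (?s E 0 3 * w' E)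
       + (1 / 32) * (G E + ?s E 0 1 * G E))"
  proof (rule cong)
    fix E assume E: "E \<in> tournaments 4"
    have "of_bool ((0, 1) \<in> E) * (of_bool (cyclic 2 E) * of_bool (cyclic 3 E)) =
        x E 0 1 * ((x E 1 2 * x E 2 0) * (x E 1 3 * x E 3 0))"
      using E by (simp add: cyclic_def of_bool_conj arc_iff_arc_sign[of _ 4] x_def)
    also have "\<dots> = (1 / 4) * (?s E 1 2 * w E) - (1 / 4) * (?s E 0 2 * w E)
       + (1 / 8) * (?s E 1 3 * w' E) - (1 / 8) * (?s E 0 3 * w' E)
       + (1 / 32) * (G E + ?s E 0 1 * G E)"
      unfolding w_def w'_def G_def A_def B_def x_def arc_sign_swap[of E 0 2] arc_sign_swap[of E 0 3]
      by (simp add: field_simps)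
    finally show "of_bool ((0, 1) \<in> E) * (of_bool (cyclic 2 E) * of_bool (cyclic 3 E)) = \<dots>" .
  qed
  also have "\<dots> = (1 / 32) * \<E> 4 G"
    unfolding scale add diff w w' sG by simp
  also have "\<E> 4 G = 1 + four_cycle"
    by (simp add: G_def[abs_def] add one AB0 AB)
  finally show ?thesis by simp
qed

lemma out_square_uniform:
  assumes "\<And>h. \<E> 3 h = (\<Sum>T\<in>tournaments 3. h T) / 2 ^ (3 choose 2)"
  shows "out_square = 0"
  unfolding out_square_def assms
  by (subst sum_tournaments_flip[of 0 _ 1]) (auto simp: arc_sign_flip[of _ 3] doubleton_eq_iff)

lemma four_cycle_uniform:
  assumes "\<And>h. \<E> 4 h = (\<Sum>T\<in>tournaments 4. h T) / 2 ^ (4 choose 2)"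
  shows "four_cycle = 0"
  unfolding four_cycle_def assms
  by (subst sum_tournaments_flip[of 0 _ 2]) (auto simp: arc_sign_flip[of _ 4] doubleton_eq_iff)

text \<open>
  The first probability forces regularity, which makes the second one detect the signed 4-cycle density;
  both are then 0, and this characterises the uniform law.
\<close>

theorem triangle_probs_iff_uniform:
  "\<E> 3 (\<lambda>E. of_bool ((0, 1) \<in> E) * of_bool (cyclic 2 E)) = 1 / 8 \<and>
   \<E> 4 (\<lambda>E. of_bool ((0, 1) \<in> E) * (of_bool (cyclic 2 E) * of_bool (cyclic 3 E))) = 1 / 32 \<longleftrightarrow>
   (\<forall>n h. \<E> n h = (\<Sum>T\<in>tournaments n. h T) / 2 ^ (n choose 2))"
    (is "?P3 \<and> ?P4 \<longleftrightarrow> ?U")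
proof
  assume P: "?P3 \<and> ?P4"
  hence d: "out_square = 0" using triangle_prob by simp
  with P have "four_cycle = 0" using two_triangles_prob by simp
  thus ?U using expectation_uniform unfolding four_cycle_def by blast
next
  assume ?U
  hence d: "out_square = 0" and "four_cycle = 0"
    by (intro out_square_uniform four_cycle_uniform; blast)+
  thus "?P3 \<and> ?P4" using triangle_prob two_triangles_prob[OF d] by simp
qed

end

section \<open>Random samples of vertices\<close>

definition injections :: "nat set \<Rightarrow> nat set \<Rightarrow> (nat \<Rightarrow> nat) set" where
  "injections D V = {x \<in> D \<rightarrow>\<^sub>E V. inj_on x D}"

lemma finite_injections: "finite D \<Longrightarrow> finite V \<Longrightarrow> finite (injections D V)"
  by (rule finite_subset[of _ "D \<rightarrow>\<^sub>E V"]) (auto simp: injections_def intro: finite_PiE)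

lemma card_injections:
  "finite D \<Longrightarrow> finite V \<Longrightarrow> card (injections D V) = (\<Prod>i<card D. card V - i)"
  using card_inj_on_subset_funcset[of D V D] by (simp add: injections_def lessThan_atLeast0)

lemma card_injections_pos:
  "finite D \<Longrightarrow> finite V \<Longrightarrow> card D \<le> card V \<Longrightarrow> 0 < card (injections D V)"
  by (auto simp: card_injections intro!: prod_pos)

lemma injections_image_card:
  "x \<in> injections D V \<Longrightarrow> card (x ` D) = card D"
  "x \<in> injections D V \<Longrightarrow> x ` D \<subseteq> V"
  by (auto simp: injections_def card_image)

lemma avg_reindex: "bij_betw t A B \<Longrightarrow> avg B g = avg A (\<lambda>x. g (t x))"
  using avg_image[of t A g] by (simp add: bij_betw_def)

lemma compose_injections:
  assumes "x \<in> injections D V" "inj_on f V" "f ` V \<subseteq> W"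
  shows "restrict (f \<circ> x) D \<in> injections D W"
proof -
  have "x ` D \<subseteq> V" "inj_on x D" using assms(1) by (auto simp: injections_def)
  hence "inj_on (f \<circ> x) D" "(f \<circ> x) ` D \<subseteq> W"
    using assms(2,3) by (auto intro: comp_inj_on inj_on_subset)
  thus ?thesis by (auto simp: injections_def)
qed

lemma injections_compose:
  assumes "z \<in> injections S V" "inj_on y D" "y ` D \<subseteq> S"
  shows "restrict (z \<circ> y) D \<in> injections D V"
proof -
  have "z ` S \<subseteq> V" "inj_on z S" using assms(1) by (auto simp: injections_def)
  hence "inj_on (z \<circ> y) D" "(z \<circ> y) ` D \<subseteq> V"
    using assms(2,3) by (auto intro: comp_inj_on inj_on_subset)
  thus ?thesis by (auto simp: injections_def)
qed

lemma bij_betw_injections_target: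
  assumes "bij_betw f V W"
  shows "bij_betw (\<lambda>x. restrict (f \<circ> x) D) (injections D V) (injections D W)"
proof (rule bij_betw_byWitness[where f' = "\<lambda>x. restrict (inv_into V f \<circ> x) D"])
  have inj: "inj_on f V" and im: "f ` V = W" using assms by (auto simp: bij_betw_def)
  show "\<forall>x\<in>injections D V. restrict (inv_into V f \<circ> restrict (f \<circ> x) D) D = x"
    using inj by (auto simp: injections_def fun_eq_iff restrict_def PiE_def extensional_def Pi_def)
  show "\<forall>x\<in>injections D W. restrict (f \<circ> restrict (inv_into V f \<circ> x) D) D = x"
    using im by (auto simp: injections_def fun_eq_iff restrict_def PiE_def extensional_def Pi_def f_inv_into_f)
  show "(\<lambda>x. restrict (f \<circ> x) D) ` injections D V \<subseteq> injections D W"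
    using inj im compose_injections[of _ D V f W] by blast
  have "inj_on (inv_into V f) W" "inv_into V f ` W \<subseteq> V"
    using im by (auto simp: inj_on_inv_into inv_into_into)
  thus "(\<lambda>x. restrict (inv_into V f \<circ> x) D) ` injections D W \<subseteq> injections D V"
    using compose_injections[of _ D W "inv_into V f" V] by blast
qed

lemma bij_betw_injections_source:
  assumes "bij_betw y D S"
  shows "bij_betw (\<lambda>z. restrict (z \<circ> y) D) (injections S V) (injections D V)"
proof (rule bij_betw_byWitness[where f' = "\<lambda>z. restrict (z \<circ> inv_into D y) S"])
  have inj: "inj_on y D" and im: "y ` D = S" using assms by (auto simp: bij_betw_def)
  have i: "inv_into D y s \<in> D" "y (inv_into D y s) = s" if "s \<in> S" for s
    using that im by (auto simp: inv_into_into f_inv_into_f)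
  have y: "y d \<in> S" "inv_into D y (y d) = d" if "d \<in> D" for d
    using that im inj by auto
  show "\<forall>z\<in>injections S V. restrict (restrict (z \<circ> y) D \<circ> inv_into D y) S = z"
    using i by (auto simp: injections_def fun_eq_iff restrict_def PiE_def extensional_def Pi_def)
  show "\<forall>z\<in>injections D V. restrict (restrict (z \<circ> inv_into D y) S \<circ> y) D = z"
    using y by (auto simp: injections_def fun_eq_iff restrict_def PiE_def extensional_def Pi_def)
  show "(\<lambda>z. restrict (z \<circ> y) D) ` injections S V \<subseteq> injections D V"
    using injections_compose[of _ S V y D] inj im by blast
  have "inj_on (inv_into D y) S" "inv_into D y ` S \<subseteq> D"
    using im by (auto simp: inj_on_inv_into inv_into_into)
  thus "(\<lambda>z. restrict (z \<circ> inv_into D y) S) ` injections D V \<subseteq> injections S V"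
    using injections_compose[of _ D V "inv_into D y" S] by blast
qed

text \<open>
  An extension of \<open>z\<close> is an injection of the remaining points into the complement of the range of \<open>z\<close>.
  The point is that their number does not depend on \<open>z\<close>.
\<close>

lemma card_injections_extending:
  assumes D: "finite D" "S \<subseteq> D" and V: "finite V" and z: "z \<in> injections S V"
  shows "card {x \<in> injections D V. restrict x S = z} = (\<Prod>i<card D - card S. card V - card S - i)"
proof -
  have zi: "z i \<in> V" if "i \<in> S" for i using z that by (auto simp: injections_def)
  have z': "inj_on z S" "z ` S \<subseteq> V" "z \<in> S \<rightarrow>\<^sub>E V" using z by (auto simp: injections_def)
  let ?X = "{x \<in> injections D V. restrict x S = z}"
  let ?ext = "\<lambda>w i. if i \<in> S then z i else w i"
  have "bij_betw (\<lambda>x. restrict x (D - S)) ?X (injections (D - S) (V - z ` S))"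
  proof (rule bij_betw_byWitness[where f' = ?ext])
    show "\<forall>x\<in>?X. ?ext (restrict x (D - S)) = x"
      using D(2) by (auto simp: injections_def fun_eq_iff restrict_def PiE_def extensional_def)
    show "\<forall>w\<in>injections (D - S) (V - z ` S). restrict (?ext w) (D - S) = w"
      by (auto simp: injections_def fun_eq_iff restrict_def PiE_def extensional_def)
    show "(\<lambda>x. restrict x (D - S)) ` ?X \<subseteq> injections (D - S) (V - z ` S)"
    proof safe
      fix x assume x: "x \<in> injections D V" "z = restrict x S"
      have "x i \<noteq> x j" if "i \<in> D - S" "j \<in> S" for i j
        using x(1) that D(2) by (auto simp: injections_def inj_on_def)
      thus "restrict x (D - S) \<in> injections (D - S) (V - restrict x S ` S)"
        using x(1) by (auto simp: injections_def inj_on_def)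
    qed
    show "?ext ` injections (D - S) (V - z ` S) \<subseteq> ?X"
    proof safe
      fix w assume w: "w \<in> injections (D - S) (V - z ` S)"
      have wi: "w i \<in> V" "w i \<notin> z ` S" if "i \<in> D" "i \<notin> S" for i
        using w that by (auto simp: injections_def)
      have wj: "i = j" if "i \<in> D" "i \<notin> S" "j \<in> D" "j \<notin> S" "w i = w j" for i j
        using w that by (auto simp: injections_def inj_on_def)
      have "?ext w \<in> D \<rightarrow>\<^sub>E V"
        using w wi zi D(2) by (auto simp: injections_def PiE_def extensional_def)
      moreover have "inj_on (?ext w) D"
      proof (rule inj_onI)
        fix i j assume ij: "i \<in> D" "j \<in> D" "?ext w i = ?ext w j"
        show "i = j"
        proof (cases "i \<in> S"; cases "j \<in> S")
          assume "i \<in> S" "j \<in> S" thus ?thesis using ij(3) z'(1) by (auto dest: inj_onD)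
        next
          assume "i \<in> S" "j \<notin> S" thus ?thesis using ij wi(2)[of j] by (metis imageI)
        next
          assume "i \<notin> S" "j \<in> S" thus ?thesis using ij wi(2)[of i] by (metis imageI)
        next
          assume "i \<notin> S" "j \<notin> S" thus ?thesis using ij wj by simp
        qed
      qed
      ultimately show "?ext w \<in> injections D V" by (simp add: injections_def)
      show "restrict (?ext w) S = z"
        using z'(3) by (auto simp: fun_eq_iff restrict_def PiE_def extensional_def)
    qed
  qed
  hence "card ?X = card (injections (D - S) (V - z ` S))" by (rule bij_betw_same_card)
  also have "card (V - z ` S) = card V - card S"
    using injections_image_card[OF z] V by (metis card_Diff_subset finite_subset)
  moreover have "card (D - S) = card D - card S"
    using D by (meson card_Diff_subset finite_subset)
  ultimately show ?thesis using D(1) V by (simp add: card_injections)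
qed

text \<open>
  The restriction of a uniformly random injection is a uniformly random injection, because all fibres
  of the restriction map have the same size.
\<close>

lemma avg_restrict_injections:
  assumes D: "finite D" "S \<subseteq> D" and V: "finite V" "card D \<le> card V"
  shows "avg (injections D V) (\<lambda>x. g (restrict x S)) = avg (injections S V) g"
proof -
  have S: "finite S" "card S \<le> card D" using D by (auto intro: finite_subset card_mono)
  have r: "{z \<in> injections S V. restrict x S = z} = {restrict x S}" if "x \<in> injections D V" for x
    using that D(2) by (auto simp: injections_def intro: inj_on_subset)
  have "avg (injections D V) (\<lambda>x. g (restrict x S)) =
      avg (injections D V) (\<lambda>x. avg {z \<in> injections S V. restrict x S = z} g)"
    by (rule avg_cong[OF refl]) (simp add: r avg_def)
  also have "\<dots> = avg (injections S V) g"
  proof (rule avg_regular)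
    show "0 < (\<Prod>i<card D - card S. card V - card S - i)"
      using V(2) S(2) by (auto intro!: prod_pos)
    show "card {x \<in> injections D V. restrict x S = z} = (\<Prod>i<card D - card S. card V - card S - i)"
      if "z \<in> injections S V" for z
      by (rule card_injections_extending[OF D V(1) that])
  qed (use S D V in \<open>auto simp: finite_injections r\<close>)
  finally show ?thesis .
qed

lemma avg_compose_injections:
  assumes "inj_on y {..<n}" "y ` {..<n} \<subseteq> {..<N}" "finite V" "N \<le> card V"
  shows "avg (injections {..<N} V) (\<lambda>x. g (restrict (x \<circ> y) {..<n})) = avg (injections {..<n} V) g"
proof -
  let ?S = "y ` {..<n}"
  have "avg (injections {..<n} V) g = avg (injections ?S V) (\<lambda>z. g (restrict (z \<circ> y) {..<n}))"
    using assms(1) by (intro avg_reindex bij_betw_injections_source) (simp add: bij_betw_def)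
  also have "\<dots> = avg (injections {..<N} V) (\<lambda>x. g (restrict (restrict x ?S \<circ> y) {..<n}))"
    using assms by (intro avg_restrict_injections[symmetric]) auto
  also have "\<dots> = avg (injections {..<N} V) (\<lambda>x. g (restrict (x \<circ> y) {..<n}))"
    by (intro avg_cong arg_cong[of _ _ g]) (auto simp: fun_eq_iff restrict_def)
  finally show ?thesis ..
qed

text \<open>
  The expectation of \<open>h\<close> at the tournament that \<open>n\<close> distinct random vertices of \<open>G\<close> induce, numbered in the
  order in which they are drawn.
\<close>

definition sample :: "nat \<Rightarrow> ((nat \<times> nat) set \<Rightarrow> real) \<Rightarrow> ty_0 cflag \<Rightarrow> real" where
  "sample n h G = avg (injections {..<n} (verts G)) (\<lambda>x. h (pull x n (arcs G)))"

lemma pull_pull: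
  "y ` {..<n} \<subseteq> {..<N} \<Longrightarrow> pull y n (pull x N E) = pull (restrict (x \<circ> y) {..<n}) n E"
  by (auto simp: pull_def)

lemma sample_iso:
  assumes "flag_isomorphism F G f"
  shows "sample n h F = sample n h G"
proof -
  have b: "bij_betw f (verts F) (verts G)" and
    a: "\<And>u v. u \<in> verts F \<Longrightarrow> v \<in> verts F \<Longrightarrow> (f u, f v) \<in> arcs G \<longleftrightarrow> (u, v) \<in> arcs F"
    using assms by (auto simp: flag_isomorphism_def)
  have "sample n h G = avg (injections {..<n} (verts F)) (\<lambda>x. h (pull (restrict (f \<circ> x) {..<n}) n (arcs G)))"
    unfolding sample_def by (rule avg_reindex[OF bij_betw_injections_target[OF b]])
  also have "\<dots> = sample n h F"
    unfolding sample_def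
  proof (rule avg_cong[OF refl])
    fix x assume "x \<in> injections {..<n} (verts F)"
    hence "x i \<in> verts F" if "i < n" for i using that by (auto simp: injections_def)
    hence "pull (restrict (f \<circ> x) {..<n}) n (arcs G) = pull x n (arcs F)"
      using a by (auto simp: pull_def)
    thus "h (pull (restrict (f \<circ> x) {..<n}) n (arcs G)) = h (pull x n (arcs F))" by simp
  qed
  finally show ?thesis by simp
qed

lemma sample_pull:
  assumes "inj_on y {..<n}" "y ` {..<n} \<subseteq> {..<N}" "N \<le> card (verts G)"
  shows "sample N (\<lambda>E. h (pull y n E)) G = sample n h G"
  unfolding sample_def pull_pull[OF assms(2)]
  by (rule avg_compose_injections[OF assms(1,2) finite_verts assms(3)])

lemma labels_Nil [simp]: "labels (G :: ty_0 cflag) = []"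
  using is_flag_cflag[of G] by (simp add: is_flag_def type_size_ty_0_def)

text \<open>
  Drawing \<open>n\<close> vertices in order amounts to drawing a set of \<open>n\<close> vertices and then ordering it. This turns
  ordered samples into the unordered densities of flags.
\<close>

lemma sample_induced:
  assumes "n \<le> card (verts G)"
  shows "avg (flag_sets n G) (\<lambda>W. sample n h (induced G W)) = sample n h G"
proof -
  let ?A = "injections {..<n} (verts G)" and ?R = "\<lambda>x W. x ` {..<n} \<subseteq> W"
  have B: "W \<subseteq> verts G" "card W = n" "finite W" if "W \<in> flag_sets n G" for W
    using that finite_subset[OF _ finite_verts[of G]] by (auto simp: flag_sets_def)
  have r: "{x \<in> ?A. ?R x W} = injections {..<n} W" if "W \<in> flag_sets n G" for W
    using B[OF that] by (auto simp: injections_def PiE_def)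
  have "avg (flag_sets n G) (\<lambda>W. sample n h (induced G W)) =
     avg (flag_sets n G) (\<lambda>W. avg {x \<in> ?A. ?R x W} (\<lambda>x. h (pull x n (arcs G))))"
  proof (rule avg_cong[OF refl])
    fix W assume W: "W \<in> flag_sets n G"
    have "pull x n (arcs G \<inter> W \<times> W) = pull x n (arcs G)" if "x \<in> injections {..<n} W" for x
      using that by (auto simp: pull_def injections_def)
    thus "sample n h (induced G W) = avg {x \<in> ?A. ?R x W} (\<lambda>x. h (pull x n (arcs G)))"
      unfolding sample_def r[OF W] using B[OF W] by (intro avg_cong) (simp_all add: induced_simps)
  qed
  also have "\<dots> = avg ?A (\<lambda>x. h (pull x n (arcs G)))"
  proof (rule avg_regular)
    show "card {x \<in> ?A. ?R x W} = card (injections {..<n} {..<n})" if "W \<in> flag_sets n G" for W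
      using B[OF that] by (simp add: r[OF that] card_injections)
    show "card {W \<in> flag_sets n G. ?R x W} = 1" if x: "x \<in> ?A" for x
    proof -
      have "W = x ` {..<n}" if "W \<in> flag_sets n G" "?R x W" for W
        using card_subset_eq[OF B(3)[OF that(1)] that(2)] B(2)[OF that(1)] injections_image_card[OF x] by simp
      hence "{W \<in> flag_sets n G. ?R x W} = {x ` {..<n}}"
        using injections_image_card[OF x] by (auto simp: flag_sets_def)
      thus ?thesis by simp
    qed
  qed (auto simp: finite_flag_sets finite_injections finite_verts card_injections_pos)
  finally show ?thesis by (simp add: sample_def)
qed

definition sample_class :: "nat \<Rightarrow> ((nat \<times> nat) set \<Rightarrow> real) \<Rightarrow> ty_0 flag \<Rightarrow> real" where
  "sample_class n h G = sample n h (rep_flag G)"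

lemma sample_class: "sample_class n h (flag_class G) = sample n h G"
proof -
  have "flag_iso (rep_flag (flag_class G)) G"
    by (simp add: Quotient3_abs_rep[OF Quotient3_flag] flip: flag_class_eq_iff)
  thus ?thesis by (auto simp: sample_class_def flag_iso_def intro: sample_iso)
qed

lemma abs_flag_alg_sum:
  "abs_flag_alg (\<Sum>H\<in>I. Poly_Mapping.single H (c H)) = (\<Sum>H\<in>I. c H *\<^sub>R of_flag H)"
proof (induction I rule: infinite_finite_induct)
  case (insert H I)
  have "abs_flag_alg (Poly_Mapping.single H (c H)) = c H *\<^sub>R of_flag H"
    using single_scaleR[of H "c H" 1] by (simp add: of_flag_def scaleR_flag_alg.abs_eq)
  thus ?case using insert by (simp flip: plus_flag_alg.abs_eq)
qed (simp_all add: zero_flag_alg_def)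

text \<open>
  The relations that define the flag algebra, read through a linear functional.
\<close>

lemma of_flag_relation:
  assumes "linear \<psi>" "flag_size F \<le> m"
  shows "\<psi> (of_flag F) = (\<Sum>G | flag_size G = m. flag_density F G * \<psi> (of_flag G))"
proof -
  have "Poly_Mapping.single F 1 - (\<Sum>H | flag_size H = m. Poly_Mapping.single H (flag_density F H)) \<in> flag_relations"
    unfolding flag_relations_def using assms(2) by (intro span_base) auto
  hence "of_flag F = abs_flag_alg (\<Sum>H | flag_size H = m. Poly_Mapping.single H (flag_density F H))"
    unfolding of_flag_def by (simp add: flag_alg.abs_eq_iff)
  thus ?thesis
    by (simp add: abs_flag_alg_sum linear_sum[OF assms(1)] linear_scale[OF assms(1)])
qed

section \<open>The random tournament of a positive homomorphism\<close>

lemma verts_unit_cflag: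
  "verts (Abs_cflag ({..<type_size TYPE('s)}, type_arcs TYPE('s), [0..<type_size TYPE('s)]) :: 's::tournament_type cflag) = {..<type_size TYPE('s)}"
  by (rule cflag_Abs[OF is_flag_unit])

lemma flag_size_unit: "flag_size (unit_flag :: 's::tournament_type flag) = type_size TYPE('s)"
  by (simp add: unit_flag_def flag_size.abs_eq verts_unit_cflag)

text \<open>
  The labelled vertices induce a copy of the type, by the very definition of a flag; hence the unit has
  density 1 in every flag.
\<close>

lemma flag_class_labels:
  fixes G :: "'s::tournament_type cflag"
  shows "cls G (set (labels G)) = unit_flag"
proof -
  let ?k = "type_size TYPE('s)"
  let ?U = "Abs_cflag ({..<?k}, type_arcs TYPE('s), [0..<?k]) :: 's cflag"
  note U = cflag_Abs[OF is_flag_unit[where 's = 's]]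
  note I = induced_simps[OF order_refl labels_subset[of G]]
  have G: "length (labels G) = ?k" "distinct (labels G)"
    "\<And>i j. i < ?k \<Longrightarrow> j < ?k \<Longrightarrow> (labels G ! i, labels G ! j) \<in> arcs G \<longleftrightarrow> (i, j) \<in> type_arcs TYPE('s)"
    using is_flag_cflag[of G] by (simp_all add: is_flag_def)
  have "bij_betw ((!) (labels G)) {..<?k} (set (labels G))"
    using bij_betw_nth[OF G(2)] G(1) by simp
  moreover have "map ((!) (labels G)) [0..<?k] = labels G"
    using map_nth[of "labels G"] G(1) by simp
  ultimately have "flag_isomorphism ?U (induced G (set (labels G))) ((!) (labels G))"
    unfolding flag_isomorphism_def U I using G by auto
  thus ?thesis
    unfolding unit_flag_def flag_class_eq_iff by (auto simp: flag_iso_def dest: flag_isomorphism_sym)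
qed

lemma flag_density_unit: "flag_density unit_flag G = 1"
proof (cases G)
  case (abs_flag G0)
  have "W = set (labels G0)" if "set (labels G0) \<subseteq> W" "W \<subseteq> verts G0" "card W = type_size TYPE('a)" for W
    using card_subset_eq[OF finite_subset[OF that(2) finite_verts] that(1)] that(3)
    by (simp add: card_labels)
  hence "flag_sets (flag_size (unit_flag :: 'a flag)) G0 = {set (labels G0)}"
    using labels_subset[of G0] by (auto simp: flag_sets_def flag_size_unit card_labels)
  thus ?thesis by (simp add: abs_flag density_avg avg_def flag_class_labels)
qed

lemma of_flag_unit: "of_flag unit_flag = 1"
  by (simp add: of_flag_def one_flag_alg_def)

lemma sum_flags_of_size:
  assumes "\<psi> \<in> pos_homs" "type_size TYPE('s) \<le> m"
  shows "(\<Sum>G | flag_size G = m. \<psi> (of_flag (G :: 's::tournament_type flag))) = 1"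
proof -
  have "\<psi> (of_flag unit_flag) = (\<Sum>G | flag_size G = m. flag_density unit_flag G * \<psi> (of_flag G))"
    using assms by (intro of_flag_relation) (auto simp: pos_homs_def flag_size_unit)
  thus ?thesis using assms(1) by (simp add: flag_density_unit of_flag_unit pos_homs_def)
qed

lemma hom_of_flag_bounds:
  assumes "\<psi> \<in> pos_homs"
  shows "0 \<le> \<psi> (of_flag F)" "\<psi> (of_flag F) \<le> 1"
proof -
  show nn: "0 \<le> \<psi> (of_flag F)" for F using assms by (simp add: pos_homs_def)
  have "\<psi> (of_flag F) \<le> (\<Sum>G | flag_size G = flag_size F. \<psi> (of_flag G))"
    by (rule member_le_sum) (auto simp: nn finite_flags_of_size)
  thus "\<psi> (of_flag F) \<le> 1" using sum_flags_of_size[OF assms flag_size_ge[of F]] by simp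
qed

lemma hom_of_flag_mult:
  assumes "\<psi> \<in> pos_homs"
  shows "\<psi> (of_flag F1) * \<psi> (of_flag (F2 :: 's::tournament_type flag)) =
    (\<Sum>H | flag_size H = flag_size F1 + flag_size F2 - type_size TYPE('s).
      joint_density F1 F2 H * \<psi> (of_flag H))"
proof -
  have lin: "linear \<psi>" using assms by (simp add: pos_homs_def)
  have "\<psi> (of_flag F1) * \<psi> (of_flag F2) = \<psi> (of_flag F1 * of_flag F2)"
    using assms by (simp add: pos_homs_def)
  also have "of_flag F1 * of_flag F2 = abs_flag_alg (flag_product F1 F2)"
    by (simp add: of_flag_def times_flag_alg.abs_eq bilinear_product_single)
  finally show ?thesis
    by (simp add: flag_product_def abs_flag_alg_sum linear_sum[OF lin] linear_scale[OF lin])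
qed

text \<open>
  The exchangeable random tournament encoded by \<open>\<phi>\<close>: an isomorphism class of size \<open>n\<close> is drawn with the
  probabilities \<open>\<phi>\<close>, and its vertices are numbered at random.
\<close>

definition law :: "(ty_0 flag_alg \<Rightarrow> real) \<Rightarrow> nat \<Rightarrow> ((nat \<times> nat) set \<Rightarrow> real) \<Rightarrow> real" where
  "law \<phi> n h = (\<Sum>G | flag_size G = n. \<phi> (of_flag G) * sample_class n h G)"

lemma sample_class_cases:
  assumes "flag_size G = n" "\<And>G0. G = flag_class G0 \<Longrightarrow> card (verts G0) = n \<Longrightarrow> P (sample n h G0)"
  shows "P (sample_class n h G)"
  using assms by (cases G) (auto simp: sample_class flag_size.abs_eq)

lemma pull_flag_tournament:
  assumes "x \<in> injections {..<n} (verts G)"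
  shows "pull x n (arcs G) \<in> tournaments n"
  using assms is_flag_cflag[of G]
  by (intro pull_tournament[of "verts G"]) (auto simp: injections_def is_flag_def)

text \<open>
  Consistency is the chain rule for densities: a sample of \<open>n\<close> vertices from a class of size \<open>N\<close> is a
  sample from a random subset of size \<open>n\<close>, and the relations of the flag algebra say that the class
  of this subset is distributed according to \<open>\<phi>\<close> again.
\<close>

lemma random_tournament_law:
  assumes "\<phi> \<in> pos_homs"
  shows "random_tournament (law \<phi>)"
proof
  have lin: "linear \<phi>" using assms by (simp add: pos_homs_def)
  fix n and f h :: "(nat \<times> nat) set \<Rightarrow> real" and c :: real
  show "law \<phi> n (\<lambda>E. f E + h E) = law \<phi> n f + law \<phi> n h"
    by (simp add: law_def sample_class_def sample_def avg_def sum.distrib add_divide_distrib algebra_simps)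
  show "law \<phi> n (\<lambda>E. c * f E) = c * law \<phi> n f"
    by (simp add: law_def sample_class_def sample_def avg_def mult_ac flip: sum_distrib_left)
      (simp add: sum_distrib_left mult_ac)
  show "0 \<le> law \<phi> n f" if nn: "\<And>E. E \<in> tournaments n \<Longrightarrow> 0 \<le> f E"
    unfolding law_def
  proof (intro sum_nonneg mult_nonneg_nonneg hom_of_flag_bounds(1)[OF assms])
    fix G :: "ty_0 flag"
    show "0 \<le> sample_class n f G"
      unfolding sample_class_def sample_def avg_def
      by (intro divide_nonneg_nonneg sum_nonneg nn pull_flag_tournament) auto
  qed
  have "sample_class n (\<lambda>_. 1) G = 1" if "flag_size G = n" for G
    using that
    by (intro sample_class_cases[of G n "\<lambda>x. x = 1"])
      (use card_injections_pos[of "{..<n}"] in \<open>auto simp: sample_def avg_def finite_verts\<close>)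
  thus "law \<phi> n (\<lambda>_. 1) = 1"
    using sum_flags_of_size[OF assms, of n] by (simp add: law_def type_size_ty_0_def)
  fix y :: "nat \<Rightarrow> nat" and N :: nat assume y: "inj_on y {..<n}" "y ` {..<n} \<subseteq> {..<N}"
  have nN: "n \<le> N" using card_inj_on_le[OF y] by simp
  \<comment> \<open>first draw the set of the sampled vertices, then their order\<close>
  have "sample_class N (\<lambda>E. f (pull y n E)) G = (\<Sum>H | flag_size H = n. flag_density H G * sample_class n f H)"
    if "flag_size G = N" for G
  proof (cases G)
    case (abs_flag G0)
    have N: "card (verts G0) = N" using that by (simp add: abs_flag flag_size.abs_eq)
    have "sample_class N (\<lambda>E. f (pull y n E)) G = sample n f G0"
      using sample_pull[OF y] N by (simp add: abs_flag sample_class)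
    also have "\<dots> = avg (flag_sets n G0) (\<lambda>W. sample_class n f (cls G0 W))"
      using sample_induced[of n G0 f] nN N by (simp add: sample_class)
    finally show ?thesis by (simp add: sum_density abs_flag)
  qed
  hence "law \<phi> N (\<lambda>E. f (pull y n E)) =
      (\<Sum>G | flag_size G = N. \<Sum>H | flag_size H = n. \<phi> (of_flag G) * (flag_density H G * sample_class n f H))"
    by (simp add: law_def sum_distrib_left)
  also have "\<dots> = (\<Sum>H | flag_size H = n. (\<Sum>G | flag_size G = N. flag_density H G * \<phi> (of_flag G)) * sample_class n f H)"
    by (subst sum.swap) (simp add: sum_distrib_left sum_distrib_right mult_ac)
  also have "\<dots> = law \<phi> n f"
    unfolding law_def using of_flag_relation[OF lin, of _ N] nN by (intro sum.cong) auto
  finally show "law \<phi> N (\<lambda>E. f (pull y n E)) = law \<phi> n f" .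
qed

lemma flag_class_pull:
  assumes fl: "is_flag TYPE('s::tournament_type) V E (map x ls)"
    and x: "bij_betw x {..<n} V" and ls: "set ls \<subseteq> {..<n}"
  shows "is_flag TYPE('s) {..<n} (pull x n E) ls"
    "flag_class (Abs_cflag ({..<n}, pull x n E, ls) :: 's cflag) = flag_class (Abs_cflag (V, E, map x ls))"
proof -
  have "pull x n E \<in> tournaments n"
    using fl x by (intro pull_tournament[of V]) (auto simp: is_flag_def bij_betw_def)
  moreover have "ls ! i < n" if "i < length ls" for i using ls that by (auto dest: nth_mem)
  ultimately show fl': "is_flag TYPE('s) {..<n} (pull x n E) ls"
    using fl ls by (auto simp: is_flag_def tournaments_def distinct_map pull_def)
  have "flag_isomorphism (Abs_cflag ({..<n}, pull x n E, ls) :: 's cflag) (Abs_cflag (V, E, map x ls)) x"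
    unfolding flag_isomorphism_def cflag_Abs[OF fl] cflag_Abs[OF fl'] using x by (auto simp: pull_def)
  thus "flag_class (Abs_cflag ({..<n}, pull x n E, ls) :: 's cflag) = flag_class (Abs_cflag (V, E, map x ls))"
    by (auto simp: flag_class_eq_iff flag_iso_def)
qed

lemma is_flag_0: "is_flag TYPE(ty_0) V E [] \<longleftrightarrow> tournament V E"
  by (simp add: is_flag_def type_size_ty_0_def)

lemma bij_injection:
  assumes "x \<in> injections {..<n} V" "finite V" "card V = n"
  shows "bij_betw x {..<n} V"
  using injections_image_card[OF assms(1)] card_subset_eq[OF assms(2), of "x ` {..<n}"] assms
  by (auto simp: bij_betw_def injections_def)

lemma cflag_eq: "Abs_cflag (verts G, arcs G, labels G) = G"
  by (simp add: verts_def arcs_def labels_def Rep_cflag_inverse)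

definition tournament_class :: "nat \<Rightarrow> (nat \<times> nat) set \<Rightarrow> ty_0 flag" where
  "tournament_class n E = flag_class (Abs_cflag ({..<n}, E, []))"

lemma tournament_class_pull:
  assumes "x \<in> injections {..<n} (verts G)" "card (verts G) = n"
  shows "tournament_class n (pull x n (arcs G)) = flag_class (G :: ty_0 cflag)"
proof -
  have "is_flag TYPE(ty_0) (verts G) (arcs G) (map x [])"
    using is_flag_cflag[of G] by simp
  from flag_class_pull(2)[OF this bij_injection[OF assms(1) finite_verts assms(2)]]
  show ?thesis using cflag_eq[of G] by (simp add: tournament_class_def)
qed

lemma law_tournament_class:
  assumes "flag_size F = n"
  shows "law \<phi> n (\<lambda>E. of_bool (tournament_class n E = F)) = \<phi> (of_flag F)"
proof -
  have "sample_class n (\<lambda>E. of_bool (tournament_class n E = F)) G = of_bool (G = F)" if "flag_size G = n" for G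
  proof (cases G)
    case (abs_flag G0)
    have n: "card (verts G0) = n" using that by (simp add: abs_flag flag_size.abs_eq)
    have "sample n (\<lambda>E. of_bool (tournament_class n E = F)) G0 =
        avg (injections {..<n} (verts G0)) (\<lambda>_. of_bool (G = F))"
      unfolding sample_def by (intro avg_cong) (simp_all add: tournament_class_pull n abs_flag)
    also have "\<dots> = of_bool (G = F)"
      using card_injections_pos[of "{..<n}" "verts G0"] n by (simp add: avg_def finite_verts)
    finally show ?thesis by (simp add: abs_flag sample_class)
  qed
  hence "law \<phi> n (\<lambda>E. of_bool (tournament_class n E = F)) =
      (\<Sum>G | flag_size G = n. of_bool (F = G) * \<phi> (of_flag G))"
    unfolding law_def by (intro sum.cong) auto
  thus ?thesis using sum_of_bool_flag[OF assms] by simp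
qed

section \<open>The quasi-random homomorphism\<close>

lemma cflag_0:
  assumes "T \<in> tournaments n"
  shows "verts (Abs_cflag ({..<n}, T, []) :: ty_0 cflag) = {..<n}"
    "arcs (Abs_cflag ({..<n}, T, []) :: ty_0 cflag) = T"
  using cflag_Abs[where V = "{..<n}" and E = T and ls = "[]" and 's = ty_0] assms
  by (auto simp: is_flag_0 tournaments_def)

lemma flag_size_tournament_class: "T \<in> tournaments n \<Longrightarrow> flag_size (tournament_class n T) = n"
  by (simp add: tournament_class_def flag_size.abs_eq cflag_0)

lemma pull_comp: "y ` {..<n} \<subseteq> {..<n} \<Longrightarrow> pull (x \<circ> y) n E = pull y n (pull x n E)"
  by (auto simp: pull_def)

lemma pull_id: "E \<in> tournaments n \<Longrightarrow> (\<And>i. i < n \<Longrightarrow> x i = i) \<Longrightarrow> pull x n E = E"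
  by (auto simp: pull_def tournaments_def tournament_def)

lemma permutes_less_iff: "p permutes {..<n} \<Longrightarrow> p i < n \<longleftrightarrow> i < (n::nat)"
  using permutes_in_image[of p "{..<n}" i] by simp

text \<open>
  Orbit--stabiliser for the symmetric group acting on tournaments by pullback: the orbit of \<open>T\<close> consists
  of the labelled copies of its class, and the stabiliser is its automorphism group.
\<close>

lemma card_labelled_copies:
  assumes "flag_size G = n"
  shows "card {E \<in> tournaments n. tournament_class n E = G} * automorphism_count G = fact n"
proof -
  obtain G0 where G0: "G = flag_class G0" by (rule flag_cases)
  have "card (verts G0) = n" using assms by (simp add: G0 flag_size.abs_eq)
  then obtain x where x: "x \<in> injections {..<n} (verts G0)"
    using card_injections_pos[of "{..<n}" "verts G0"] by (force simp: finite_verts card_gt_0_iff)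
  define T where "T = pull x n (arcs G0)"
  have T: "T \<in> tournaments n" unfolding T_def by (rule pull_flag_tournament[OF x])
  have GT: "tournament_class n T = G"
    unfolding T_def G0 by (rule tournament_class_pull[OF x \<open>card (verts G0) = n\<close>])
  let ?F = "Abs_cflag ({..<n}, T, []) :: ty_0 cflag"
  let ?P = "{p. p permutes {..<n}}"
  let ?A = "{p \<in> ?P. pull p n T = T}"
  have Tsub: "T \<subseteq> {..<n} \<times> {..<n}" using T by (auto simp: tournaments_def tournament_def)
  have iso: "flag_isomorphism ?F (Abs_cflag ({..<n}, E, [])) p \<longleftrightarrow> pull p n E = T"
    if "p permutes {..<n}" "E \<in> tournaments n" for p E
    unfolding flag_isomorphism_def cflag_0[OF T] cflag_0[OF that(2)]
    using permutes_imp_bij[OF that(1)] Tsub by (auto simp: pull_def)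
  have "automorphisms ?F = ?A"
    unfolding automorphisms_def cflag_0[OF T] using iso T by auto
  hence aut: "automorphism_count G = card ?A"
    by (simp add: tournament_class_def automorphism_count.abs_eq flip: GT)
  have im: "(\<lambda>p. pull p n T) ` ?P = {E \<in> tournaments n. tournament_class n E = G}"
  proof (intro equalityI subsetI)
    fix E assume "E \<in> (\<lambda>p. pull p n T) ` ?P"
    then obtain p where p: "p permutes {..<n}" "E = pull p n T" by auto
    have E: "E \<in> tournaments n"
      using T p by (auto intro!: pull_tournaments[of T n] simp: permutes_inj_on permutes_less_iff)
    have "flag_class (Abs_cflag ({..<n}, pull p n T, []) :: ty_0 cflag) = flag_class (Abs_cflag ({..<n}, T, map p []))"
      using T permutes_imp_bij[OF p(1)] by (intro flag_class_pull(2)) (auto simp: is_flag_0 tournaments_def)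
    thus "E \<in> {E \<in> tournaments n. tournament_class n E = G}"
      using E p(2) by (simp add: tournament_class_def flip: GT)
  next
    fix E assume E: "E \<in> {E \<in> tournaments n. tournament_class n E = G}"
    hence "flag_iso (Abs_cflag ({..<n}, E, []) :: ty_0 cflag) ?F"
      by (simp add: tournament_class_def flag_class_eq_iff flip: GT)
    then obtain f where f: "flag_isomorphism (Abs_cflag ({..<n}, E, [])) ?F f" by (auto simp: flag_iso_def)
    define p where "p = (\<lambda>i. if i < n then f i else i)"
    have E': "E \<in> tournaments n" using E by simp
    have f': "bij_betw f {..<n} {..<n}" "\<And>u v. u < n \<Longrightarrow> v < n \<Longrightarrow> (f u, f v) \<in> T \<longleftrightarrow> (u, v) \<in> E"
      using f unfolding flag_isomorphism_def cflag_0[OF T] cflag_0[OF E'] by auto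
    have "bij_betw p {..<n} {..<n}" using f'(1) bij_betw_cong[of "{..<n}" p f "{..<n}"] by (simp add: p_def)
    hence "p permutes {..<n}" by (rule bij_imp_permutes) (simp add: p_def)
    moreover have "pull p n T = E"
      using f'(2) E' by (auto simp: pull_def p_def tournaments_def tournament_def)
    ultimately show "E \<in> (\<lambda>p. pull p n T) ` ?P" by auto
  qed
  have fibre: "card {p \<in> ?P. pull p n T = E} = card ?A" if E: "E \<in> (\<lambda>p. pull p n T) ` ?P" for E
  proof -
    obtain r where r: "r permutes {..<n}" "E = pull r n T" using E by blast
    have ri: "inv r permutes {..<n}" by (rule permutes_inv[OF r(1)])
    have c: "r \<circ> inv r = id" "inv r \<circ> r = id" using permutes_inv_o[OF r(1)] by auto
    have comp: "pull (p \<circ> q) n T = pull q n (pull p n T)" if "q permutes {..<n}" for p q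
      using that by (intro pull_comp) (simp add: permutes_image)
    \<comment> \<open>the fibre is a coset of the stabiliser\<close>
    have "bij_betw (\<lambda>p. p \<circ> r) ?A {p \<in> ?P. pull p n T = E}"
    proof (rule bij_betw_byWitness[where f' = "\<lambda>p. p \<circ> inv r"])
      show "\<forall>p\<in>?A. (p \<circ> r) \<circ> inv r = p" using c by (simp add: comp_assoc)
      show "\<forall>p\<in>{p \<in> ?P. pull p n T = E}. (p \<circ> inv r) \<circ> r = p" using c by (simp add: comp_assoc)
      show "(\<lambda>p. p \<circ> r) ` ?A \<subseteq> {p \<in> ?P. pull p n T = E}"
        using r by (auto simp: comp intro: permutes_compose)
      have "pull (inv r) n E = T"
        using comp[OF ri, of r] c(1) pull_id[OF T, of id] r(2) by simp
      hence "pull (p \<circ> inv r) n T = T" if "pull p n T = E" for p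
        using that by (simp only: comp[OF ri])
      thus "(\<lambda>p. p \<circ> inv r) ` {p \<in> ?P. pull p n T = E} \<subseteq> ?A"
        using ri permutes_compose by blast
    qed
    thus ?thesis by (simp add: bij_betw_same_card)
  qed
  have "fact n = card ?P" by (simp add: card_permutations)
  also have "\<dots> = (\<Sum>E\<in>(\<lambda>p. pull p n T) ` ?P. card {p \<in> ?P. pull p n T = E})"
    using sum.image_gen[of ?P "\<lambda>_. 1::nat" "\<lambda>p. pull p n T"] by (simp add: finite_permutations)
  also have "\<dots> = (\<Sum>E\<in>(\<lambda>p. pull p n T) ` ?P. card ?A)" by (intro sum.cong refl fibre)
  also have "\<dots> = card ((\<lambda>p. pull p n T) ` ?P) * card ?A" by simp
  finally show ?thesis by (simp add: im aut)
qed

text \<open>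
  This identifies \<open>phi_qr\<close> with the law of the isomorphism class of a uniformly random labelled tournament.
\<close>

lemma phi_qr_eq:
  assumes "flag_size G = n"
  shows "phi_qr G = card {E \<in> tournaments n. tournament_class n E = G} / 2 ^ (n choose 2)"
proof -
  have "real (card {E \<in> tournaments n. tournament_class n E = G}) * real (automorphism_count G) = fact n"
    using card_labelled_copies[OF assms] by (metis of_nat_fact of_nat_mult)
  moreover from this have "automorphism_count G \<noteq> 0" by (intro notI) simp
  ultimately show ?thesis by (simp add: phi_qr_def assms field_simps)
qed

lemma sum_tournaments_pull:
  assumes "x \<in> injections {..<n} {..<n}"
  shows "(\<Sum>E\<in>tournaments n. h (pull x n E)) = (\<Sum>E\<in>tournaments n. h E :: real)"
proof (rule sum.reindex_bij_betw)
  have x: "bij_betw x {..<n} {..<n}" using assms by (intro bij_injection) auto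
  let ?y = "inv_into {..<n} x"
  have y: "bij_betw ?y {..<n} {..<n}" by (rule bij_betw_inv_into[OF x])
  have im: "x ` {..<n} = {..<n}" "?y ` {..<n} = {..<n}" using x y by (auto simp: bij_betw_def)
  have xy: "x (?y i) = i" "?y (x i) = i" if "i < n" for i
    using that x by (auto simp: bij_betw_inv_into_left bij_betw_inv_into_right)
  show "bij_betw (pull x n) (tournaments n) (tournaments n)"
  proof (rule bij_betw_byWitness[where f' = "pull ?y n"])
    show "\<forall>E\<in>tournaments n. pull ?y n (pull x n E) = E"
      by (intro ballI, subst pull_comp[symmetric]) (simp_all add: im xy pull_id)
    show "\<forall>E\<in>tournaments n. pull x n (pull ?y n E) = E"
      by (intro ballI, subst pull_comp[symmetric]) (simp_all add: im xy pull_id)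
  qed (use x y im in \<open>auto intro!: pull_tournaments simp: bij_betw_def\<close>)
qed

text \<open>
  In one direction, numbering the vertices of a uniformly random tournament anew leaves its law
  unchanged; in the other, the value of \<open>\<phi>\<close> at a class is the probability of this class under \<open>law \<phi>\<close>.
\<close>

theorem phi_qr_iff_uniform:
  "hom_point \<phi> = phi_qr \<longleftrightarrow>
   (\<forall>n h. law \<phi> n h = (\<Sum>T\<in>tournaments n. h T) / 2 ^ (n choose 2))"
proof
  assume qr: "hom_point \<phi> = phi_qr"
  show "\<forall>n h. law \<phi> n h = (\<Sum>T\<in>tournaments n. h T) / 2 ^ (n choose 2)"
  proof (intro allI)
    fix n h
    let ?I = "injections {..<n} {..<n}"
    have I: "card ?I > 0" by (rule card_injections_pos) auto
    have "law \<phi> n h = (\<Sum>G | flag_size G = n. phi_qr G * sample_class n h G)"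
      unfolding law_def qr[symmetric] by (simp add: hom_point_def)
    also have "\<dots> = (\<Sum>G | flag_size G = n. \<Sum>E | E \<in> tournaments n \<and> tournament_class n E = G.
        sample_class n h (tournament_class n E)) / 2 ^ (n choose 2)"
      by (simp add: phi_qr_eq sum_divide_distrib)
    also have "(\<Sum>G | flag_size G = n. \<Sum>E | E \<in> tournaments n \<and> tournament_class n E = G.
        sample_class n h (tournament_class n E)) = (\<Sum>E\<in>tournaments n. sample_class n h (tournament_class n E))"
      by (rule sum.group) (auto simp: finite_tournaments finite_flags_of_size flag_size_tournament_class)
    also have "\<dots> = (\<Sum>E\<in>tournaments n. avg ?I (\<lambda>x. h (pull x n E)))"
      by (intro sum.cong refl) (simp add: tournament_class_def sample_class sample_def cflag_0)
    also have "\<dots> = avg ?I (\<lambda>x. \<Sum>E\<in>tournaments n. h (pull x n E))"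
      by (rule avg_sum)
    also have "\<dots> = avg ?I (\<lambda>x. \<Sum>E\<in>tournaments n. h E)"
      by (intro avg_cong refl sum_tournaments_pull)
    also have "\<dots> = (\<Sum>E\<in>tournaments n. h E)"
      using I by (simp add: avg_def)
    finally show "law \<phi> n h = (\<Sum>T\<in>tournaments n. h T) / 2 ^ (n choose 2)" .
  qed
next
  assume u: "\<forall>n h. law \<phi> n h = (\<Sum>T\<in>tournaments n. h T) / 2 ^ (n choose 2)"
  show "hom_point \<phi> = phi_qr"
  proof
    fix F :: "ty_0 flag"
    let ?n = "flag_size F"
    have "hom_point \<phi> F = law \<phi> ?n (\<lambda>E. of_bool (tournament_class ?n E = F))"
      by (simp add: hom_point_def law_tournament_class)
    also have "\<dots> = phi_qr F"
      by (simp add: u phi_qr_eq finite_tournaments Int_def)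
    finally show "hom_point \<phi> F = phi_qr F" .
  qed
qed

section \<open>Flags with a labelled arc\<close>

text \<open>
  The candidates for the labels of a flag whose unlabelled tournament has the vertex set \<open>V\<close>.
\<close>

definition tuples :: "'s::tournament_type itself \<Rightarrow> nat set \<Rightarrow> nat list set" where
  "tuples s V = {ls. length ls = type_size s \<and> distinct ls \<and> set ls \<subseteq> V}"

lemma finite_tuples: "finite V \<Longrightarrow> finite (tuples s V)"
  by (rule finite_subset[of _ "{ls. set ls \<subseteq> V \<and> length ls = type_size s}"])
    (auto simp: tuples_def finite_lists_length_eq)

lemma avg_of_bool: "finite A \<Longrightarrow> avg A (\<lambda>x. of_bool (P x)) = real (card {x \<in> A. P x}) / real (card A)"
  by (simp add: avg_def Int_def)

text \<open>
  The factor of the downward operator, computed in a fixed representative \<open>G\<close> of the unlabelled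
  tournament: it is the probability that random labels turn \<open>G\<close> into \<open>F\<close>.
\<close>

lemma label_prob_underlying:
  fixes F :: "'s::tournament_type flag"
  shows "of_bool (underlying F = flag_class G) * label_prob F =
    avg (tuples TYPE('s) (verts G)) (\<lambda>ls. of_bool (is_flag TYPE('s) (verts G) (arcs G) ls \<and>
      flag_class (Abs_cflag (verts G, arcs G, ls)) = F))"
proof (cases "underlying F = flag_class G")
  case True
  obtain F0 where F0: "F = flag_class F0" by (rule flag_cases)
  have "flag_iso (unlabelled F0) G"
    using True by (simp add: F0 underlying.abs_eq flag_class_eq_iff)
  then obtain f where f: "flag_isomorphism (unlabelled F0) G f" by (auto simp: flag_iso_def)
  let ?ls = "map f (labels F0)"
  have b: "bij_betw f (verts F0) (verts G)"
    and a: "\<And>u v. u \<in> verts F0 \<Longrightarrow> v \<in> verts F0 \<Longrightarrow> (f u, f v) \<in> arcs G \<longleftrightarrow> (u, v) \<in> arcs F0"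
    using f by (auto simp: flag_isomorphism_def unlabelled_simps)
  have F: "length (labels F0) = type_size TYPE('s)" "distinct (labels F0)" "set (labels F0) \<subseteq> verts F0"
    "\<And>i j. i < type_size TYPE('s) \<Longrightarrow> j < type_size TYPE('s) \<Longrightarrow>
      (labels F0 ! i, labels F0 ! j) \<in> arcs F0 \<longleftrightarrow> (i, j) \<in> type_arcs TYPE('s)"
    using is_flag_cflag[of F0] by (simp_all add: is_flag_def)
  have l: "labels F0 ! i \<in> verts F0" if "i < type_size TYPE('s)" for i
    using that F(1,3) by (metis nth_mem subsetD)
  have "set ?ls \<subseteq> verts G" using F(3) b by (auto simp: bij_betw_def)
  hence fl: "is_flag TYPE('s) (verts G) (arcs G) ?ls"
    using is_flag_cflag[of G] F b
    by (auto simp: is_flag_def a l distinct_map bij_betw_def intro: inj_on_subset)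
  let ?F1 = "Abs_cflag (verts G, arcs G, ?ls) :: 's cflag"
  note F1 = cflag_Abs[OF fl]
  have "flag_isomorphism F0 ?F1 f"
    unfolding flag_isomorphism_def F1 using b a by simp
  hence F1c: "F = flag_class ?F1" by (auto simp: F0 flag_class_eq_iff flag_iso_def)
  have "label_prob F = real (card {ls \<in> tuples TYPE('s) (verts G).
       is_flag TYPE('s) (verts G) (arcs G) ls \<and> flag_class (Abs_cflag (verts G, arcs G, ls)) = F}) /
     real (card (tuples TYPE('s) (verts G)))"
    unfolding F1c label_prob.abs_eq label_tuples_def relabelled_def F1 tuples_def flag_class_eq_iff ..
  thus ?thesis using True by (simp only: avg_of_bool[OF finite_tuples[OF finite_verts]] of_bool_eq mult_1 simp_thms)
next
  case False
  have "flag_class (Abs_cflag (verts G, arcs G, ls)) \<noteq> F" if "is_flag TYPE('s) (verts G) (arcs G) ls" for ls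
  proof
    assume "flag_class (Abs_cflag (verts G, arcs G, ls)) = F"
    hence "underlying F = flag_class (unlabelled (Abs_cflag (verts G, arcs G, ls) :: 's cflag))"
      by (simp flip: underlying.abs_eq)
    also have "unlabelled (Abs_cflag (verts G, arcs G, ls) :: 's cflag) = G"
      using cflag_eq[of G] by (simp add: unlabelled_def cflag_Abs[OF that])
    finally show False using False by simp
  qed
  hence "{ls \<in> tuples TYPE('s) (verts G). is_flag TYPE('s) (verts G) (arcs G) ls \<and>
      flag_class (Abs_cflag (verts G, arcs G, ls)) = F} = {}" by blast
  thus ?thesis
    using False by (simp only: avg_of_bool[OF finite_tuples[OF finite_verts]]) simp
qed

lemma is_flag_A:
  assumes "tournament V E"
  shows "is_flag TYPE(ty_A) V E [u, v] \<longleftrightarrow> (u, v) \<in> E"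
proof
  assume "is_flag TYPE(ty_A) V E [u, v]"
  hence "\<forall>i<2. \<forall>j<2. ([u, v] ! i, [u, v] ! j) \<in> E \<longleftrightarrow> (i, j) = (0, 1)"
    by (simp add: is_flag_def type_size_ty_A_def type_arcs_ty_A_def)
  from this[rule_format, of 0 1] show "(u, v) \<in> E" by simp
next
  assume uv: "(u, v) \<in> E"
  hence V: "u \<in> V" "v \<in> V" "(u, u) \<notin> E" "(v, v) \<notin> E" using assms by (auto simp: tournament_def)
  hence ne: "u \<noteq> v" using uv by auto
  hence "(v, u) \<notin> E" using tournament_arcs[OF assms V(1,2)] uv by blast
  hence "([u, v] ! i, [u, v] ! j) \<in> E \<longleftrightarrow> (i, j) \<in> {(0, 1)}" if "i < 2" "j < 2" for i j
    using that uv V by (auto simp: less_2_cases_iff)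
  thus "is_flag TYPE(ty_A) V E [u, v]"
    using assms V ne by (simp add: is_flag_def type_size_ty_A_def type_arcs_ty_A_def)
qed

text \<open>
  Labelling two random vertices of a tournament with \<open>m\<close> vertices can be done by numbering all of them
  and labelling the first two.
\<close>

lemma avg_tuples_A:
  assumes "finite V" "card V = m" "2 \<le> m"
  shows "avg (tuples TYPE(ty_A) V) g = avg (injections {..<m} V) (\<lambda>x. g [x 0, x 1])"
proof -
  have "bij_betw (\<lambda>z. [z 0, z 1]) (injections {..<2} V) (tuples TYPE(ty_A) V)"
  proof (rule bij_betw_byWitness[where f' = "\<lambda>ls. restrict ((!) ls) {..<2}"])
    show "\<forall>z\<in>injections {..<2} V. restrict ((!) [z 0, z 1]) {..<2} = z"
      by (auto simp: injections_def PiE_def extensional_def fun_eq_iff restrict_def less_2_cases_iff)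
    show "\<forall>ls\<in>tuples TYPE(ty_A) V. [restrict ((!) ls) {..<2} 0, restrict ((!) ls) {..<2} 1] = ls"
      by (auto simp: tuples_def type_size_ty_A_def length_Suc_conv numeral_2_eq_2)
    show "(\<lambda>z. [z 0, z 1]) ` injections {..<2} V \<subseteq> tuples TYPE(ty_A) V"
    proof (rule image_subsetI)
      fix z assume z: "z \<in> injections {..<2} V"
      hence "inj_on z {..<2}" "z ` {..<2} \<subseteq> V" by (auto simp: injections_def)
      hence "z 0 \<noteq> z 1" "z 0 \<in> V" "z 1 \<in> V" by (auto dest: inj_onD)
      thus "[z 0, z 1] \<in> tuples TYPE(ty_A) V" by (simp add: tuples_def type_size_ty_A_def)
    qed
    show "(\<lambda>ls. restrict ((!) ls) {..<2}) ` tuples TYPE(ty_A) V \<subseteq> injections {..<2} V"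
    proof (rule image_subsetI)
      fix ls assume ls: "ls \<in> tuples TYPE(ty_A) V"
      hence "inj_on ((!) ls) {..<2}" "(!) ls ` {..<2} \<subseteq> V"
        by (auto simp: tuples_def type_size_ty_A_def intro: inj_on_nth)
      thus "restrict ((!) ls) {..<2} \<in> injections {..<2} V"
        by (auto simp: injections_def)
    qed
  qed
  hence "avg (tuples TYPE(ty_A) V) g = avg (injections {..<2} V) (\<lambda>z. g [z 0, z 1])"
    by (rule avg_reindex)
  also have "\<dots> = avg (injections {..<m} V) (\<lambda>x. g [restrict (x \<circ> id) {..<2} 0, restrict (x \<circ> id) {..<2} 1])"
    using assms by (intro avg_compose_injections[symmetric]) auto
  finally show ?thesis by simp
qed

text \<open>
  The \<open>A\<close>-flag with the labels 1 and 2 at the vertices 0 and 1; only meaningful when 0 beats 1.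
\<close>

definition arc_class :: "nat \<Rightarrow> (nat \<times> nat) set \<Rightarrow> ty_A flag" where
  "arc_class m E = flag_class (Abs_cflag ({..<m}, E, [0, 1]))"

text \<open>
  Linear combinations of downward images are expectations over \<open>law \<phi>\<close>: draw a tournament, label its first
  two vertices, and count 0 unless the first beats the second.
\<close>

lemma sum_downward:
  fixes c :: "ty_A flag \<Rightarrow> real"
  assumes \<phi>: "\<phi> \<in> pos_homs" and m: "2 \<le> m"
  shows "(\<Sum>F | flag_size F = m. c F * \<phi> (downward F)) =
    law \<phi> m (\<lambda>E. of_bool ((0, 1) \<in> E) * c (arc_class m E))"
proof -
  have lin: "linear \<phi>" using \<phi> by (simp add: pos_homs_def)
  have us: "flag_size (underlying F) = flag_size F" for F :: "ty_A flag"
    by (cases F) (simp add: underlying.abs_eq flag_size.abs_eq unlabelled_simps)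
  have inner: "(\<Sum>F | flag_size F = m. c F * (of_bool (underlying F = G) * label_prob F)) =
      sample_class m (\<lambda>E. of_bool ((0, 1) \<in> E) * c (arc_class m E)) G"
    if "flag_size G = m" for G
  proof (cases G)
    case (abs_flag G0)
    have n: "card (verts G0) = m" using that by (simp add: abs_flag flag_size.abs_eq)
    have t: "tournament (verts G0) (arcs G0)" using is_flag_cflag[of G0] by (simp add: is_flag_def)
    let ?f = "is_flag TYPE(ty_A) (verts G0) (arcs G0)"
    let ?K = "\<lambda>ls. flag_class (Abs_cflag (verts G0, arcs G0, ls)) :: ty_A flag"
    let ?T = "tuples TYPE(ty_A) (verts G0)"
    have "(\<Sum>F | flag_size F = m. c F * (of_bool (underlying F = G) * label_prob F)) =
        (\<Sum>F | flag_size F = m. avg ?T (\<lambda>ls. of_bool (?f ls \<and> ?K ls = F) * c F))"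
      unfolding abs_flag label_prob_underlying
      by (intro sum.cong refl) (subst mult.commute, rule avg_mult)
    also have "\<dots> = avg ?T (\<lambda>ls. \<Sum>F | flag_size F = m. of_bool (?f ls \<and> ?K ls = F) * c F)"
      by (rule avg_sum)
    also have "\<dots> = avg ?T (\<lambda>ls. of_bool (?f ls) * c (?K ls))"
    proof (rule avg_cong[OF refl])
      fix ls
      show "(\<Sum>F | flag_size F = m. of_bool (?f ls \<and> ?K ls = F) * c F) = of_bool (?f ls) * c (?K ls)"
      proof (cases "?f ls")
        case True
        hence "flag_size (?K ls) = m" by (simp add: flag_size.abs_eq cflag_Abs n)
        thus ?thesis using True sum_of_bool_flag[of "?K ls" m c] by simp
      qed simp
    qed
    also have "\<dots> = avg (injections {..<m} (verts G0)) (\<lambda>x. of_bool (?f [x 0, x 1]) * c (?K [x 0, x 1]))"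
      using n m by (intro avg_tuples_A finite_verts) auto
    also have "\<dots> = sample m (\<lambda>E. of_bool ((0, 1) \<in> E) * c (arc_class m E)) G0"
      unfolding sample_def
    proof (rule avg_cong[OF refl])
      fix x assume x: "x \<in> injections {..<m} (verts G0)"
      have "(0, 1) \<in> pull x m (arcs G0) \<longleftrightarrow> ?f [x 0, x 1]"
        using m by (auto simp: is_flag_A[OF t] pull_def)
      moreover have "arc_class m (pull x m (arcs G0)) = ?K [x 0, x 1]" if "?f [x 0, x 1]"
        using flag_class_pull(2)[of "verts G0" "arcs G0" x "[0, 1]" m, OF _ bij_injection[OF x finite_verts n]]
          that m by (simp add: arc_class_def)
      ultimately show "of_bool (?f [x 0, x 1]) * c (?K [x 0, x 1]) =
          of_bool ((0, 1) \<in> pull x m (arcs G0)) * c (arc_class m (pull x m (arcs G0)))"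
        by auto
    qed
    finally show ?thesis by (simp add: abs_flag sample_class)
  qed
  have "(\<Sum>F | flag_size F = m. c F * \<phi> (downward F)) =
      (\<Sum>F | flag_size F = m. \<Sum>G | flag_size G = m.
         \<phi> (of_flag G) * (c F * (of_bool (underlying F = G) * label_prob F)))"
  proof (rule sum.cong[OF refl])
    fix F :: "ty_A flag" assume "F \<in> {F. flag_size F = m}"
    hence "\<phi> (of_flag (underlying F)) = (\<Sum>G | flag_size G = m. of_bool (underlying F = G) * \<phi> (of_flag G))"
      by (subst sum_of_bool_flag) (simp_all add: us)
    thus "c F * \<phi> (downward F) = (\<Sum>G | flag_size G = m.
         \<phi> (of_flag G) * (c F * (of_bool (underlying F = G) * label_prob F)))"
      by (simp add: downward_def linear_scale[OF lin] sum_distrib_left mult_ac)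
  qed
  also have "\<dots> = (\<Sum>G | flag_size G = m. \<phi> (of_flag G) *
      (\<Sum>F | flag_size F = m. c F * (of_bool (underlying F = G) * label_prob F)))"
    by (subst sum.swap) (simp add: sum_distrib_left)
  also have "\<dots> = law \<phi> m (\<lambda>E. of_bool ((0, 1) \<in> E) * c (arc_class m E))"
    unfolding law_def by (simp add: inner)
  finally show ?thesis .
qed

lemma cyclic_flag_iff:
  fixes G :: "ty_A cflag"
  assumes l: "labels G = [0, 1]" and V: "verts G = {0, 1, w}" and w: "w \<noteq> 0" "w \<noteq> 1"
  shows "flag_class G = C3_A \<longleftrightarrow> cyclic w (arcs G)"
proof -
  let ?C = "Abs_cflag ({0, 1, 2}, {(0, 1), (1, 2), (2, 0)}, [0, 1]) :: ty_A cflag"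
  note C = cflag_Abs[OF is_flag_C3_A]
  have t: "tournament (verts G) (arcs G)" and f: "is_flag TYPE(ty_A) (verts G) (arcs G) [0, 1]"
    using is_flag_cflag[of G] l by (auto simp: is_flag_def)
  have e01: "(0, 1) \<in> arcs G" using f is_flag_A[OF t] by simp
  show ?thesis
  proof
    assume "flag_class G = C3_A"
    then obtain f where "flag_isomorphism G ?C f" by (auto simp: C3_A_def flag_class_eq_iff flag_iso_def)
    hence b: "bij_betw f {0, 1, w} {0, 1, 2}" and f: "f 0 = 0" "f 1 = 1"
      and a: "\<And>u v. u \<in> {0, 1, w} \<Longrightarrow> v \<in> {0, 1, w} \<Longrightarrow>
        (f u, f v) \<in> {(0, 1), (1, 2), (2, 0)} \<longleftrightarrow> (u, v) \<in> arcs G"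
      unfolding flag_isomorphism_def C V l by auto
    have "f w \<in> {0, 1, 2}" "f w \<noteq> f 0" "f w \<noteq> f 1"
      using b w by (auto simp: bij_betw_def inj_on_def)
    hence "f w = 2" using f by auto
    thus "cyclic w (arcs G)" using a[of 1 w] a[of w 0] f by (simp add: cyclic_def)
  next
    assume c: "cyclic w (arcs G)"
    let ?f = "\<lambda>i. if i = w then 2 else i"
    have d: "(u, u) \<notin> arcs G" for u using t by (auto simp: tournament_def)
    have "(1, w) \<in> arcs G" "(w, 0) \<in> arcs G" using c by (auto simp: cyclic_def)
    moreover from this e01 have "(w, 1) \<notin> arcs G" "(0, w) \<notin> arcs G" "(1, 0) \<notin> arcs G"
      using tournament_arcs[OF t, of 1 w] tournament_arcs[OF t, of w 0] tournament_arcs[OF t, of 0 1] w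
      by (auto simp: V)
    ultimately have "\<forall>u\<in>{0, 1, w}. \<forall>v\<in>{0, 1, w}. (?f u, ?f v) \<in> {(0, 1), (1, 2), (2, 0)} \<longleftrightarrow> (u, v) \<in> arcs G"
      using w d e01 by simp
    moreover have "bij_betw ?f {0, 1, w} {0, 1, 2}" using w by (auto simp: bij_betw_def inj_on_def)
    ultimately have "flag_isomorphism G ?C ?f"
      unfolding flag_isomorphism_def C V l using w by simp
    thus "flag_class G = C3_A" by (auto simp: C3_A_def flag_class_eq_iff flag_iso_def)
  qed
qed

lemma cflag_A:
  assumes "E \<in> tournaments m" "(0, 1) \<in> E"
  shows "verts (Abs_cflag ({..<m}, E, [0, 1]) :: ty_A cflag) = {..<m}"
    "arcs (Abs_cflag ({..<m}, E, [0, 1]) :: ty_A cflag) = E"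
    "labels (Abs_cflag ({..<m}, E, [0, 1]) :: ty_A cflag) = [0, 1]"
  using cflag_Abs[where V = "{..<m}" and E = E and ls = "[0, 1]" and 's = ty_A] assms
  by (auto simp: is_flag_A tournaments_def)

lemma flag_size_C3_A: "flag_size C3_A = 3"
  by (simp add: C3_A_def flag_size.abs_eq cflag_Abs[OF is_flag_C3_A] del: One_nat_def)

lemma arc_class_3:
  assumes "E \<in> tournaments 3" "(0, 1) \<in> E"
  shows "arc_class 3 E = C3_A \<longleftrightarrow> cyclic 2 E"
proof -
  have "{..<3} = {0, 1, 2 :: nat}" by auto
  thus ?thesis
    using cyclic_flag_iff[of "Abs_cflag ({..<3}, E, [0, 1])" 2] cflag_A[OF assms]
    by (simp add: arc_class_def del: One_nat_def)
qed

lemma arc_class_2: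
  assumes "E \<in> tournaments 2" "(0, 1) \<in> E"
  shows "arc_class 2 E = unit_flag"
proof -
  have sub: "E \<subseteq> {..<2} \<times> {..<2}"
    using assms(1) unfolding tournaments_def tournament_def by blast
  hence loop: "(i, i) \<notin> E" for i
    using assms(1) unfolding tournaments_def tournament_def by blast
  have rev: "(1, 0) \<notin> E" using tournaments_arcs[OF assms(1), of 0 1] assms(2) by simp
  have only: "i = 0 \<and> j = 1" if ij: "(i, j) \<in> E" for i j
  proof -
    have "i = 0 \<or> i = 1" "j = 0 \<or> j = 1" using ij sub by auto
    thus ?thesis using ij loop rev by blast
  qed
  have "E \<subseteq> {(0, 1)}" by (rule subrelI) (use only in blast)
  hence "E = {(0, 1)}" using assms(2) by blast
  moreover have "[0..<2] = [0, 1 :: nat]" by (simp add: upt_rec)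
  ultimately show ?thesis
    by (simp add: arc_class_def unit_flag_def type_size_ty_A_def type_arcs_ty_A_def)
qed

text \<open>
  In a flag with four vertices the two unlabelled ones can be distributed over the two small flags in
  exactly two ways, and both give the same indicator.
\<close>

lemma joint_density_C3:
  assumes "E \<in> tournaments 4" "(0, 1) \<in> E"
  shows "joint_density C3_A C3_A (arc_class 4 E) = of_bool (cyclic 2 E) * of_bool (cyclic 3 E)"
proof -
  let ?G = "Abs_cflag ({..<4}, E, [0, 1]) :: ty_A cflag"
  note G = cflag_A[OF assms] cflag_A[OF assms, unfolded One_nat_def]
  have W: "W = {0, 1, 2} \<or> W = {0, 1, 3}" if "W \<subseteq> {..<4}" "{0, 1} \<subseteq> W" "card W = 3" for W :: "nat set"
  proof -
    have sub: "W \<subseteq> {0, 1, 2, 3}" using that(1) by auto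
    have "W = {0, 1} \<union> (W \<inter> {2, 3})" using sub that(2) by blast
    moreover have "W \<inter> {2, 3} = {} \<or> W \<inter> {2, 3} = {2} \<or> W \<inter> {2, 3} = {3} \<or> W \<inter> {2, 3} = {2, 3}" by blast
    ultimately have "W = {0, 1} \<or> W = {0, 1, 2} \<or> W = {0, 1, 3} \<or> W = {0, 1, 2, 3}"
      by (elim disjE) (simp_all add: insert_commute)
    thus ?thesis using that(3) by (elim disjE) simp_all
  qed
  have pairs: "flag_set_pairs 3 3 ?G = {({0, 1, 2}, {0, 1, 3}), ({0, 1, 3}, {0, 1, 2})}"
  proof (intro equalityI subsetI)
    fix p assume "p \<in> flag_set_pairs 3 3 ?G"
    then obtain W1 W2 where p: "p = (W1, W2)" "W1 \<subseteq> {..<4}" "W2 \<subseteq> {..<4}" "card W1 = 3" "card W2 = 3"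
      "W1 \<inter> W2 = {0, 1}" by (auto simp: flag_set_pairs_def G)
    have "{0, 1} \<subseteq> W1" "{0, 1} \<subseteq> W2" using p(6) by blast+
    hence W12: "W1 = {0, 1, 2} \<or> W1 = {0, 1, 3}" "W2 = {0, 1, 2} \<or> W2 = {0, 1, 3}"
      using W p(2-5) by blast+
    have "W1 \<noteq> W2"
    proof
      assume "W1 = W2"
      hence "card W1 = card {0, 1 :: nat}" using p(6) by simp
      thus False using p(4) by simp
    qed
    with W12 show "p \<in> {({0, 1, 2}, {0, 1, 3}), ({0, 1, 3}, {0, 1, 2})}"
      unfolding p(1) by (elim disjE) simp_all
  qed (auto simp: flag_set_pairs_def G)
  have c: "cls ?G {0, 1, w} = C3_A \<longleftrightarrow> cyclic w E" if "w \<in> {2, 3}" for w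
  proof -
    have s: "set (labels ?G) \<subseteq> {0, 1, w}" "{0, 1, w} \<subseteq> verts ?G" using that by (auto simp: G)
    have "cls ?G {0, 1, w} = C3_A \<longleftrightarrow> cyclic w (arcs (induced ?G {0, 1, w}))"
      by (rule cyclic_flag_iff) (unfold induced_simps[OF s] G, use that in auto)
    also have "\<dots> \<longleftrightarrow> cyclic w E" unfolding induced_simps[OF s] G cyclic_def by auto
    finally show ?thesis .
  qed
  have c2: "cls ?G {0, 1, 2} = C3_A \<longleftrightarrow> cyclic 2 E" and c3: "cls ?G {0, 1, 3} = C3_A \<longleftrightarrow> cyclic 3 E"
    by (rule c, simp)+
  have "2 \<in> {0, 1, 2 :: nat}" "2 \<notin> {0, 1, 3 :: nat}" by simp_all
  hence "({0, 1, 2}, {0, 1, 3}) \<noteq> ({0, 1, 3}, {0, 1, 2 :: nat})" by (metis prod.inject)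
  thus ?thesis
    unfolding arc_class_def joint_density_avg flag_size_C3_A pairs
    by (simp add: avg_def c2 c3 del: One_nat_def)
qed

section \<open>Moments of the random extension\<close>

text \<open>
  All values of a positive homomorphism at flags lie in \<open>[0, 1]\<close>, and evaluation at a flag is a coordinate
  projection, hence Borel measurable.
\<close>

lemma integral_hom_of_flag:
  assumes X: "random_extension \<phi> M X"
  shows "integrable M (\<lambda>\<omega>. X \<omega> (of_flag F))" "integrable M (\<lambda>\<omega>. X \<omega> (of_flag F) * X \<omega> (of_flag F'))"
proof -
  interpret prob_space M using X by (simp add: random_extension_def)
  have [measurable]: "(\<lambda>\<omega>. X \<omega> (of_flag F)) \<in> borel_measurable M" for F
    using measurable_compose[OF _ measurable_product_coordinates, of "\<lambda>\<omega>. hom_point (X \<omega>)" M F] X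
    by (simp add: random_extension_def hom_point_def)
  have b: "\<bar>X \<omega> (of_flag F)\<bar> \<le> 1" if "\<omega> \<in> space M" for \<omega> F
    using hom_of_flag_bounds[of "X \<omega>" F] X that by (auto simp: random_extension_def)
  show "integrable M (\<lambda>\<omega>. X \<omega> (of_flag F))"
    by (rule integrable_const_bound[of _ 1]) (auto intro: AE_I2 b)
  show "integrable M (\<lambda>\<omega>. X \<omega> (of_flag F) * X \<omega> (of_flag F'))"
    by (rule integrable_const_bound[of _ 1]) (auto intro!: AE_I2 abs_mult_le_1 b)
qed

lemma downward_unit:
  assumes "\<phi> \<in> pos_homs"
  shows "\<phi> (downward (unit_flag :: ty_A flag)) = 1 / 2"
proof -
  interpret random_tournament "law \<phi>" by (rule random_tournament_law[OF assms])
  have "\<phi> (downward (unit_flag :: ty_A flag)) =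
      (\<Sum>F | flag_size F = 2. of_bool (unit_flag = F) * \<phi> (downward (F :: ty_A flag)))"
    by (rule sum_of_bool_flag[symmetric]) (simp add: flag_size_unit type_size_ty_A_def)
  also have "\<dots> = law \<phi> 2 (\<lambda>E. of_bool ((0, 1) \<in> E) * of_bool (unit_flag = arc_class 2 E))"
    by (rule sum_downward[OF assms]) simp
  also have "\<dots> = law \<phi> 2 (\<lambda>E. (1 / 2) * (1 + arc_sign E 0 1))"
  proof (rule cong)
    fix E assume E: "E \<in> tournaments 2"
    have "of_bool ((0, 1) \<in> E) * of_bool (unit_flag = arc_class 2 E) = (of_bool ((0, 1) \<in> E) :: real)"
      using arc_class_2[OF E] by auto
    also have "\<dots> = (1 / 2) * (1 + arc_sign E 0 1)"
      using arc_iff_arc_sign[OF E, of 0 1] by simp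
    finally show "of_bool ((0, 1) \<in> E) * of_bool (unit_flag = arc_class 2 E) = (1 / 2) * (1 + arc_sign E 0 1)" .
  qed
  also have "\<dots> = 1 / 2"
  proof -
    have "law \<phi> 2 (\<lambda>E. arc_sign E 0 1) = 0"
      by (rule transpose_antisymmetric[of 0 _ 1])
        (simp_all add: arc_sign_pull Transposition.transpose_def arc_sign_swap[of _ 1 0] del: One_nat_def)
    thus ?thesis unfolding scale add one by simp
  qed
  finally show ?thesis .
qed

text \<open>
  The second moment is again linear in flags: the square of \<open>C3_A\<close> in the flag algebra is a combination of
  flags with four vertices, whose coefficients are the joint densities.
\<close>

lemma extension_moments:
  assumes \<phi>: "\<phi> \<in> pos_homs" and X: "random_extension \<phi> M X"
  shows "(\<integral>\<omega>. X \<omega> (of_flag C3_A) \<partial>M) = 2 * law \<phi> 3 (\<lambda>E. of_bool ((0, 1) \<in> E) * of_bool (cyclic 2 E))"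
    and "(\<integral>\<omega>. X \<omega> (of_flag C3_A) * X \<omega> (of_flag C3_A) \<partial>M) =
      2 * law \<phi> 4 (\<lambda>E. of_bool ((0, 1) \<in> E) * (of_bool (cyclic 2 E) * of_bool (cyclic 3 E)))"
proof -
  interpret random_tournament "law \<phi>" by (rule random_tournament_law[OF \<phi>])
  have E: "(\<integral>\<omega>. X \<omega> (of_flag F) \<partial>M) = 2 * \<phi> (downward F)" for F
    using X downward_unit[OF \<phi>] by (simp add: random_extension_def)
  have "\<phi> (downward C3_A) = (\<Sum>F | flag_size F = 3. of_bool (C3_A = F) * \<phi> (downward F))"
    by (rule sum_of_bool_flag[symmetric]) (rule flag_size_C3_A)
  also have "\<dots> = law \<phi> 3 (\<lambda>E. of_bool ((0, 1) \<in> E) * of_bool (C3_A = arc_class 3 E))"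
    by (rule sum_downward[OF \<phi>]) simp
  also have "\<dots> = law \<phi> 3 (\<lambda>E. of_bool ((0, 1) \<in> E) * of_bool (cyclic 2 E))"
    by (rule cong) (use arc_class_3 in force)
  finally show "(\<integral>\<omega>. X \<omega> (of_flag C3_A) \<partial>M) = 2 * law \<phi> 3 (\<lambda>E. of_bool ((0, 1) \<in> E) * of_bool (cyclic 2 E))"
    by (simp add: E)
  have "(\<integral>\<omega>. X \<omega> (of_flag C3_A) * X \<omega> (of_flag C3_A) \<partial>M) =
      (\<integral>\<omega>. (\<Sum>H | flag_size H = 4. joint_density C3_A C3_A H * X \<omega> (of_flag H)) \<partial>M)"
    using X by (intro Bochner_Integration.integral_cong refl)
      (simp add: random_extension_def hom_of_flag_mult flag_size_C3_A type_size_ty_A_def)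
  also have "\<dots> = (\<Sum>H | flag_size H = 4. joint_density C3_A C3_A H * (2 * \<phi> (downward H)))"
    using integral_hom_of_flag(1)[OF X] by (simp add: Bochner_Integration.integral_sum E)
  also have "\<dots> = 2 * (\<Sum>H | flag_size H = 4. joint_density C3_A C3_A H * \<phi> (downward H))"
    by (simp add: sum_distrib_left mult_ac)
  also have "(\<Sum>H | flag_size H = 4. joint_density C3_A C3_A H * \<phi> (downward H)) =
      law \<phi> 4 (\<lambda>E. of_bool ((0, 1) \<in> E) * joint_density C3_A C3_A (arc_class 4 E))"
    by (rule sum_downward[OF \<phi>]) simp
  also have "\<dots> = law \<phi> 4 (\<lambda>E. of_bool ((0, 1) \<in> E) * (of_bool (cyclic 2 E) * of_bool (cyclic 3 E)))"
    by (rule cong) (use joint_density_C3 in force)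
  finally show "(\<integral>\<omega>. X \<omega> (of_flag C3_A) * X \<omega> (of_flag C3_A) \<partial>M) =
      2 * law \<phi> 4 (\<lambda>E. of_bool ((0, 1) \<in> E) * (of_bool (cyclic 2 E) * of_bool (cyclic 3 E)))" .
qed

text \<open>
  These moments say that \<open>f - c\<close> has second moment 0.
\<close>

lemma AE_constant_iff_moments:
  fixes f :: "'w \<Rightarrow> real"
  assumes "prob_space M" and f: "integrable M f" "integrable M (\<lambda>\<omega>. f \<omega> * f \<omega>)"
  shows "(AE \<omega> in M. f \<omega> = c) \<longleftrightarrow> (\<integral>\<omega>. f \<omega> \<partial>M) = c \<and> (\<integral>\<omega>. f \<omega> * f \<omega> \<partial>M) = c * c"
proof -
  interpret prob_space M by fact
  have int: "integrable M (\<lambda>\<omega>. f \<omega> * f \<omega> - 2 * c * f \<omega> + c * c)"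
    using f by auto
  show ?thesis
  proof
    assume c: "AE \<omega> in M. f \<omega> = c"
    have "(\<integral>\<omega>. f \<omega> \<partial>M) = (\<integral>\<omega>. c \<partial>M)"
      using c f by (intro integral_cong_AE) auto
    moreover have "(\<integral>\<omega>. f \<omega> * f \<omega> \<partial>M) = (\<integral>\<omega>. c * c \<partial>M)"
      using c f by (intro integral_cong_AE) auto
    ultimately show "(\<integral>\<omega>. f \<omega> \<partial>M) = c \<and> (\<integral>\<omega>. f \<omega> * f \<omega> \<partial>M) = c * c"
      by (simp add: prob_space)
  next
    assume m: "(\<integral>\<omega>. f \<omega> \<partial>M) = c \<and> (\<integral>\<omega>. f \<omega> * f \<omega> \<partial>M) = c * c"
    have sq: "(f \<omega> - c)\<^sup>2 = f \<omega> * f \<omega> - 2 * c * f \<omega> + c * c" for \<omega>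
      by (simp add: power2_eq_square algebra_simps)
    have "(\<integral>\<omega>. (f \<omega> - c)\<^sup>2 \<partial>M) = 0"
      unfolding sq using f m by (simp add: prob_space)
    hence "AE \<omega> in M. (f \<omega> - c)\<^sup>2 = 0"
      using int by (subst (asm) integral_nonneg_eq_0_iff_AE) (simp_all add: sq[symmetric])
    thus "AE \<omega> in M. f \<omega> = c" by simp
  qed
qed

theorem theorem3p2:
  fixes \<phi> :: "ty_0 flag_alg \<Rightarrow> real"
    and M :: "'w measure"
    and phiA :: "'w \<Rightarrow> ty_A flag_alg \<Rightarrow> real"
  assumes "\<phi> \<in> pos_homs"
    and "random_extension \<phi> M phiA"
  shows "(AE \<omega> in M. phiA \<omega> (of_flag C3_A) = 1 / 4) \<longleftrightarrow> hom_point \<phi> = phi_qr"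
proof -
  interpret random_tournament "law \<phi>" by (rule random_tournament_law[OF assms(1)])
  have "prob_space M" using assms(2) by (simp add: random_extension_def)
  hence "(AE \<omega> in M. phiA \<omega> (of_flag C3_A) = 1 / 4) \<longleftrightarrow>
      (\<integral>\<omega>. phiA \<omega> (of_flag C3_A) \<partial>M) = 1 / 4 \<and>
      (\<integral>\<omega>. phiA \<omega> (of_flag C3_A) * phiA \<omega> (of_flag C3_A) \<partial>M) = 1 / 4 * (1 / 4)"
    by (rule AE_constant_iff_moments) (rule integral_hom_of_flag[OF assms(2)])+
  also have "\<dots> \<longleftrightarrow>
      law \<phi> 3 (\<lambda>E. of_bool ((0, 1) \<in> E) * of_bool (cyclic 2 E)) = 1 / 8 \<and>
      law \<phi> 4 (\<lambda>E. of_bool ((0, 1) \<in> E) * (of_bool (cyclic 2 E) * of_bool (cyclic 3 E))) = 1 / 32"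
    unfolding extension_moments[OF assms] by auto
  also have "\<dots> \<longleftrightarrow> hom_point \<phi> = phi_qr"
    unfolding triangle_probs_iff_uniform phi_qr_iff_uniform ..
  finally show ?thesis .
qed

end
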